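(* Let $n\ge2$. There exist functions $F\colon\mathbb R^{2\times n}\to\mathbb R$ of the form $$F(A)=\frac{\nu}{2}|A|^2+G(A,\delta(A))\qquad (A=(a_{ij})\in\mathbb R^{2\times n}),$$ where $\nu>0$, $G\colon\mathbb R^{2\times n}\times\mathbb R\to\mathbb R$ is smooth and convex and $\delta(A)=a_{11}a_{22}-a_{12}a_{21}$, such that $\sigma=DF$ satisfies Condition $O_5$ (with $m=2$) and such that for every $k=1,2,\dots$ there is $C_k>0$ with $|D^kF(A)|\le C_k(|A|+1)$ for all $A\in\mathbb R^{2\times n}$.
   Context: $|A|$ is the Frobenius norm; $DF$ is the gradient of $F$, viewed as a map $\mathbb R^{2\times n}\to\mathbb R^{2\times n}$. Wave cone: $\Gamma=\{(p\otimes a,B): p\in\mathbb R^m,\ a\in\mathbb R^n\setminus\{0\},\ B\in\mathbb R^{m\times n},\ Ba=0\}$, $p\otimes a=pa^T$. Write $\rho=(\rho^1,\rho^2)\in\mathbb R^{m\times n}\times\mathbb R^{m\times n}$; $\mathbb B_r,\bar{\mathbb B}_r$ are open/closed balls of radius $r$ about $0$ in this product space. Condition $O_N$ (here $m=2$, $N=5$): $\sigma\colon\mathbb R^{m\times n}\to\mathbb R^{m\times n}$ is continuous with graph $\mathcal K$, and there exist $r_0>0$, $0<\delta_1<\delta_2<1$ and continuous maps $(\kappa_i,\gamma_i)\colon\bar{\mathbb B}_{r_0}\to[1/\delta_2,1/\delta_1]\times\Gamma$ ($1\le i\le N$) with $\sum_i\gamma_i(\rho)=0$ on $\bar{\mathbb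 B}_{r_0}$ such that, with $\pi_1(\rho)=\rho$, $\pi_i(\rho)=\rho+\gamma_1(\rho)+\dots+\gamma_{i-1}(\rho)$, $\xi_i(\rho)=\pi_i(\rho)+\kappa_i(\rho)\gamma_i(\rho)$: (P1)(i) $\xi_i(\rho)\in\mathcal K$ for all $\rho\in\bar{\mathbb B}_{r_0}$; (ii) for $i\ne j$, $\xi_i^1(\bar{\mathbb B}_{r_0})\cap\xi_j^1(\bar{\mathbb B}_{r_0})=\emptyset$ and $\pi_i^1(\bar{\mathbb B}_{r_0})\cap\pi_j^1(\bar{\mathbb B}_{r_0})=\emptyset$; (P2) with $S_i^r(\lambda)=\{\lambda\xi_i(\rho)+(1-\lambda)\pi_i(\rho):\rho\in\mathbb B_r\}$, there is $\delta_0\in(\delta_2,1)$ such that for each $0<r\le r_0$ and $\lambda\in\{0\}\cup[\delta_0,1)$ the sets $S_1^r(\lambda),\dots,S_N^r(\lambda)$ are open and pairwise disjoint. *)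

theory Defs
  imports "HOL-Analysis.Analysis"
begin

text \<open>Matrices in R^(m x n) are rendered as real^'n^'m, entry (i,j) is A$i$j.
  The norm on real^'n^'m is the Frobenius norm.\<close>

fun iter_dderiv :: "('a::real_normed_vector \<Rightarrow> 'b::real_normed_vector) \<Rightarrow> 'a list \<Rightarrow> 'a \<Rightarrow> 'b" where
  "iter_dderiv f [] = f"
| "iter_dderiv f (h # hs) = (\<lambda>x. frechet_derivative (iter_dderiv f hs) (at x) h)"

definition smooth :: "('a::real_normed_vector \<Rightarrow> 'b::real_normed_vector) \<Rightarrow> bool" where
  "smooth f \<longleftrightarrow> (\<forall>hs x. iter_dderiv f hs differentiable (at x))"

definition tensor :: "real^'m \<Rightarrow> real^'n \<Rightarrow> real^'n^'m" where
  "tensor p a = (\<chi> i j. p$i * a$j)"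

definition wave_cone :: "((real^'n^'m) \<times> (real^'n^'m)) set" where
  "wave_cone = {(tensor p a, B) | p a B. a \<noteq> 0 \<and> B *v a = 0}"

definition pi_map :: "(nat \<Rightarrow> 'x \<Rightarrow> 'x::real_vector) \<Rightarrow> nat \<Rightarrow> 'x \<Rightarrow> 'x" where
  "pi_map \<gamma> i \<rho> = \<rho> + (\<Sum>j\<in>{1..<i}. \<gamma> j \<rho>)"

definition xi_map :: "(nat \<Rightarrow> 'x \<Rightarrow> real) \<Rightarrow> (nat \<Rightarrow> 'x \<Rightarrow> 'x::real_vector) \<Rightarrow> nat \<Rightarrow> 'x \<Rightarrow> 'x" where
  "xi_map \<kappa> \<gamma> i \<rho> = pi_map \<gamma> i \<rho> + \<kappa> i \<rho> *\<^sub>R \<gamma> i \<rho>"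

definition S_set :: "(nat \<Rightarrow> 'x \<Rightarrow> real) \<Rightarrow> (nat \<Rightarrow> 'x \<Rightarrow> 'x::real_normed_vector) \<Rightarrow> nat \<Rightarrow> real \<Rightarrow> real \<Rightarrow> 'x set" where
  "S_set \<kappa> \<gamma> i r t = (\<lambda>\<rho>. t *\<^sub>R xi_map \<kappa> \<gamma> i \<rho> + (1 - t) *\<^sub>R pi_map \<gamma> i \<rho>) ` ball 0 r"

definition condition_O :: "nat \<Rightarrow> (real^'n^'m \<Rightarrow> real^'n^'m) \<Rightarrow> bool" where
  "condition_O N \<sigma> \<longleftrightarrow> continuous_on UNIV \<sigma> \<and>
    (\<exists>r0 \<delta>1 \<delta>2 (\<kappa> :: nat \<Rightarrow> (real^'n^'m) \<times> (real^'n^'m) \<Rightarrow> real)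
        (\<gamma> :: nat \<Rightarrow> (real^'n^'m) \<times> (real^'n^'m) \<Rightarrow> (real^'n^'m) \<times> (real^'n^'m)).
      r0 > 0 \<and> 0 < \<delta>1 \<and> \<delta>1 < \<delta>2 \<and> \<delta>2 < 1 \<and>
      (\<forall>i\<in>{1..N}. continuous_on (cball 0 r0) (\<kappa> i) \<and> continuous_on (cball 0 r0) (\<gamma> i) \<and>
         (\<forall>\<rho>\<in>cball 0 r0. \<kappa> i \<rho> \<in> {1/\<delta>2..1/\<delta>1} \<and> \<gamma> i \<rho> \<in> wave_cone)) \<and>
      (\<forall>\<rho>\<in>cball 0 r0. (\<Sum>i\<in>{1..N}. \<gamma> i \<rho>) = 0) \<and>
      \<comment> \<open>(P1)(i)\<close>
      (\<forall>i\<in>{1..N}. \<forall>\<rho>\<in>cball 0 r0.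
          snd (xi_map \<kappa> \<gamma> i \<rho>) = \<sigma> (fst (xi_map \<kappa> \<gamma> i \<rho>))) \<and>
      \<comment> \<open>(P1)(ii)\<close>
      (\<forall>i\<in>{1..N}. \<forall>j\<in>{1..N}. i \<noteq> j \<longrightarrow>
          (fst \<circ> xi_map \<kappa> \<gamma> i) ` cball 0 r0 \<inter> (fst \<circ> xi_map \<kappa> \<gamma> j) ` cball 0 r0 = {} \<and>
          (fst \<circ> pi_map \<gamma> i) ` cball 0 r0 \<inter> (fst \<circ> pi_map \<gamma> j) ` cball 0 r0 = {}) \<and>
      \<comment> \<open>(P2)\<close>
      (\<exists>\<delta>0. \<delta>2 < \<delta>0 \<and> \<delta>0 < 1 \<and>
         (\<forall>r t. 0 < r \<and> r \<le> r0 \<and> (t = 0 \<or> (\<delta>0 \<le> t \<and> t < 1)) \<longrightarrow>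
            (\<forall>i\<in>{1..N}. open (S_set \<kappa> \<gamma> i r t)) \<and>
            (\<forall>i\<in>{1..N}. \<forall>j\<in>{1..N}. i \<noteq> j \<longrightarrow> S_set \<kappa> \<gamma> i r t \<inter> S_set \<kappa> \<gamma> j r t = {}))))"

text \<open>delta(A) = a_11 a_22 - a_12 a_21, where the columns labelled 1 and 2 are j1, j2.\<close>
definition det12 :: "'n \<Rightarrow> 'n \<Rightarrow> real^'n^2 \<Rightarrow> real" where
  "det12 j1 j2 A = A$1$j1 * A$2$j2 - A$1$j2 * A$2$j1"

end

theory Submission
  imports Defs "HOL-Computational_Algebra.Polynomial"
begin

text \<open>
  The function \<open>F\<close> is a quadratic polynomial with Hessian \<open>h\<^sub>k I\<close> near each of five points \<open>A\<^sub>k\<close>, so that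
  \<open>\<sigma> = DF\<close> is affine there. From a given point \<open>\<pi>\<close> and a given kernel direction \<open>b\<close> the wave cone then
  reaches the graph of \<open>\<sigma>\<close> at an explicit point, and a closed configuration is the same as a choice of
  five directions for which five consecutive steps return to the starting point \<open>\<rho>\<close>. An explicit
  nondegenerate configuration at \<open>\<rho> = 0\<close> is continued to all small \<open>\<rho>\<close> by the implicit function theorem;
  openness of the sets \<open>S\<^sub>i\<close> reduces, by invariance of domain, to local injectivity, which follows from
  linear algebra at \<open>\<rho> = 0\<close>.

  The five quadratic pieces are compatible with polyconvexity. They are glued by smooth maxima to a
  large multiple of \<open>sqrt (1 + |A|\<^sup>2 + \<delta>\<^sup>2)\<close>, which alone is active outside a compact set; its derivatives
  along \<open>\<delta> = \<delta>(A)\<close> grow at most linearly.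
\<close>

section \<open>Smooth functions\<close>

text \<open>A parameter count fixes the unknowns: from a given starting point a step is determined
  by its kernel direction, length included, so five steps carry 5n parameters against the 4n
  equations of a closed loop; freezing the last direction makes the system square. The loop is
  linearised explicitly only at the base configuration, so differentiability is used in the strict
  sense at that single point. This already bounds increments from below nearby, and invariance of
  domain turns such bounds into solvability and open images. For F two demands conflict. Near each
  of the five points the Hessian is prescribed, while a supporting function affine in (A, delta)
  contributes a multiple of the determinant and must lie below F at the other four points. A global
  quadratic correction would spoil those inequalities; it is therefore flattened at a small scale
  tau, exact near its own point and of slope O(tau) elsewhere. Flattening also leaves every piece
  with linear growth, so one convex function can dominate at infinity and the derivative bounds
  concern one explicit function plus a remainder of compact support.\<close>

lemma frechet_derivative_eqI:
  "(f has_derivative f') (at x) \<Longrightarrow> frechet_derivative f (at x) h = f' h"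
  by (metis frechet_derivative_at)

text \<open>The head of the list is the direction differentiated last, so the final entry acts on
  the function itself. Recursion over lists thereby becomes recursion over functions.\<close>

lemma iter_dderiv_snoc:
  "iter_dderiv f (hs @ [h]) = iter_dderiv (\<lambda>x. frechet_derivative f (at x) h) hs"
  by (induction hs) auto

text \<open>\<open>smooth\<close> speaks of all orders at once and offers no induction. Here each
  derivative costs one order and the function stays free, so closure under products and compositions
  is an induction on the order.\<close>

fun differentiable_upto :: "nat \<Rightarrow> ('a::real_normed_vector \<Rightarrow> 'b::real_normed_vector) \<Rightarrow> bool" where
  "differentiable_upto 0 f \<longleftrightarrow> (\<forall>x. f differentiable (at x))"
| "differentiable_upto (Suc n) f \<longleftrightarrow> (\<forall>x. f differentiable (at x)) \<and>
     (\<forall>h. differentiable_upto n (\<lambda>x. frechet_derivative f (at x) h))"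

lemma differentiable_upto_iff:
  "differentiable_upto n f \<longleftrightarrow> (\<forall>hs x. length hs \<le> n \<longrightarrow> iter_dderiv f hs differentiable (at x))"
proof (induction n arbitrary: f)
  case (Suc n)
  show ?case
  proof
    assume L: "differentiable_upto (Suc n) f"
    show "\<forall>hs x. length hs \<le> Suc n \<longrightarrow> iter_dderiv f hs differentiable (at x)"
    proof (intro allI impI)
      fix hs x assume len: "length (hs::'a list) \<le> Suc n"
      show "iter_dderiv f hs differentiable (at x)"
      proof (cases hs rule: rev_cases)
        case (snoc hs' h)
        then show ?thesis using L len Suc by (simp add: iter_dderiv_snoc)
      qed (use L in simp)
    qed
  next
    assume R: "\<forall>hs x. length hs \<le> Suc n \<longrightarrow> iter_dderiv f hs differentiable (at x)"
    have "f differentiable (at x)" for x using R[rule_format, of "[]" x] by simp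
    moreover have "differentiable_upto n (\<lambda>x. frechet_derivative f (at x) h)" for h
      unfolding Suc using R[rule_format, of "_ @ [h]"] by (simp add: iter_dderiv_snoc)
    ultimately show "differentiable_upto (Suc n) f" by simp
  qed
qed auto

lemma smooth_iff_upto: "smooth f \<longleftrightarrow> (\<forall>n. differentiable_upto n f)"
  unfolding smooth_def differentiable_upto_iff by blast

lemma differentiable_upto_mono: "differentiable_upto (Suc n) f \<Longrightarrow> differentiable_upto n f"
  unfolding differentiable_upto_iff by (meson le_SucI)

lemma smooth_iff_deriv:
  "smooth f \<longleftrightarrow> (\<forall>x. f differentiable (at x)) \<and> (\<forall>h. smooth (\<lambda>x. frechet_derivative f (at x) h))"
proof -
  have "smooth f \<longleftrightarrow> (\<forall>n. differentiable_upto (Suc n) f)"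
    unfolding smooth_iff_upto using differentiable_upto_mono by blast
  then show ?thesis by (auto simp: smooth_iff_upto)
qed

text \<open>Reduces smoothness of a whole family to one generic derivative; applied to
  \<open>range flat_exp\<close> and to the classes \<open>symb m\<close>.\<close>

lemma smooth_coinduct:
  assumes "f \<in> S"
    and "\<And>f x. f \<in> S \<Longrightarrow> f differentiable (at x)"
    and "\<And>f h. f \<in> S \<Longrightarrow> (\<lambda>x. frechet_derivative f (at x) h) \<in> S"
  shows "smooth f"
proof -
  have "f \<in> S \<Longrightarrow> differentiable_upto n f" for n f
    by (induction n arbitrary: f) (auto simp: assms)
  then show ?thesis using assms(1) by (simp add: smooth_iff_upto)
qed

lemma smooth_imp_differentiable: "smooth f \<Longrightarrow> f differentiable (at x)"
  using smooth_iff_deriv by blast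

lemma smooth_imp_deriv: "smooth f \<Longrightarrow> smooth (\<lambda>x. frechet_derivative f (at x) h)"
  using smooth_iff_deriv by blast

lemma smooth_imp_has_derivative: "smooth f \<Longrightarrow> (f has_derivative frechet_derivative f (at x)) (at x)"
  by (simp add: frechet_derivative_works[symmetric] smooth_imp_differentiable)

lemma smooth_imp_continuous_on: "smooth f \<Longrightarrow> continuous_on S f"
  by (meson smooth_imp_has_derivative has_derivative_continuous continuous_at_imp_continuous_on)

lemma differentiable_upto_const: "differentiable_upto n (\<lambda>x. c)"
  by (induction n arbitrary: c) auto

lemma smooth_const: "smooth (\<lambda>x. c)"
  by (simp add: smooth_iff_upto differentiable_upto_const)

lemma smooth_bounded_linear:
  assumes "bounded_linear f" shows "smooth f"
  unfolding smooth_iff_deriv[of f]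
  using frechet_derivative_eqI[OF bounded_linear_imp_has_derivative[OF assms]]
    bounded_linear_imp_differentiable[OF assms] smooth_const by auto

lemma differentiable_upto_add:
  assumes "differentiable_upto n f" "differentiable_upto n g"
  shows "differentiable_upto n (\<lambda>x. f x + g x)"
  using assms
proof (induction n arbitrary: f g)
  case (Suc n)
  have "frechet_derivative (\<lambda>x. f x + g x) (at x) h
      = frechet_derivative f (at x) h + frechet_derivative g (at x) h" for x h
    using Suc.prems by (intro frechet_derivative_eqI has_derivative_add) (auto simp: frechet_derivative_works[symmetric])
  then show ?case using Suc by simp
qed simp

lemma smooth_add: "smooth f \<Longrightarrow> smooth g \<Longrightarrow> smooth (\<lambda>x. f x + g x)"
  by (simp add: smooth_iff_upto differentiable_upto_add)

lemma differentiable_upto_mult: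
  fixes f g :: "'a::real_normed_vector \<Rightarrow> real"
  assumes "differentiable_upto n f" "differentiable_upto n g"
  shows "differentiable_upto n (\<lambda>x. f x * g x)"
  using assms
proof (induction n arbitrary: f g)
  case (Suc n)
  have "frechet_derivative (\<lambda>x. f x * g x) (at x) h
      = f x * frechet_derivative g (at x) h + frechet_derivative f (at x) h * g x" for x h
    using Suc.prems by (intro frechet_derivative_eqI has_derivative_mult) (auto simp: frechet_derivative_works[symmetric])
  moreover have "differentiable_upto n f" "differentiable_upto n g"
    using Suc.prems differentiable_upto_mono by blast+
  ultimately show ?case using Suc
    by (auto intro!: differentiable_upto_add)
qed simp

lemma smooth_mult: 
  fixes f g :: "'a::real_normed_vector \<Rightarrow> real"
  shows "smooth f \<Longrightarrow> smooth g \<Longrightarrow> smooth (\<lambda>x. f x * g x)"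
  by (simp add: smooth_iff_upto differentiable_upto_mult)

lemma smooth_diff: 
  fixes f g :: "'a::real_normed_vector \<Rightarrow> real"
  assumes "smooth f" "smooth g" shows "smooth (\<lambda>x. f x - g x)"
  using smooth_add[OF assms(1) smooth_mult[OF smooth_const[of "-1"] assms(2)]] by simp

lemma smooth_sum:
  assumes "\<And>i. i \<in> I \<Longrightarrow> smooth (f i)"
  shows "smooth (\<lambda>x. \<Sum>i\<in>I. f i x)"
  using assms by (induction I rule: infinite_finite_induct) (auto intro: smooth_const smooth_add)

lemma smooth_powr:
  fixes p :: "'a::real_normed_vector \<Rightarrow> real"
  assumes p: "smooth p" "\<And>x. p x > 0"
  shows "smooth (\<lambda>x. p x powr r)"
proof -
  have der: "((\<lambda>x. p x powr r) has_derivative (\<lambda>h. r * p x powr (r - 1) * frechet_derivative p (at x) h)) (at x)" for x r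
  proof -
    have "((\<lambda>z. z powr r) has_derivative (*) (r * p x powr (r - 1))) (at (p x))"
      using has_real_derivative_powr[OF p(2)] by (simp add: has_field_derivative_def)
    from has_derivative_compose[OF smooth_imp_has_derivative[OF p(1)] this]
    show ?thesis .
  qed
  have "differentiable_upto n (\<lambda>x. p x powr r)" for n
  proof (induction n arbitrary: r)
    case 0
    show ?case using differentiableI[OF der] by simp
  next
    case (Suc n)
    have "differentiable_upto n (\<lambda>x. r * p x powr (r - 1) * frechet_derivative p (at x) h)" for h
      using Suc smooth_imp_deriv[OF p(1)]
      by (intro differentiable_upto_mult differentiable_upto_const) (auto simp: smooth_iff_upto)
    then show ?case using differentiableI[OF der] by (simp add: frechet_derivative_eqI[OF der])
  qed
  then show ?thesis by (simp add: smooth_iff_upto)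
qed

lemma smooth_real_antiderivative:
  fixes f g :: "real \<Rightarrow> real"
  assumes "\<And>x. (f has_real_derivative g x) (at x)" "smooth g"
  shows "smooth f"
proof -
  have der: "(f has_derivative (\<lambda>h. g x * h)) (at x)" for x
    using assms(1)[of x] by (simp add: has_field_derivative_def)
  then show ?thesis
    unfolding smooth_iff_deriv[of f]
    using smooth_mult[OF assms(2) smooth_const] differentiableI[OF der]
    by (simp add: frechet_derivative_eqI[OF der])
qed

lemma has_real_derivative_frechet:
  fixes f :: "real \<Rightarrow> real"
  assumes "smooth f"
  shows "(f has_real_derivative frechet_derivative f (at x) 1) (at x)"
proof -
  let ?D = "frechet_derivative f (at x)"
  have D: "(f has_derivative ?D) (at x)" using smooth_imp_has_derivative[OF assms] .
  have "?D h = ?D 1 * h" for h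
    using linear_cmul[OF has_derivative_linear[OF D], of h 1] by simp
  then have "?D = (*) (?D 1)" by blast
  then show ?thesis using D unfolding has_field_derivative_def by simp
qed

lemma smooth_compose:
  fixes f :: "real \<Rightarrow> real" and g :: "'a::real_normed_vector \<Rightarrow> real"
  assumes "smooth f" "smooth g"
  shows "smooth (\<lambda>x. f (g x))"
proof -
  have der: "((\<lambda>x. f (g x)) has_derivative
      (\<lambda>h. frechet_derivative f (at (g x)) 1 * frechet_derivative g (at x) h)) (at x)" if "smooth f" for x f
  proof -
    have "(f has_derivative (*) (frechet_derivative f (at (g x)) 1)) (at (g x))"
      using has_real_derivative_frechet[OF that, of "g x"] by (simp add: has_field_derivative_def)
    from has_derivative_compose[OF smooth_imp_has_derivative[OF assms(2)] this]
    show ?thesis .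
  qed
  have "smooth f \<Longrightarrow> differentiable_upto n (\<lambda>x. f (g x))" for n and f :: "real \<Rightarrow> real"
  proof (induction n arbitrary: f)
    case 0
    then show ?case using differentiableI[OF der] by auto
  next
    case (Suc n)
    have "differentiable_upto n (\<lambda>x. frechet_derivative f (at (g x)) 1 * frechet_derivative g (at x) h)" for h
      using Suc.IH[OF smooth_imp_deriv[OF Suc.prems]] smooth_imp_deriv[OF assms(2)]
      by (intro differentiable_upto_mult) (auto simp: smooth_iff_upto)
    then show ?case using differentiableI[OF der[OF Suc.prems]] by (simp add: frechet_derivative_eqI[OF der[OF Suc.prems]])
  qed
  then show ?thesis using assms(1) by (simp add: smooth_iff_upto)
qed

lemma iter_dderiv_add:
  assumes "smooth f" "smooth g"
  shows "iter_dderiv (\<lambda>x. f x + g x) hs x = iter_dderiv f hs x + iter_dderiv g hs x"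
proof (induction hs arbitrary: x)
  case (Cons h hs)
  have e: "iter_dderiv (\<lambda>x. f x + g x) hs = (\<lambda>x. iter_dderiv f hs x + iter_dderiv g hs x)" 
    using Cons by auto
  show ?case unfolding iter_dderiv.simps e
    using assms by (intro frechet_derivative_eqI has_derivative_add)
      (auto simp: smooth_def frechet_derivative_works[symmetric])
qed simp

text \<open>The bounds of the theorem are uniform over infinitely many direction lists. Expanding
  each direction in coordinates leaves finitely many lists of basis vectors, with coefficients that
  are products of coordinates of vectors in the unit ball.\<close>

lemma iter_dderiv_bound_Basis:
  fixes f :: "'a::euclidean_space \<Rightarrow> real"
  assumes f: "smooth f" and B: "\<And>bs. set bs \<subseteq> Basis \<Longrightarrow> length bs = length hs \<Longrightarrow> \<bar>iter_dderiv f bs x\<bar> \<le> (C::real)"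
    and hs: "\<forall>h\<in>set hs. norm h \<le> 1"
  shows "\<bar>iter_dderiv f hs x\<bar> \<le> real DIM('a) ^ length hs * C"
proof -
  let ?L = "\<lambda>k. {bs. set bs \<subseteq> (Basis::'a set) \<and> length bs = k}"
  have fin: "finite (?L k)" for k by (rule finite_lists_length_eq) simp
  have "\<exists>c. (\<forall>bs. \<bar>c bs\<bar> \<le> (1::real)) \<and> iter_dderiv f hs = (\<lambda>x. \<Sum>bs\<in>?L (length hs). c bs * iter_dderiv f bs x)"
    using hs
  proof (induction hs)
    case Nil
    have "?L 0 = {[]}" by auto
    then show ?case by (intro exI[of _ "\<lambda>_. 1"]) simp
  next
    case (Cons h hs)
    then obtain c where c: "\<And>bs. \<bar>c bs\<bar> \<le> (1::real)"
      "iter_dderiv f hs = (\<lambda>x. \<Sum>bs\<in>?L (length hs). c bs * iter_dderiv f bs x)" by auto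
    have L: "?L (Suc k) = (\<lambda>(b,bs). b # bs) ` (Basis \<times> ?L k)" for k
      by (auto simp: length_Suc_conv image_iff)
    have split: "(\<Sum>bs\<in>?L (Suc k). g bs) = (\<Sum>b\<in>Basis. \<Sum>bs\<in>?L k. g (b # bs))" for k and g :: "'a list \<Rightarrow> real"
    proof -
      have "inj_on (\<lambda>(b,bs). b # bs) (Basis \<times> ?L k)" by (auto simp: inj_on_def)
      then have "(\<Sum>bs\<in>?L (Suc k). g bs) = (\<Sum>x\<in>Basis \<times> ?L k. g (fst x # snd x))"
        unfolding L by (simp add: sum.reindex split_def)
      then show ?thesis by (simp add: sum.cartesian_product split_def)
    qed
    have dif: "iter_dderiv f bs differentiable (at x)" for bs x using f by (simp add: smooth_def)
    have "iter_dderiv f (h # hs) x = (\<Sum>bs\<in>?L (Suc (length hs)). (c (tl bs) * (h \<bullet> hd bs)) * iter_dderiv f bs x)" for x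
    proof -
      have 1: "iter_dderiv f (h # hs) x = (\<Sum>bs\<in>?L (length hs). c bs * frechet_derivative (iter_dderiv f bs) (at x) h)"
        unfolding iter_dderiv.simps c(2) using dif
        by (intro frechet_derivative_eqI has_derivative_sum has_derivative_mult_right)
           (auto simp: frechet_derivative_works[symmetric])
      have 2: "frechet_derivative (iter_dderiv f bs) (at x) h
          = (\<Sum>b\<in>Basis. (h \<bullet> b) * iter_dderiv f (b # bs) x)" for bs
      proof -
        have lin: "linear (frechet_derivative (iter_dderiv f bs) (at x))"
          using dif by (simp add: linear_frechet_derivative)
        let ?D = "frechet_derivative (iter_dderiv f bs) (at x)"
        have "?D h = ?D (\<Sum>b\<in>Basis. (h \<bullet> b) *\<^sub>R b)" by (simp add: euclidean_representation)
        also have "\<dots> = (\<Sum>b\<in>Basis. (h \<bullet> b) *\<^sub>R ?D b)"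
          by (simp add: linear_sum[OF lin] linear_cmul[OF lin])
        finally show ?thesis by simp
      qed
      show ?thesis unfolding 1 2 split sum_distrib_left
        by (subst sum.swap) (simp add: mult.assoc)
    qed
    moreover have "\<bar>c (tl bs) * (h \<bullet> hd bs)\<bar> \<le> 1" if "bs \<in> ?L (Suc (length hs))" for bs
    proof -
      have "hd bs \<in> Basis" using that by (cases bs) auto
      then have "\<bar>h \<bullet> hd bs\<bar> \<le> 1" using Basis_le_norm[of "hd bs" h] Cons.prems by auto
      then show ?thesis using c(1)[of "tl bs"] by (simp add: abs_mult mult_le_one)
    qed
    ultimately show ?case
      \<comment> \<open>Extended by 0 off the finite index set, so that the bound on the
        coefficients holds for every list.\<close>
      using fin by (intro exI[of _ "\<lambda>bs. if bs \<in> ?L (Suc (length hs)) then c (tl bs) * (h \<bullet> hd bs) else 0"] conjI allI ext)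
         (auto intro!: sum.cong)
  qed
  then obtain c where c: "\<And>bs. \<bar>c bs\<bar> \<le> (1::real)"
      "iter_dderiv f hs = (\<lambda>x. \<Sum>bs\<in>?L (length hs). c bs * iter_dderiv f bs x)" by auto
  have "\<bar>iter_dderiv f hs x\<bar> \<le> (\<Sum>bs\<in>?L (length hs). \<bar>c bs * iter_dderiv f bs x\<bar>)"
    unfolding c(2) by (rule sum_abs)
  also have "\<dots> \<le> (\<Sum>bs\<in>?L (length hs). C)"
  proof (intro sum_mono)
    fix bs assume "bs \<in> ?L (length hs)"
    then have "\<bar>iter_dderiv f bs x\<bar> \<le> C" using B by auto
    then show "\<bar>c bs * iter_dderiv f bs x\<bar> \<le> C"
      using mult_mono[OF c(1)[of bs], of "\<bar>iter_dderiv f bs x\<bar>" C] by (simp add: abs_mult)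
  qed
  also have "\<dots> = real DIM('a) ^ length hs * C"
    using card_lists_length_eq[of "Basis::'a set" "length hs"] by simp
  finally show ?thesis .
qed

section \<open>Smooth cut-off functions of one variable\<close>

text \<open>The polynomial factor in 1/x makes the family closed under differentiation, so flatness
  of exp(-1/x) at 0 to all orders is a single computation.\<close>

definition flat_exp :: "real poly \<Rightarrow> real \<Rightarrow> real" where
  "flat_exp p x = (if x > 0 then poly p (1/x) * exp (- (1/x)) else 0)"

lemma poly_times_exp_minus_tendsto_0: "((\<lambda>y::real. poly p y * exp (- y)) \<longlongrightarrow> 0) at_top"
proof -
  have "((\<lambda>y. \<Sum>i\<le>degree p. coeff p i * (y ^ i / exp y)) \<longlongrightarrow> (\<Sum>i\<le>degree p. coeff p i * 0)) at_top"
    by (intro tendsto_sum tendsto_mult tendsto_const tendsto_power_div_exp_0)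
  then show ?thesis
    by (simp add: poly_altdef exp_minus sum_divide_distrib divide_inverse sum_distrib_right mult.assoc)
qed

lemma has_real_derivative_flat_exp:
  "(flat_exp p has_real_derivative flat_exp (monom 1 2 * (p - pderiv p)) x) (at x)"
proof (cases x "0::real" rule: linorder_cases)
  case greater
  have "((\<lambda>x. poly p (1/x) * exp (- (1/x))) has_real_derivative 
       flat_exp (monom 1 2 * (p - pderiv p)) x) (at x)"
    unfolding flat_exp_def using greater
    by (auto intro!: derivative_eq_intros simp: poly_monom field_simps power2_eq_square)
  then show ?thesis
    by (rule DERIV_cong_ev[THEN iffD1, rotated -1, OF _ refl _ refl])
       (use greater in \<open>auto simp: flat_exp_def eventually_nhds intro!: exI[of _ "{0<..}"]\<close>)
next
  case less
  have "((\<lambda>x. 0) has_real_derivative flat_exp (monom 1 2 * (p - pderiv p)) x) (at x)"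
    using less by (auto simp: flat_exp_def)
  then show ?thesis
    by (rule DERIV_cong_ev[THEN iffD1, rotated -1, OF _ refl _ refl])
       (use less in \<open>auto simp: flat_exp_def eventually_nhds intro!: exI[of _ "{..<0}"]\<close>)
next
  case equal
  have "((\<lambda>h. flat_exp p h / h) \<longlongrightarrow> 0) (at_left 0)"
    by (rule tendsto_eventually) (auto simp: flat_exp_def eventually_at_filter)
  moreover have "((\<lambda>h. flat_exp p h / h) \<longlongrightarrow> 0) (at_right 0)"
  proof -
    \<comment> \<open>Dividing by \<open>h\<close> multiplies the polynomial in 1/h by its variable,
      so the difference quotient is again of the same form.\<close>
    have "((\<lambda>h. poly (pCons 0 p) (inverse h) * exp (- inverse h)) \<longlongrightarrow> 0) (at_right (0::real))"
      by (rule filterlim_compose[OF poly_times_exp_minus_tendsto_0 filterlim_inverse_at_top_right])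
    then show ?thesis
      by (rule tendsto_cong[THEN iffD1, rotated])
         (auto simp: flat_exp_def eventually_at_filter field_simps)
  qed
  ultimately have "((\<lambda>h. flat_exp p h / h) \<longlongrightarrow> 0) (at 0)"
    by (simp add: filterlim_split_at)
  then show ?thesis unfolding equal DERIV_def by (simp add: flat_exp_def)
qed

lemma smooth_flat_exp: "smooth (flat_exp p)"
proof (rule smooth_coinduct[of _ "range flat_exp"])
  fix f x h assume "f \<in> range flat_exp"
  then obtain p where f: "f = flat_exp p" by auto
  have der: "(f has_derivative (\<lambda>h. flat_exp (monom 1 2 * (p - pderiv p)) x * h)) (at x)" for x
    unfolding f using has_real_derivative_flat_exp by (simp add: has_field_derivative_def)
  show "f differentiable (at x)" using der differentiable_def by blast
  have "(\<lambda>x. frechet_derivative f (at x) h) = flat_exp (smult h (monom 1 2 * (p - pderiv p)))"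
    by (auto simp: frechet_derivative_eqI[OF der] flat_exp_def)
  then show "(\<lambda>x. frechet_derivative f (at x) h) \<in> range flat_exp" by auto
qed auto

text \<open>The step is \<open>b (e + t)\<close> divided by its sum with the mirror image
  \<open>b (e - t)\<close>. The resulting symmetry later forces the antiderivative to be exactly the
  identity on the right.\<close>

lemma smooth_step_exists:
  fixes e :: real assumes "e > 0"
  obtains s :: "real \<Rightarrow> real" where "smooth s" "mono s" "\<And>t. s t + s (- t) = 1"
    "\<And>t. t \<le> - e \<Longrightarrow> s t = 0" "\<And>t. 0 \<le> s t"
proof -
  define b where "b = flat_exp 1"
  have b_pos: "b t > 0" if "t > 0" for t using that by (simp add: b_def flat_exp_def)
  have b_0: "b t = 0" if "t \<le> 0" for t using that by (simp add: b_def flat_exp_def)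
  have b_nonneg: "b t \<ge> 0" for t using b_pos b_0 by (cases "t > 0") (auto simp: less_imp_le)
  have b_mono: "b x \<le> b y" if "x \<le> y" for x y
    using that by (auto simp: b_def flat_exp_def field_simps)
  have den: "b (e + t) + b (e - t) > 0" for t
    using b_pos[of "e + t"] b_pos[of "e - t"] b_nonneg[of "e + t"] b_nonneg[of "e - t"] assms
    by (cases "t \<ge> 0") (auto intro: add_pos_nonneg add_nonneg_pos)
  define s where "s t = b (e + t) / (b (e + t) + b (e - t))" for t
  have id: "smooth (\<lambda>t::real. t)" by (rule smooth_bounded_linear) (rule bounded_linear_ident)
  have sb: "smooth (\<lambda>t. b (e + t))" "smooth (\<lambda>t. b (e - t))" unfolding b_def
    by (intro smooth_compose[OF smooth_flat_exp] smooth_add smooth_diff smooth_const id)+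
  have "smooth s"
    using smooth_mult[OF sb(1) smooth_powr[OF smooth_add[OF sb] den, of "-1"]] den
    by (simp add: s_def[abs_def] powr_minus divide_inverse less_imp_le)
  moreover have "mono s"
  proof
    fix x y :: real assume "x \<le> y"
    then have "b (e + x) * b (e - y) \<le> b (e + y) * b (e - x)"
      by (intro mult_mono b_mono b_nonneg) auto
    then show "s x \<le> s y" using den[of x] den[of y]
      by (simp add: s_def divide_simps algebra_simps)
  qed
  moreover have "s t + s (- t) = 1" for t using den[of t] by (simp add: s_def divide_simps add.commute)
  moreover have "s t = 0" if "t \<le> - e" for t using that by (simp add: s_def b_0)
  moreover have "0 \<le> s t" for t using den[of t] b_nonneg by (simp add: s_def)
  ultimately show ?thesis using that by blast
qed

lemma smooth_antiderivative:
  fixes g :: "real \<Rightarrow> real"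
  assumes "smooth g"
  obtains f where "smooth f" "\<And>x. (f has_real_derivative g x) (at x)" "f a = c"
proof -
  obtain F where F: "\<And>x. (F has_vector_derivative g x) (at x)"
    using einterval_antiderivative[of "-\<infinity>" "\<infinity>" g] smooth_imp_continuous_on[OF assms, of UNIV]
    by (auto simp: continuous_on_eq_continuous_at)
  have f: "((\<lambda>x. F x + (c - F a)) has_real_derivative g x) (at x)" for x
    using F[of x] by (auto simp: has_real_derivative_iff_has_vector_derivative intro!: derivative_eq_intros)
  show ?thesis
    by (rule that[OF smooth_real_antiderivative[OF f assms] f]) simp
qed

text \<open>The antiderivative of the step has slopes between 0 and 1, which gives both
  monotonicities; these are what lets a smooth maximum preserve convexity.\<close>

lemma smooth_positive_part_exists:
  fixes e :: real assumes e: "e > 0"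
  obtains \<psi> :: "real \<Rightarrow> real" where "smooth \<psi>" "convex_on UNIV \<psi>" "mono \<psi>" "mono (\<lambda>t. t - \<psi> t)"
    "\<And>t. t \<le> - e \<Longrightarrow> \<psi> t = 0" "\<And>t. e \<le> t \<Longrightarrow> \<psi> t = t"
proof -
  obtain s :: "real \<Rightarrow> real" where s: "smooth s" "mono s" "\<And>t. s t + s (- t) = 1"
    "\<And>t. t \<le> - e \<Longrightarrow> s t = 0" "\<And>t. 0 \<le> s t" using smooth_step_exists[OF e] by blast
  obtain \<psi> where \<psi>: "smooth \<psi>" "\<And>x. (\<psi> has_real_derivative s x) (at x)" "\<psi> (- e) = 0"
    using smooth_antiderivative[OF s(1)] by metis
  have "convex_on UNIV \<psi>"
    using convex_on_realI[of UNIV \<psi> s] \<psi>(2) s(2) by (auto simp: mono_def)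
  moreover have "mono \<psi>"
  proof (intro monoI)
    fix x y :: real assume "x \<le> y"
    then show "\<psi> x \<le> \<psi> y"
      by (rule DERIV_nonneg_imp_nondecreasing) (use \<psi>(2) s(5) in blast)
  qed
  moreover have "mono (\<lambda>t. t - \<psi> t)"
  proof (rule monoI)
    fix x y :: real assume "x \<le> y"
    then show "x - \<psi> x \<le> y - \<psi> y"
    proof (rule DERIV_nonneg_imp_nondecreasing[where f = "\<lambda>t. t - \<psi> t"])
      fix t have "((\<lambda>t. t - \<psi> t) has_real_derivative 1 - s t) (at t)"
        by (intro derivative_intros \<psi>(2))
      moreover have "s t \<le> 1" using s(3)[of t] s(5)[of "- t"] by linarith
      ultimately show "\<exists>y. ((\<lambda>t. t - \<psi> t) has_real_derivative y) (at t) \<and> y \<ge> 0" by force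
    qed
  qed
  moreover have left: "\<psi> t = 0" if "t \<le> - e" for t
  proof -
    have "\<psi> t \<ge> \<psi> (- e)"
    proof (rule DERIV_nonpos_imp_nonincreasing[OF that])
      fix x assume "x \<le> - e"
      then show "\<exists>y. (\<psi> has_real_derivative y) (at x) \<and> y \<le> 0"
        using \<psi>(2)[of x] s(4)[of x] by auto
    qed
    moreover have "\<psi> t \<le> \<psi> (- e)" using \<open>mono \<psi>\<close> that by (rule monoD)
    ultimately show ?thesis using \<psi>(3) by simp
  qed
  moreover have "\<psi> t = t" if "e \<le> t" for t
  proof -
    \<comment> \<open>The derivative is s x + s (-x) - 1 = 0 by symmetry, and the value at 0 is
      0.\<close>
    have "\<exists>c. \<forall>x\<in>UNIV. \<psi> x - \<psi> (- x) - x = c"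
    proof (rule has_field_derivative_zero_constant)
      fix x
      have "((\<lambda>x. \<psi> (- x)) has_real_derivative s (- x) * (- 1)) (at x)"
        by (rule DERIV_chain2[OF \<psi>(2)]) (auto intro!: derivative_eq_intros)
      then have "((\<lambda>x. \<psi> x - \<psi> (- x) - x) has_real_derivative s x - s (- x) * (- 1) - 1) (at x)"
        by (intro derivative_intros \<psi>(2))
      then show "((\<lambda>x. \<psi> x - \<psi> (- x) - x) has_real_derivative 0) (at x within UNIV)"
        using s(3)[of x] by simp
    qed auto
    then have "\<psi> t - \<psi> (- t) - t = \<psi> 0 - \<psi> (- 0) - 0" by (metis UNIV_I)
    then show ?thesis using left[of "- t"] that by simp
  qed
  ultimately show ?thesis using that \<psi>(1) by blast
qed

text \<open>The derivative is a smooth clamp, the identity on [-tau, tau] and bounded by 2 tau. The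
  quadratic germ serves the prescribed Hessian; the small slope makes the function negligible at the
  other points.\<close>

lemma smooth_truncated_square_exists:
  fixes \<tau> :: real assumes \<tau>: "\<tau> > 0"
  obtains k :: "real \<Rightarrow> real" where "smooth k" "convex_on UNIV k"
    "\<And>s. \<bar>s\<bar> \<le> \<tau> \<Longrightarrow> k s = s\<^sup>2 / 2" "\<And>s. k s \<le> 2 * \<tau> * \<bar>s\<bar>"
proof -
  obtain \<psi> :: "real \<Rightarrow> real" where \<psi>: "smooth \<psi>" "convex_on UNIV \<psi>" "mono \<psi>" "mono (\<lambda>t. t - \<psi> t)"
    "\<And>t. t \<le> - \<tau> \<Longrightarrow> \<psi> t = 0" "\<And>t. \<tau> \<le> t \<Longrightarrow> \<psi> t = t"
    using smooth_positive_part_exists[OF \<tau>] by blast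
  have id: "smooth (\<lambda>t::real. t)" by (rule smooth_bounded_linear) (rule bounded_linear_ident)
  \<comment> \<open>The shifts by 2 tau move both transition zones of \<open>\<psi>\<close> outside
    [-tau, tau].\<close>
  define g where "g s = \<psi> (s + 2 * \<tau>) - \<psi> (s - 2 * \<tau>) - 2 * \<tau>" for s
  have "smooth g" unfolding g_def[abs_def]
    by (intro smooth_diff smooth_compose[OF \<psi>(1)] smooth_add smooth_const id)
  then obtain k where k: "smooth k" "\<And>x. (k has_real_derivative g x) (at x)" "k 0 = 0"
    using smooth_antiderivative by metis
  have g_id: "g s = s" if "\<bar>s\<bar> \<le> \<tau>" for s
    using that \<tau> \<psi>(6)[of "s + 2 * \<tau>"] \<psi>(5)[of "s - 2 * \<tau>"] by (simp add: g_def)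
  have g_mono: "g x \<le> g y" if "x \<le> y" for x y
  proof -
    \<comment> \<open>\<open>\<psi>\<close> is constant on the left and has slope one on the right, so one of its two
        translates is always affine.\<close>
    have "\<psi> (x + 2 * \<tau>) - \<psi> (x - 2 * \<tau>) \<le> \<psi> (y + 2 * \<tau>) - \<psi> (y - 2 * \<tau>)"
      if xy: "x \<le> y" "y \<le> 0 \<or> x \<ge> 0" for x y
    proof (cases "y \<le> 0")
      case True
      then show ?thesis using monoD[OF \<psi>(3), of "x + 2 * \<tau>" "y + 2 * \<tau>"] xy \<tau>
        by (simp add: \<psi>(5))
    next
      case False
      then show ?thesis using monoD[OF \<psi>(4), of "x - 2 * \<tau>" "y - 2 * \<tau>"] xy \<tau>
        by (simp add: \<psi>(6))
    qed
    from this[of x y] this[of x 0] this[of 0 y] show ?thesis using that unfolding g_def by linarith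
  qed
  have g_le: "\<bar>g s\<bar> \<le> 2 * \<tau>" for s
  proof -
    have "\<psi> (s - 2 * \<tau>) \<le> \<psi> (s + 2 * \<tau>)" using \<tau> by (intro monoD[OF \<psi>(3)]) simp
    moreover have "\<psi> (s + 2 * \<tau>) - \<psi> (s - 2 * \<tau>) \<le> 4 * \<tau>"
      using monoD[OF \<psi>(4), of "s - 2 * \<tau>" "s + 2 * \<tau>"] \<tau> by simp
    ultimately show ?thesis by (simp add: g_def)
  qed
  have "convex_on UNIV k"
    using convex_on_realI[of UNIV k g] k(2) g_mono by auto
  moreover have "k s = s\<^sup>2 / 2" if "\<bar>s\<bar> \<le> \<tau>" for s
  proof -
    have "\<exists>c. \<forall>x\<in>{-\<tau>..\<tau>}. k x - x\<^sup>2 / 2 = c"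
    proof (rule has_field_derivative_zero_constant)
      fix x assume "x \<in> {-\<tau>..\<tau>}"
      then have "g x = x" using g_id by auto
      then have "((\<lambda>x. k x - x\<^sup>2 / 2) has_real_derivative 0) (at x)"
        by (auto intro!: derivative_eq_intros k(2))
      then show "((\<lambda>x. k x - x\<^sup>2 / 2) has_real_derivative 0) (at x within {-\<tau>..\<tau>})"
        by (rule has_field_derivative_at_within)
    qed auto
    then obtain c where c: "\<And>x. x \<in> {-\<tau>..\<tau>} \<Longrightarrow> k x - x\<^sup>2 / 2 = c" by blast
    show ?thesis using c[of s] c[of 0] that \<tau> k(3) by (auto simp: abs_le_iff)
  qed
  moreover have "k s \<le> 2 * \<tau> * \<bar>s\<bar>" for s
  proof -
    have "norm (k s - k 0) \<le> 2 * \<tau> * norm (s - 0)"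
      by (rule field_differentiable_bound[of UNIV k g])
         (use k(2) g_le in auto)
    then show ?thesis using k(3) by simp
  qed
  ultimately show ?thesis using that k(1) by blast
qed

section \<open>Strict derivatives and the implicit function theorem\<close>

text \<open>Both points of the increment move. Unlike an ordinary derivative at \<open>a\<close>,
  this controls injectivity near \<open>a\<close>, and it asks for no derivative at any other
  point.\<close>

definition has_strict_derivative ::
    "('a::real_normed_vector \<Rightarrow> 'b::real_normed_vector) \<Rightarrow> ('a \<Rightarrow> 'b) \<Rightarrow> 'a \<Rightarrow> bool" where
  "has_strict_derivative f f' a \<longleftrightarrow> bounded_linear f' \<and>
     (\<forall>e>0. \<exists>r>0. \<forall>x\<in>ball a r. \<forall>y\<in>ball a r. norm (f x - f y - f' (x - y)) \<le> e * norm (x - y))"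

lemma has_strict_derivativeD:
  assumes "has_strict_derivative f f' a" "e > 0"
  obtains r where "r > 0" "\<And>x y. x \<in> ball a r \<Longrightarrow> y \<in> ball a r \<Longrightarrow> norm (f x - f y - f' (x - y)) \<le> e * norm (x - y)"
  using assms unfolding has_strict_derivative_def by blast

lemma has_strict_derivative_bounded_linear: "has_strict_derivative f f' a \<Longrightarrow> bounded_linear f'"
  by (simp add: has_strict_derivative_def)

lemma has_strict_derivative_lipschitz:
  assumes "has_strict_derivative f f' a"
  obtains r L where "r > 0" "L > 0" "\<And>x y. x \<in> ball a r \<Longrightarrow> y \<in> ball a r \<Longrightarrow> norm (f x - f y) \<le> L * norm (x - y)"
proof -
  obtain r where r: "r > 0" "\<And>x y. x \<in> ball a r \<Longrightarrow> y \<in> ball a r \<Longrightarrow> norm (f x - f y - f' (x - y)) \<le> 1 * norm (x - y)"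
    using has_strict_derivativeD[OF assms zero_less_one] by blast
  obtain B where B: "B > 0" "\<And>x. norm (f' x) \<le> norm x * B"
    using bounded_linear.pos_bounded[OF has_strict_derivative_bounded_linear[OF assms]] by blast
  show ?thesis
  proof (rule that[OF r(1), of "1 + B"])
    fix x y assume "x \<in> ball a r" "y \<in> ball a r"
    then have "norm (f x - f y - f' (x - y)) \<le> norm (x - y)" using r(2) by simp
    moreover have "norm (f x - f y) \<le> norm (f x - f y - f' (x - y)) + norm (f' (x - y))"
      using norm_triangle_ineq[of "f x - f y - f' (x - y)" "f' (x - y)"] by simp
    ultimately show "norm (f x - f y) \<le> (1 + B) * norm (x - y)"
      using B(2)[of "x - y"] by (simp add: algebra_simps)
  qed (use B in simp)
qed

lemma has_strict_derivative_near:
  assumes "has_strict_derivative f f' a" "e > 0"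
  obtains r where "r > 0" "\<And>x. x \<in> ball a r \<Longrightarrow> norm (f x - f a) \<le> e"
proof -
  obtain r L where r: "r > 0" "L > 0" "\<And>x y. x \<in> ball a r \<Longrightarrow> y \<in> ball a r \<Longrightarrow> norm (f x - f y) \<le> L * norm (x - y)"
    using has_strict_derivative_lipschitz[OF assms(1)] by blast
  show ?thesis
  proof (rule that[of "min r (e / L)"])
    fix x assume x: "x \<in> ball a (min r (e / L))"
    then have "norm (f x - f a) \<le> L * norm (x - a)" using r by auto
    also have "\<dots> \<le> L * (e / L)" using x r by (intro mult_left_mono) (auto simp: dist_norm norm_minus_commute)
    finally show "norm (f x - f a) \<le> e" using r by simp
  qed (use r assms in auto)
qed

lemma has_strict_derivative_continuous_on:
  assumes "has_strict_derivative f f' a"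
  obtains r where "r > 0" "continuous_on (ball a r) f"
proof -
  obtain r L where r: "r > 0" "L > 0" "\<And>x y. x \<in> ball a r \<Longrightarrow> y \<in> ball a r \<Longrightarrow> norm (f x - f y) \<le> L * norm (x - y)"
    using has_strict_derivative_lipschitz[OF assms(1)] by blast
  have "L-lipschitz_on (ball a r) f"
    by (rule lipschitz_onI) (use r in \<open>auto simp: dist_norm\<close>)
  then show ?thesis using that r(1) lipschitz_on_continuous_on by blast
qed

lemma has_strict_derivative_linear: "bounded_linear f \<Longrightarrow> has_strict_derivative f f a"
  unfolding has_strict_derivative_def
  by (auto simp: linear_simps intro!: exI[of _ 1] zero_less_one)

lemma has_strict_derivative_const: "has_strict_derivative (\<lambda>x. c) (\<lambda>x. 0) a"
  unfolding has_strict_derivative_def by (auto intro!: exI[of _ 1])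

lemma has_strict_derivative_add:
  assumes "has_strict_derivative f f' a" "has_strict_derivative g g' a"
  shows "has_strict_derivative (\<lambda>x. f x + g x) (\<lambda>x. f' x + g' x) a"
  unfolding has_strict_derivative_def
proof (intro conjI allI impI)
  show "bounded_linear (\<lambda>x. f' x + g' x)"
    using assms by (intro bounded_linear_add) (auto simp: has_strict_derivative_def)
  fix e :: real assume "e > 0"
  then have e: "e / 2 > 0" by simp
  obtain r where r: "r > 0" "\<And>x y. x \<in> ball a r \<Longrightarrow> y \<in> ball a r \<Longrightarrow> norm (f x - f y - f' (x - y)) \<le> e / 2 * norm (x - y)"
    using has_strict_derivativeD[OF assms(1) e] by blast
  obtain s where s: "s > 0" "\<And>x y. x \<in> ball a s \<Longrightarrow> y \<in> ball a s \<Longrightarrow> norm (g x - g y - g' (x - y)) \<le> e / 2 * norm (x - y)"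
    using has_strict_derivativeD[OF assms(2) e] by blast
  show "\<exists>r>0. \<forall>x\<in>ball a r. \<forall>y\<in>ball a r.
      norm (f x + g x - (f y + g y) - (f' (x - y) + g' (x - y))) \<le> e * norm (x - y)"
  proof (intro exI[of _ "min r s"] conjI ballI)
    fix x y assume "x \<in> ball a (min r s)" "y \<in> ball a (min r s)"
    then have "norm (f x - f y - f' (x - y)) + norm (g x - g y - g' (x - y)) \<le> e * norm (x - y)"
      using r(2)[of x y] s(2)[of x y] by (auto simp: field_simps)
    then show "norm (f x + g x - (f y + g y) - (f' (x - y) + g' (x - y))) \<le> e * norm (x - y)"
      using norm_triangle_ineq[of "f x - f y - f' (x - y)" "g x - g y - g' (x - y)"]
      by (simp add: algebra_simps)
  qed (use r s in auto)
qed

lemma has_strict_derivative_compose: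
  assumes "has_strict_derivative f f' a" "has_strict_derivative g g' (f a)"
  shows "has_strict_derivative (\<lambda>x. g (f x)) (\<lambda>x. g' (f' x)) a"
  unfolding has_strict_derivative_def
proof (intro conjI allI impI)
  show "bounded_linear (\<lambda>x. g' (f' x))"
    using assms bounded_linear_compose by (auto simp: has_strict_derivative_def)
  fix e :: real assume e: "e > 0"
  obtain B where B: "B > 0" "\<And>x. norm (g' x) \<le> norm x * B"
    using bounded_linear.pos_bounded[OF has_strict_derivative_bounded_linear[OF assms(2)]] by blast
  obtain r0 L where L: "r0 > 0" "L > 0" "\<And>x y. x \<in> ball a r0 \<Longrightarrow> y \<in> ball a r0 \<Longrightarrow> norm (f x - f y) \<le> L * norm (x - y)"
    using has_strict_derivative_lipschitz[OF assms(1)] by blast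
  obtain r1 where r1: "r1 > 0" "\<And>x y. x \<in> ball a r1 \<Longrightarrow> y \<in> ball a r1 \<Longrightarrow> norm (f x - f y - f' (x - y)) \<le> e / (2 * B) * norm (x - y)"
    using has_strict_derivativeD[OF assms(1), of "e / (2 * B)"] e B(1) by (auto simp: field_simps)
  obtain s where s: "s > 0" "\<And>x y. x \<in> ball (f a) s \<Longrightarrow> y \<in> ball (f a) s \<Longrightarrow> norm (g x - g y - g' (x - y)) \<le> e / (2 * L) * norm (x - y)"
    using has_strict_derivativeD[OF assms(2), of "e / (2 * L)"] e L(2) by (auto simp: field_simps)
  obtain r2 where r2: "r2 > 0" "\<And>x. x \<in> ball a r2 \<Longrightarrow> norm (f x - f a) \<le> s / 2"
    using has_strict_derivative_near[OF assms(1), of "s / 2"] s(1) by auto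
  define r where "r = min r0 (min r1 r2)"
  show "\<exists>r>0. \<forall>x\<in>ball a r. \<forall>y\<in>ball a r. norm (g (f x) - g (f y) - g' (f' (x - y))) \<le> e * norm (x - y)"
  proof (intro exI[of _ r] conjI ballI)
    show "r > 0" using L r1 r2 by (simp add: r_def)
    fix x y assume "x \<in> ball a r" "y \<in> ball a r"
    then have xy: "x \<in> ball a r0" "y \<in> ball a r0" "x \<in> ball a r1" "y \<in> ball a r1" "x \<in> ball a r2" "y \<in> ball a r2"
      by (auto simp: r_def)
    have "f x \<in> ball (f a) s" "f y \<in> ball (f a) s"
      using r2(2)[OF xy(5)] r2(2)[OF xy(6)] s(1) by (auto simp: dist_norm norm_minus_commute)
    then have "norm (g (f x) - g (f y) - g' (f x - f y)) \<le> e / (2 * L) * norm (f x - f y)"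
      by (rule s(2))
    also have "\<dots> \<le> e / (2 * L) * (L * norm (x - y))"
      using L e xy by (intro mult_left_mono L) auto
    finally have 1: "norm (g (f x) - g (f y) - g' (f x - f y)) \<le> e / 2 * norm (x - y)"
      using L by simp
    have "norm (g' (f x - f y - f' (x - y))) \<le> (e / (2 * B) * norm (x - y)) * B"
      by (rule order_trans[OF B(2)]) (use B xy in \<open>intro mult_right_mono r1, auto\<close>)
    then have 2: "norm (g' (f x - f y - f' (x - y))) \<le> e / 2 * norm (x - y)"
      using B by simp
    have "g (f x) - g (f y) - g' (f' (x - y)) = (g (f x) - g (f y) - g' (f x - f y)) + g' (f x - f y - f' (x - y))"
      using linear_diff[OF bounded_linear.linear[OF has_strict_derivative_bounded_linear[OF assms(2)]]] by simp
    then have "norm (g (f x) - g (f y) - g' (f' (x - y))) \<le> norm (g (f x) - g (f y) - g' (f x - f y)) + norm (g' (f x - f y - f' (x - y)))"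
      by (metis norm_triangle_ineq)
    with 1 2 show "norm (g (f x) - g (f y) - g' (f' (x - y))) \<le> e * norm (x - y)"
      by (simp add: field_simps)
  qed
qed

lemma has_strict_derivative_bounded_linear_compose:
  assumes "bounded_linear g" "has_strict_derivative f f' a"
  shows "has_strict_derivative (\<lambda>x. g (f x)) (\<lambda>x. g (f' x)) a"
  by (rule has_strict_derivative_compose[OF assms(2) has_strict_derivative_linear[OF assms(1)]])

lemma has_strict_derivative_Pair:
  assumes "has_strict_derivative f f' a" "has_strict_derivative g g' a"
  shows "has_strict_derivative (\<lambda>x. (f x, g x)) (\<lambda>x. (f' x, g' x)) a"
proof -
  have "bounded_linear (\<lambda>x. (x, 0))" "bounded_linear (\<lambda>x. (0, x))"
    by (intro bounded_linear_Pair bounded_linear_ident bounded_linear_zero)+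
  from has_strict_derivative_add[OF has_strict_derivative_bounded_linear_compose[OF this(1) assms(1)]
     has_strict_derivative_bounded_linear_compose[OF this(2) assms(2)]]
  show ?thesis by simp
qed

text \<open>The remainder is exactly mul (x-y)_1 (x-a)_2 + mul (y-a)_1 (x-y)_2, in which each term
  has one factor x-y and one factor that is small near \<open>a\<close>.\<close>

lemma has_strict_derivative_bilinear_Pair:
  assumes "bounded_bilinear mul"
  shows "has_strict_derivative (\<lambda>z. mul (fst z) (snd z)) (\<lambda>z. mul (fst a) (snd z) + mul (fst z) (snd a)) a"
  unfolding has_strict_derivative_def
proof (intro conjI allI impI)
  interpret bounded_bilinear "mul" by fact
  show "bounded_linear (\<lambda>z. mul (fst a) (snd z) + mul (fst z) (snd a))"
    by (intro bounded_linear_add bounded_linear_compose[OF bounded_linear_right bounded_linear_snd]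
          bounded_linear_compose[OF bounded_linear_left bounded_linear_fst])
  fix e :: real assume e: "e > 0"
  obtain B where B: "B > 0" "\<And>x y. norm (mul x y) \<le> norm x * norm y * B" using pos_bounded by blast
  have key: "norm (mul (fst x) (snd x) - mul (fst y) (snd y) - (mul (fst a) (snd (x - y)) + mul (fst (x - y)) (snd a)))
      \<le> e * norm (x - y)" if "x \<in> ball a (e / (2 * B))" "y \<in> ball a (e / (2 * B))" for x y
  proof -
    have "mul (fst x) (snd x) - mul (fst y) (snd y) - (mul (fst a) (snd (x - y)) + mul (fst (x - y)) (snd a))
      = mul (fst (x - y)) (snd (x - a)) + mul (fst (y - a)) (snd (x - y))"
      by (simp add: diff_left diff_right)
    moreover have "norm (mul (fst (x - y)) (snd (x - a))) \<le> norm (x - y) * (e / (2 * B)) * B"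
      using that B(1) e norm_fst_le[of "fst (x - y)" "snd (x - y)"] norm_snd_le[of "snd (x - a)" "fst (x - a)"]
      unfolding prod.collapse
      by (intro order_trans[OF B(2)] mult_right_mono mult_mono) (auto simp: dist_norm norm_minus_commute)
    moreover have "norm (mul (fst (y - a)) (snd (x - y))) \<le> (e / (2 * B)) * norm (x - y) * B"
      using that B(1) e norm_fst_le[of "fst (y - a)" "snd (y - a)"] norm_snd_le[of "snd (x - y)" "fst (x - y)"]
      unfolding prod.collapse
      by (intro order_trans[OF B(2)] mult_right_mono mult_mono) (auto simp: dist_norm norm_minus_commute)
    ultimately show ?thesis
      using norm_triangle_ineq[of "mul (fst (x - y)) (snd (x - a))" "mul (fst (y - a)) (snd (x - y))"] B(1)
      by (simp add: field_simps)
  qed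
  show "\<exists>r>0. \<forall>x\<in>ball a r. \<forall>y\<in>ball a r.
      norm (mul (fst x) (snd x) - mul (fst y) (snd y) - (mul (fst a) (snd (x - y)) + mul (fst (x - y)) (snd a)))
      \<le> e * norm (x - y)"
    by (intro exI[of _ "e / (2 * B)"] conjI ballI key) (use e B in auto)
qed

lemma has_strict_derivative_bilinear:
  assumes "bounded_bilinear mul" "has_strict_derivative f f' a" "has_strict_derivative g g' a"
  shows "has_strict_derivative (\<lambda>x. mul (f x) (g x)) (\<lambda>x. mul (f a) (g' x) + mul (f' x) (g a)) a"
  using has_strict_derivative_compose[OF has_strict_derivative_Pair[OF assms(2,3)] has_strict_derivative_bilinear_Pair[OF assms(1)]]
  by simp

text \<open>The error equals -(1/(xy) - 1/a^2)(x - y), so continuity of 1/(xy) at (a, a)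
  suffices.\<close>

lemma has_strict_derivative_inverse_real:
  fixes a :: real assumes a: "a \<noteq> 0"
  shows "has_strict_derivative inverse (\<lambda>x. - (inverse a * x * inverse a)) a"
  unfolding has_strict_derivative_def
proof (intro conjI allI impI)
  show "bounded_linear (\<lambda>x. - (inverse a * x * inverse a))"
    by (intro bounded_linear_minus bounded_linear_mult_left[THEN bounded_linear_compose] bounded_linear_mult_right)
  fix e :: real assume e: "e > 0"
  have "((\<lambda>z. inverse (fst z * snd z)) \<longlongrightarrow> inverse (a * a)) (at (a, a))"
    using a by (auto intro!: tendsto_eq_intros)
  then obtain d where d: "d > 0" "\<And>z. z \<noteq> (a, a) \<Longrightarrow> dist z (a, a) < d \<Longrightarrow> \<bar>inverse (fst z * snd z) - inverse (a * a)\<bar> < e"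
    using e unfolding tendsto_iff eventually_at by (auto simp: dist_real_def)
  have key: "norm (inverse x - inverse y - - (inverse a * (x - y) * inverse a)) \<le> e * norm (x - y)"
    if "x \<in> ball a (min (d / 2) \<bar>a\<bar>)" "y \<in> ball a (min (d / 2) \<bar>a\<bar>)" for x y
  proof -
    have nz: "x \<noteq> 0" "y \<noteq> 0" using that by (auto simp: dist_real_def)
    have "dist (x, y) (a, a) \<le> dist x a + dist y a"
      using sqrt_sum_squares_le_sum[of "dist x a" "dist y a"] by (simp add: dist_Pair_Pair)
    then have "dist (x, y) (a, a) < d" using that by (simp add: dist_commute)
    then have "\<bar>inverse (x * y) - inverse (a * a)\<bar> \<le> e" using d(2)[of "(x, y)"] e by (cases "(x,y) = (a,a)") auto
    then have "\<bar>inverse (x * y) - inverse (a * a)\<bar> * \<bar>x - y\<bar> \<le> e * \<bar>x - y\<bar>" by (rule mult_right_mono) simp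
    moreover have "inverse x - inverse y - - (inverse a * (x - y) * inverse a) = - ((inverse (x * y) - inverse (a * a)) * (x - y))"
      using nz a by (simp add: field_simps)
    ultimately show ?thesis by (simp add: abs_mult)
  qed
  show "\<exists>r>0. \<forall>x\<in>ball a r. \<forall>y\<in>ball a r. norm (inverse x - inverse y - - (inverse a * (x - y) * inverse a)) \<le> e * norm (x - y)"
    by (intro exI[of _ "min (d / 2) \<bar>a\<bar>"] conjI ballI key) (use d a in auto)
qed

lemma has_strict_derivative_inverse:
  fixes f :: "'a::real_normed_vector \<Rightarrow> real"
  assumes "has_strict_derivative f f' a" "f a \<noteq> 0"
  shows "has_strict_derivative (\<lambda>x. inverse (f x)) (\<lambda>x. - (inverse (f a) * f' x * inverse (f a))) a"
  using has_strict_derivative_compose[OF assms(1) has_strict_derivative_inverse_real[OF assms(2)]] .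

text \<open>Of the lower bound \<open>B\<close> for the injective derivative, the linearisation
  error consumes B/2 and the perturbation B/4. One radius works for all small \<open>s\<close>, as
  needed for lambda close to 1.\<close>

lemma strict_derivative_bounded_below_perturbed:
  fixes f g :: "'a::euclidean_space \<Rightarrow> 'b::euclidean_space"
  assumes "has_strict_derivative f f' a" "has_strict_derivative g g' a" and inj: "\<And>x. f' x = 0 \<Longrightarrow> x = 0"
  obtains r \<eta> m where "r > 0" "\<eta> > 0" "m > 0"
    "\<And>s x y. \<bar>s\<bar> \<le> \<eta> \<Longrightarrow> x \<in> ball a r \<Longrightarrow> y \<in> ball a r \<Longrightarrow>
       m * norm (x - y) \<le> norm ((f x + s *\<^sub>R g x) - (f y + s *\<^sub>R g y))"
proof -
  have lin: "linear f'" using assms(1) by (simp add: has_strict_derivative_def bounded_linear.linear)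
  then have "inj f'" using inj by (metis linear_injective_0)
  then obtain B where B: "B > 0" "\<And>x. B * norm x \<le> norm (f' x)"
    using linear_inj_bounded_below_pos[OF lin] by blast
  obtain r where r: "r > 0" "\<And>x y. x \<in> ball a r \<Longrightarrow> y \<in> ball a r \<Longrightarrow> norm (f x - f y - f' (x - y)) \<le> B / 2 * norm (x - y)"
    using has_strict_derivativeD[OF assms(1), of "B / 2"] B(1) by auto
  obtain q L where L: "q > 0" "L > 0" "\<And>x y. x \<in> ball a q \<Longrightarrow> y \<in> ball a q \<Longrightarrow> norm (g x - g y) \<le> L * norm (x - y)"
    using has_strict_derivative_lipschitz[OF assms(2)] by blast
  show ?thesis
  proof (rule that[of "min r q" "B / (4 * L)" "B / 4"])
    fix s x y assume s: "\<bar>s\<bar> \<le> B / (4 * L)" and "x \<in> ball a (min r q)" "y \<in> ball a (min r q)"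
    then have 1: "norm (f x - f y - f' (x - y)) \<le> B / 2 * norm (x - y)" and 2: "norm (g x - g y) \<le> L * norm (x - y)"
      using r L by auto
    have "norm (s *\<^sub>R (g x - g y)) \<le> B / (4 * L) * (L * norm (x - y))"
      unfolding norm_scaleR using s 2 L B by (intro mult_mono) auto
    then have 3: "norm (s *\<^sub>R (g x - g y)) \<le> B / 4 * norm (x - y)" using L by simp
    have "norm (f' (x - y)) \<le> norm (f x - f y) + norm (f x - f y - f' (x - y))"
      using norm_triangle_ineq4[of "f x - f y" "f x - f y - f' (x - y)"] by simp
    moreover have "norm (f x - f y) \<le> norm ((f x + s *\<^sub>R g x) - (f y + s *\<^sub>R g y)) + norm (s *\<^sub>R (g x - g y))"
      using norm_triangle_ineq4[of "(f x + s *\<^sub>R g x) - (f y + s *\<^sub>R g y)" "s *\<^sub>R (g x - g y)"]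
      by (simp add: algebra_simps)
    ultimately show "B / 4 * norm (x - y) \<le> norm ((f x + s *\<^sub>R g x) - (f y + s *\<^sub>R g y))"
      using B(2)[of "x - y"] 1 3 by (simp add: field_simps)
  qed (use r L B in auto)
qed

lemma strict_derivative_bounded_below:
  fixes f :: "'a::euclidean_space \<Rightarrow> 'b::euclidean_space"
  assumes "has_strict_derivative f f' a" and inj: "\<And>x. f' x = 0 \<Longrightarrow> x = 0"
  obtains r m where "r > 0" "m > 0"
    "\<And>x y. x \<in> ball a r \<Longrightarrow> y \<in> ball a r \<Longrightarrow> m * norm (x - y) \<le> norm (f x - f y)"
proof -
  obtain r \<eta> m where *: "r > 0" "\<eta> > 0" "m > 0"
    "\<And>s x y. \<bar>s\<bar> \<le> \<eta> \<Longrightarrow> x \<in> ball a r \<Longrightarrow> y \<in> ball a r \<Longrightarrow>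
       m * norm (x - y) \<le> norm ((f x + s *\<^sub>R f x) - (f y + s *\<^sub>R f y))"
    using strict_derivative_bounded_below_perturbed[OF assms(1,1) inj] by blast
  then show ?thesis using *(4)[of 0] that[of r m] by simp
qed

text \<open>The map (rho, v) to (rho, Phi (rho, v)) is injective near 0 by the lower bound, so its
  image is open by invariance of domain and contains all (rho, 0) with small rho. The same lower
  bound makes the selected solution Lipschitz.\<close>

lemma strict_implicit_function:
  fixes \<Phi> :: "'a::euclidean_space \<times> 'b::euclidean_space \<Rightarrow> 'b"
  assumes \<Phi>: "has_strict_derivative \<Phi> \<Phi>' 0" "\<Phi> 0 = 0" and inj: "\<And>v. \<Phi>' (0, v) = 0 \<Longrightarrow> v = 0"
  obtains U r where "r > 0" "continuous_on (ball 0 r) U" "U 0 = 0" "\<And>\<rho>. \<rho> \<in> ball 0 r \<Longrightarrow> \<Phi> (\<rho>, U \<rho>) = 0"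
proof -
  define \<Psi> where "\<Psi> z = (fst z, \<Phi> z)" for z
  have \<Psi>: "has_strict_derivative \<Psi> (\<lambda>z. (fst z, \<Phi>' z)) 0"
    unfolding \<Psi>_def[abs_def]
    by (intro has_strict_derivative_Pair \<Phi> has_strict_derivative_linear bounded_linear_fst)
  obtain r m where r: "r > 0" "m > 0"
    "\<And>x y. x \<in> ball 0 r \<Longrightarrow> y \<in> ball 0 r \<Longrightarrow> m * norm (x - y) \<le> norm (\<Psi> x - \<Psi> y)"
  proof -
    have "x = 0" if "(fst x, \<Phi>' x) = 0" for x
      using that inj[of "snd x"] by (cases x) (auto simp: zero_prod_def)
    from strict_derivative_bounded_below[OF \<Psi> this] show ?thesis using that by blast
  qed
  obtain q where q: "q > 0" "continuous_on (ball 0 q) \<Psi>"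
    using has_strict_derivative_continuous_on[OF \<Psi>] by blast
  define s where "s = min r q / 2"
  have s: "s > 0" "cball 0 s \<subseteq> ball (0::'a \<times> 'b) r" "cball 0 s \<subseteq> ball (0::'a \<times> 'b) q"
    using r q by (auto simp: s_def)
  have injs: "inj_on \<Psi> (cball 0 s)"
  proof (rule inj_onI)
    fix x y assume "x \<in> cball 0 s" "y \<in> cball 0 s" "\<Psi> x = \<Psi> y"
    then have "m * norm (x - y) \<le> 0" using r(3)[of x y] subsetD[OF s(2), of x] subsetD[OF s(2), of y] by simp
    then show "x = y" using r(2) by (simp add: mult_le_0_iff)
  qed
  have "open (\<Psi> ` ball 0 s)"
    by (rule invariance_of_domain_ball[OF continuous_on_subset[OF q(2) s(3)] s(1) injs])
  moreover have "0 \<in> \<Psi> ` ball 0 s" using s(1) \<Phi>(2)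
    by (intro image_eqI[of _ _ 0]) (auto simp: \<Psi>_def zero_prod_def)
  ultimately obtain t where t: "t > 0" "ball 0 t \<subseteq> \<Psi> ` ball 0 s" by (meson open_contains_ball)
  have ex: "\<exists>u. (\<rho>, u) \<in> ball 0 s \<and> \<Phi> (\<rho>, u) = 0" if "\<rho> \<in> ball 0 t" for \<rho>
  proof -
    have "(\<rho>, 0) \<in> ball 0 t" using that by (simp add: zero_prod_def dist_Pair_Pair)
    then obtain z where "z \<in> ball 0 s" "(\<rho>, 0) = \<Psi> z" using t by blast
    then show ?thesis by (cases z) (auto simp: \<Psi>_def)
  qed
  define U where "U \<rho> = (SOME u. (\<rho>, u) \<in> ball 0 s \<and> \<Phi> (\<rho>, u) = 0)" for \<rho>
  have U: "(\<rho>, U \<rho>) \<in> ball 0 s" "\<Phi> (\<rho>, U \<rho>) = 0" if "\<rho> \<in> ball 0 t" for \<rho>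
    using someI_ex[OF ex[OF that]] unfolding U_def by auto
  have lip: "norm ((\<rho>, U \<rho>) - (\<rho>', U \<rho>')) \<le> 1 / m * norm (\<rho> - \<rho>')" if "\<rho> \<in> ball 0 t" "\<rho>' \<in> ball 0 t" for \<rho> \<rho>'
  proof -
    have "m * norm ((\<rho>, U \<rho>) - (\<rho>', U \<rho>')) \<le> norm (\<Psi> (\<rho>, U \<rho>) - \<Psi> (\<rho>', U \<rho>'))"
      using U[OF that(1)] U[OF that(2)] s(2) ball_subset_cball by (intro r(3)) blast+
    also have "\<dots> = norm (\<rho> - \<rho>')" using U[OF that(1)] U[OF that(2)] by (simp add: \<Psi>_def norm_Pair)
    finally show ?thesis using r(2) by (simp add: field_simps)
  qed
  have "(1 / m)-lipschitz_on (ball 0 t) U"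
  proof (rule lipschitz_onI)
    fix \<rho> \<rho>' :: 'a assume "\<rho> \<in> ball 0 t" "\<rho>' \<in> ball 0 t"
    from lip[OF this] show "dist (U \<rho>) (U \<rho>') \<le> 1 / m * dist \<rho> \<rho>'"
      using norm_snd_le[of "U \<rho> - U \<rho>'" "\<rho> - \<rho>'"] by (simp add: dist_norm)
  qed (use r in simp)
  then have "continuous_on (ball 0 t) U" by (rule lipschitz_on_continuous_on)
  moreover have "U 0 = 0"
  proof -
    have 0: "0 \<in> ball (0::'a) t" using t by simp
    have "(0::'a, U 0) = (0, 0)"
    proof (rule inj_onD[OF injs])
      show "(0::'a, U 0) \<in> cball 0 s" by (rule subsetD[OF ball_subset_cball U(1)[OF 0]])
      show "\<Psi> (0::'a, U 0) = \<Psi> (0, 0)" using U(2)[OF 0] \<Phi>(2) by (simp add: \<Psi>_def zero_prod_def)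
      show "(0::'a, 0) \<in> cball (0::'a \<times> 'b) s" using s(1) by (simp flip: zero_prod_def)
    qed
    then show ?thesis by simp
  qed
  ultimately show ?thesis using that t(1) U(2) by blast
qed

section \<open>Linear algebra of the base configuration\<close>

text \<open>
  The two locales below express, in coordinates, that an infinitesimal variation of the base
  configuration closes up after five steps: \<open>x\<close> and \<open>y\<close> vary the two components of the vertices and
  \<open>b\<close> varies the directions of the first four edges. The entries in the two distinguished columns
  (in the order 11, 12, 21, 22) and those in any other column decouple, and in each case the
  variation is trivial as soon as it fixes one vertex or one endpoint.
\<close>

locale closed_block_variation =
  fixes x0 x1 x2 x3 y0 y1 y2 y3 b0 b1 :: "nat \<Rightarrow> real"
  assumes
    step0:
      "12 * x0 1 = - 4 * b0 0 - 4 * b1 0 + 9 * x0 0 + 3 * x1 0 + y0 0 - y1 0"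
      "12 * x1 1 = 4 * b0 0 + 4 * b1 0 + 3 * x0 0 + 9 * x1 0 - y0 0 + y1 0"
      "12 * x2 1 = - 36 * b0 0 + 12 * b1 0 + 9 * x2 0 + 3 * x3 0 + y2 0 - y3 0"
      "12 * x3 1 = 12 * b0 0 - 36 * b1 0 + 3 * x2 0 + 9 * x3 0 - y2 0 + y3 0"
      "4 * y0 1 = 4 * b0 0 - 12 * b1 0 + 3 * x0 0 + 3 * x1 0 + 3 * y0 0 - y1 0"
      "4 * y1 1 = 12 * b0 0 - 4 * b1 0 + 3 * x0 0 + 3 * x1 0 - y0 0 + 3 * y1 0"
      "4 * y2 1 = - 12 * b0 0 - 12 * b1 0 + 3 * x2 0 + 3 * x3 0 + 3 * y2 0 - y3 0"
      "4 * y3 1 = - 12 * b0 0 - 12 * b1 0 + 3 * x2 0 + 3 * x3 0 - y2 0 + 3 * y3 0"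
    and
    step1:
      "9 * x0 2 = - 36 * b0 1 + 3 * x0 1 + 2 * y0 1" "x1 2 = - 2 * b1 1 + x1 1"
      "9 * x2 2 = - 72 * b0 1 - 12 * b1 1 + 3 * x2 1 + 2 * y2 1" "x3 2 = - 4 * b1 1 + x3 1" "y0 2 = y0 1"
      "3 * y1 2 = - 18 * b1 1 + 6 * x1 1 + y1 1" "y2 2 = - 4 * b1 1 + y2 1"
      "3 * y3 2 = 24 * b0 1 - 36 * b1 1 + 6 * x3 1 + y3 1"
    and
    step2:
      "x0 3 = - 4 * b0 2 + x0 2" "3 * x1 3 = - 6 * b0 2 - 24 * b1 2 + x1 2 + y1 2" "x2 3 = 2 * b0 2 + x2 2"
      "3 * x3 3 = 12 * b1 2 + x3 2 + y3 2" "3 * y0 3 = - 24 * b0 2 + 24 * b1 2 + 4 * x0 2 + y0 2"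
      "y1 3 = - 4 * b0 2 + y1 2" "3 * y2 3 = 12 * b0 2 + 4 * x2 2 + y2 2" "y3 3 = y3 2"
    and
    step3:
      "3 * x0 4 = - 12 * b0 3 + x0 3 + y0 3" "x1 4 = - 2 * b1 3 + x1 3" "3 * x2 4 = 12 * b0 3 + 6 * b1 3 + x2 3 + y2 3"
      "x3 4 = 2 * b1 3 + x3 3" "y0 4 = y0 3" "3 * y1 4 = - 12 * b1 3 + 4 * x1 3 + y1 3" "y2 4 = 4 * b1 3 + y2 3"
      "3 * y3 4 = - 24 * b0 3 + 12 * b1 3 + 4 * x3 3 + y3 3"
    and
    step4:
      "6 * x0 0 = 4 * x0 4 - 2 * x1 4 + y0 4 + y1 4" "6 * x1 0 = - 2 * x0 4 + 4 * x1 4 + y0 4 + y1 4"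
      "6 * x2 0 = 4 * x2 4 - 2 * x3 4 + y2 4 + y3 4" "6 * x3 0 = - 2 * x2 4 + 4 * x3 4 + y2 4 + y3 4"
      "3 * y0 0 = 2 * x0 4 - 2 * x1 4 + 2 * y0 4 + y1 4" "3 * y1 0 = - 2 * x0 4 + 2 * x1 4 + y0 4 + 2 * y1 4"
      "3 * y2 0 = 2 * x2 4 - 2 * x3 4 + 2 * y2 4 + y3 4" "3 * y3 0 = - 2 * x2 4 + 2 * x3 4 + y2 4 + 2 * y3 4"
begin

lemmas steps = step0 step1 step2 step3 step4

text \<open>A linear system with denominators cleared, so \<open>algebra\<close> can decide it. Only
  the directions are eliminated here; the vertices follow afterwards by running the steps
  forward.\<close>

lemma vanishing_at_0:
  assumes
    "x0 0 = 0" "x1 0 = 0" "x2 0 = 0" "x3 0 = 0" "y0 0 = 0" "y1 0 = 0" "y2 0 = 0" "y3 0 = 0"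
  shows "b0 0 = 0 \<and> b1 0 = 0 \<and> b0 1 = 0 \<and> b1 1 = 0 \<and> b0 2 = 0 \<and> b1 2 = 0 \<and> b0 3 = 0 \<and> b1 3 = 0"
  using assms steps by algebra

text \<open>The hypotheses encode a stationary endpoint: the residual does not vary, so y = h x with
  h = 3 here, and x is minus the first-order change of the displacement from vertex to
  endpoint.\<close>

lemma vanishing_endpoint_at_0:
  assumes
    "3 * x0 0 = 2 * b0 0 + 2 * b1 0" "3 * x1 0 = - 2 * b0 0 - 2 * b1 0" "x2 0 = 2 * b0 0 + 2 * b1 0"
    "x3 0 = 2 * b0 0 + 2 * b1 0" "y0 0 = 2 * b0 0 + 2 * b1 0" "y1 0 = - 2 * b0 0 - 2 * b1 0"
    "y2 0 = 6 * b0 0 + 6 * b1 0" "y3 0 = 6 * b0 0 + 6 * b1 0"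
  shows "b0 0 = 0 \<and> b1 0 = 0 \<and> b0 1 = 0 \<and> b1 1 = 0 \<and> b0 2 = 0 \<and> b1 2 = 0 \<and> b0 3 = 0 \<and> b1 3 = 0"
  using assms steps by algebra

lemma vanishing_at_1:
  assumes
    "x0 1 = 0" "x1 1 = 0" "x2 1 = 0" "x3 1 = 0" "y0 1 = 0" "y1 1 = 0" "y2 1 = 0" "y3 1 = 0"
  shows "b0 0 = 0 \<and> b1 0 = 0 \<and> b0 1 = 0 \<and> b1 1 = 0 \<and> b0 2 = 0 \<and> b1 2 = 0 \<and> b0 3 = 0 \<and> b1 3 = 0"
  using assms steps by algebra

lemma vanishing_endpoint_at_1:
  assumes
    "x0 1 = 0" "x1 1 = 3 * b1 1" "x2 1 = 2 * b1 1" "x3 1 = 6 * b1 1" "y0 1 = 0" "y1 1 = 9 * b1 1" "y2 1 = 6 * b1 1"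
    "y3 1 = 18 * b1 1"
  shows "b0 0 = 0 \<and> b1 0 = 0 \<and> b0 1 = 0 \<and> b1 1 = 0 \<and> b0 2 = 0 \<and> b1 2 = 0 \<and> b0 3 = 0 \<and> b1 3 = 0"
  using assms steps by algebra

lemma vanishing_at_2:
  assumes
    "x0 2 = 0" "x1 2 = 0" "x2 2 = 0" "x3 2 = 0" "y0 2 = 0" "y1 2 = 0" "y2 2 = 0" "y3 2 = 0"
  shows "b0 0 = 0 \<and> b1 0 = 0 \<and> b0 1 = 0 \<and> b1 1 = 0 \<and> b0 2 = 0 \<and> b1 2 = 0 \<and> b0 3 = 0 \<and> b1 3 = 0"
  using assms steps by algebra

lemma vanishing_endpoint_at_2:
  assumes
    "x0 2 = 6 * b0 2" "x1 2 = 3 * b0 2" "x2 2 = - 3 * b0 2" "x3 2 = 0" "y0 2 = 12 * b0 2" "y1 2 = 6 * b0 2"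
    "y2 2 = - 6 * b0 2" "y3 2 = 0"
  shows "b0 0 = 0 \<and> b1 0 = 0 \<and> b0 1 = 0 \<and> b1 1 = 0 \<and> b0 2 = 0 \<and> b1 2 = 0 \<and> b0 3 = 0 \<and> b1 3 = 0"
  using assms steps by algebra

lemma vanishing_at_3:
  assumes
    "x0 3 = 0" "x1 3 = 0" "x2 3 = 0" "x3 3 = 0" "y0 3 = 0" "y1 3 = 0" "y2 3 = 0" "y3 3 = 0"
  shows "b0 0 = 0 \<and> b1 0 = 0 \<and> b0 1 = 0 \<and> b1 1 = 0 \<and> b0 2 = 0 \<and> b1 2 = 0 \<and> b0 3 = 0 \<and> b1 3 = 0"
  using assms steps by algebra

lemma vanishing_endpoint_at_3:
  assumes
    "x0 3 = 0" "x1 3 = 3 * b1 3" "x2 3 = - 3 * b1 3" "x3 3 = - 3 * b1 3" "y0 3 = 0" "y1 3 = 6 * b1 3"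
    "y2 3 = - 6 * b1 3" "y3 3 = - 6 * b1 3"
  shows "b0 0 = 0 \<and> b1 0 = 0 \<and> b0 1 = 0 \<and> b1 1 = 0 \<and> b0 2 = 0 \<and> b1 2 = 0 \<and> b0 3 = 0 \<and> b1 3 = 0"
  using assms steps by algebra

text \<open>This also serves the fifth endpoint: the last direction is frozen, so a stationary
  endpoint there already means a stationary vertex.\<close>

lemma vanishing_at_4:
  assumes
    "x0 4 = 0" "x1 4 = 0" "x2 4 = 0" "x3 4 = 0" "y0 4 = 0" "y1 4 = 0" "y2 4 = 0" "y3 4 = 0"
  shows "b0 0 = 0 \<and> b1 0 = 0 \<and> b0 1 = 0 \<and> b1 1 = 0 \<and> b0 2 = 0 \<and> b1 2 = 0 \<and> b0 3 = 0 \<and> b1 3 = 0"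
  using assms steps by algebra

end

locale closed_column_variation =
  fixes x0 x1 y0 y1 b :: "nat \<Rightarrow> real"
  assumes
    step0:
      "x0 1 = x0 0" "x1 1 = - 2 * b 0 + x1 0" "2 * y0 1 = 3 * x0 0 + y0 0" "2 * y1 1 = - 12 * b 0 + 3 * x1 0 + y1 0"
    and
    step1:
      "x0 2 = - 2 * b 1 + x0 1" "x1 2 = - 4 * b 1 + x1 1" "3 * y0 2 = - 18 * b 1 + 6 * x0 1 + y0 1"
      "3 * y1 2 = - 36 * b 1 + 6 * x1 1 + y1 1"
    and
    step2:
      "x0 3 = - 4 * b 2 + x0 2" "x1 3 = 2 * b 2 + x1 2" "3 * y0 3 = - 24 * b 2 + 4 * x0 2 + y0 2"
      "3 * y1 3 = 12 * b 2 + 4 * x1 2 + y1 2"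
    and
    step3:
      "x0 4 = - 2 * b 3 + x0 3" "x1 4 = 2 * b 3 + x1 3" "3 * y0 4 = - 12 * b 3 + 4 * x0 3 + y0 3"
      "3 * y1 4 = 12 * b 3 + 4 * x1 3 + y1 3"
    and
    step4:
      "x0 0 = x0 4" "x1 0 = x1 4" "3 * y0 0 = 4 * x0 4 + y0 4" "3 * y1 0 = 4 * x1 4 + y1 4"
begin

lemmas steps = step0 step1 step2 step3 step4

lemma vanishing_at_0:
  assumes
    "x0 0 = 0" "x1 0 = 0" "y0 0 = 0" "y1 0 = 0"
  shows "b 0 = 0 \<and> b 1 = 0 \<and> b 2 = 0 \<and> b 3 = 0"
  using assms steps by algebra

lemma vanishing_endpoint_at_0:
  assumes
    "x0 0 = 0" "x1 0 = 4 * b 0" "y0 0 = 0" "y1 0 = 12 * b 0"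
  shows "b 0 = 0 \<and> b 1 = 0 \<and> b 2 = 0 \<and> b 3 = 0"
  using assms steps by algebra

lemma vanishing_at_1:
  assumes
    "x0 1 = 0" "x1 1 = 0" "y0 1 = 0" "y1 1 = 0"
  shows "b 0 = 0 \<and> b 1 = 0 \<and> b 2 = 0 \<and> b 3 = 0"
  using assms steps by algebra

lemma vanishing_endpoint_at_1:
  assumes
    "x0 1 = 3 * b 1" "x1 1 = 6 * b 1" "y0 1 = 9 * b 1" "y1 1 = 18 * b 1"
  shows "b 0 = 0 \<and> b 1 = 0 \<and> b 2 = 0 \<and> b 3 = 0"
  using assms steps by algebra

lemma vanishing_at_2:
  assumes
    "x0 2 = 0" "x1 2 = 0" "y0 2 = 0" "y1 2 = 0"
  shows "b 0 = 0 \<and> b 1 = 0 \<and> b 2 = 0 \<and> b 3 = 0"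
  using assms steps by algebra

lemma vanishing_endpoint_at_2:
  assumes
    "x0 2 = 6 * b 2" "x1 2 = - 3 * b 2" "y0 2 = 12 * b 2" "y1 2 = - 6 * b 2"
  shows "b 0 = 0 \<and> b 1 = 0 \<and> b 2 = 0 \<and> b 3 = 0"
  using assms steps by algebra

lemma vanishing_at_3:
  assumes
    "x0 3 = 0" "x1 3 = 0" "y0 3 = 0" "y1 3 = 0"
  shows "b 0 = 0 \<and> b 1 = 0 \<and> b 2 = 0 \<and> b 3 = 0"
  using assms steps by algebra

lemma vanishing_endpoint_at_3:
  assumes
    "x0 3 = 3 * b 3" "x1 3 = - 3 * b 3" "y0 3 = 6 * b 3" "y1 3 = - 6 * b 3"
  shows "b 0 = 0 \<and> b 1 = 0 \<and> b 2 = 0 \<and> b 3 = 0"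
  using assms steps by algebra

lemma vanishing_at_4:
  assumes
    "x0 4 = 0" "x1 4 = 0" "y0 4 = 0" "y1 4 = 0"
  shows "b 0 = 0 \<and> b 1 = 0 \<and> b 2 = 0 \<and> b 3 = 0"
  using assms steps by algebra

end

section \<open>The step map and the base configuration\<close>

text \<open>
  If \<open>\<sigma> A = h A + K\<close> then \<open>p\<close> lies on the graph of \<open>\<sigma>\<close> iff \<open>w = cone_residual h K p\<close> vanishes.
  For a prescribed kernel direction \<open>b\<close>, the element of the wave cone leading from \<open>p\<close> to the graph is
  \<open>(- (w b) b\<^sup>T / h, |b|\<^sup>2 w - (w b) b\<^sup>T)\<close> up to the factor \<open>1 / |b|\<^sup>2\<close>. The length of \<open>b\<close> is kept as
  a free parameter: it encodes \<open>\<kappa> = 1 / (l |b|\<^sup>2)\<close>.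
\<close>

definition cone_residual :: "real \<Rightarrow> real^'n^'m \<Rightarrow> (real^'n^'m) \<times> (real^'n^'m) \<Rightarrow> real^'n^'m" where
  "cone_residual h K p = K + h *\<^sub>R fst p - snd p"

definition cone_step :: "real \<Rightarrow> real \<Rightarrow> real^'n^'m \<Rightarrow> (real^'n^'m) \<times> (real^'n^'m) \<Rightarrow> real^'n \<Rightarrow> (real^'n^'m) \<times> (real^'n^'m)" where
  "cone_step l h K p b = (let w = cone_residual h K p in
     ((- (l / h)) *\<^sub>R tensor (w *v b) b, l *\<^sub>R ((b \<bullet> b) *\<^sub>R w - tensor (w *v b) b)))"

text \<open>Formal derivative in (p, b). The base residual enters as a separate argument
  \<open>w\<close>, so that its numerical value can be substituted.\<close>

definition cone_step_deriv :: "real \<Rightarrow> real \<Rightarrow> real^'n^'m \<Rightarrow> real^'n \<Rightarrow> (real^'n^'m) \<times> (real^'n^'m) \<Rightarrow> real^'n \<Rightarrow> (real^'n^'m) \<times> (real^'n^'m)" where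
  "cone_step_deriv l h w b dp db = (let dw = h *\<^sub>R fst dp - snd dp; dT = tensor (w *v b) db + tensor (w *v db + dw *v b) b in
     ((- (l / h)) *\<^sub>R dT, l *\<^sub>R ((b \<bullet> b) *\<^sub>R dw + (2 * (b \<bullet> db)) *\<^sub>R w - dT)))"

lemma bounded_bilinear_tensor: "bounded_bilinear (tensor :: real^'m \<Rightarrow> real^'n \<Rightarrow> real^'n^'m)"
  unfolding bilinear_conv_bounded_bilinear[symmetric] bilinear_def
  by (auto intro!: linearI simp: tensor_def vec_eq_iff algebra_simps)

lemma bounded_bilinear_matrix_vector_mult: "bounded_bilinear ((*v) :: real^'n^'m \<Rightarrow> real^'n \<Rightarrow> real^'m)"
  unfolding bilinear_conv_bounded_bilinear[symmetric] bilinear_def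
  by (auto intro!: linearI simp: matrix_vector_mult_def vec_eq_iff algebra_simps sum.distrib sum_distrib_left)

lemma tensor_mult_vec: "tensor p a *v b = (a \<bullet> b) *\<^sub>R p"
  by (simp add: tensor_def matrix_vector_mult_def vec_eq_iff inner_vec_def sum_distrib_left sum_distrib_right mult_ac)

lemma cone_step_in_wave_cone:
  fixes b :: "real^'n" and K :: "real^'n^'m"
  assumes "b \<noteq> 0"
  shows "cone_step l h K p b \<in> wave_cone"
proof -
  let ?w = "cone_residual h K p"
  have "(l *\<^sub>R ((b \<bullet> b) *\<^sub>R ?w - tensor (?w *v b) b)) *v b = 0"
    by (simp add: matrix_vector_mult_diff_rdistrib tensor_mult_vec scaleR_matrix_vector_assoc[symmetric])
  moreover have "(- (l / h)) *\<^sub>R tensor (?w *v b) b = tensor ((- (l / h)) *\<^sub>R (?w *v b)) b"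
    by (simp add: tensor_def vec_eq_iff)
  ultimately show ?thesis
    using assms unfolding wave_cone_def cone_step_def Let_def mem_Collect_eq by blast
qed

text \<open>In h times the first component minus the second component of a step the two tensors
  cancel, leaving -l |b|^2 w. Hence the graph is reached exactly at s = 1 / (l |b|^2).\<close>

lemma cone_residual_along_step:
  assumes "h \<noteq> 0"
  shows "cone_residual h K (p + s *\<^sub>R cone_step l h K p b) = (1 - s * l * (b \<bullet> b)) *\<^sub>R cone_residual h K p"
  using assms by (simp add: cone_residual_def cone_step_def Let_def vec_eq_iff algebra_simps)

lemma has_strict_derivative_cone_step:
  fixes K :: "real^'n^'m"
  assumes p: "has_strict_derivative p p' a" and b: "has_strict_derivative b b' a"
  shows "has_strict_derivative (\<lambda>z. cone_step l h K (p z) (b z))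
     (\<lambda>z. cone_step_deriv l h (cone_residual h K (p a)) (b a) (p' z) (b' z)) a"
proof -
  let ?w = "\<lambda>z. cone_residual h K (p z)"
  have lin: "bounded_linear (\<lambda>q. h *\<^sub>R fst q - snd q :: real^'n^'m)"
    by (intro bounded_linear_sub bounded_linear_scaleR_right[THEN bounded_linear_compose] bounded_linear_fst bounded_linear_snd)
  have w: "has_strict_derivative ?w (\<lambda>z. h *\<^sub>R fst (p' z) - snd (p' z)) a"
    using has_strict_derivative_add[OF has_strict_derivative_const[of K] has_strict_derivative_bounded_linear_compose[OF lin p]]
    by (simp add: cone_residual_def add_diff_eq)
  have T: "has_strict_derivative (\<lambda>z. tensor (?w z *v b z) (b z))
      (\<lambda>z. tensor (?w a *v b a) (b' z) + tensor (?w a *v b' z + (h *\<^sub>R fst (p' z) - snd (p' z)) *v b a) (b a)) a"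
    by (intro has_strict_derivative_bilinear[OF bounded_bilinear_tensor] has_strict_derivative_bilinear[OF bounded_bilinear_matrix_vector_mult] w b)
  have bb: "has_strict_derivative (\<lambda>z. (b z \<bullet> b z) *\<^sub>R ?w z)
      (\<lambda>z. (b a \<bullet> b a) *\<^sub>R (h *\<^sub>R fst (p' z) - snd (p' z)) + (b a \<bullet> b' z + b' z \<bullet> b a) *\<^sub>R ?w a) a"
    by (intro has_strict_derivative_bilinear[OF bounded_bilinear_scaleR] has_strict_derivative_bilinear[OF bounded_bilinear_inner] w b)
  have lin2: "bounded_linear (\<lambda>q::(real^'n^'m) \<times> (real^'n^'m). ((- (l / h)) *\<^sub>R fst q, l *\<^sub>R (snd q - fst q)))"
    by (intro bounded_linear_Pair bounded_linear_sub bounded_linear_scaleR_right[THEN bounded_linear_compose] bounded_linear_fst bounded_linear_snd)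
  from has_strict_derivative_bounded_linear_compose[OF lin2 has_strict_derivative_Pair[OF T bb]]
  show ?thesis
    by (simp add: cone_step_def cone_step_deriv_def Let_def inner_commute)
qed

lemma cone_step_deriv_0: "cone_step_deriv l h w b 0 0 = 0"
  by (simp add: cone_step_deriv_def Let_def tensor_def vec_eq_iff zero_prod_def matrix_vector_mult_def)

section \<open>Coordinates with two distinguished columns, and the base data\<close>

locale two_columns =
  fixes j1 j2 :: "'n::finite"
  assumes distinct_columns: "j1 \<noteq> j2"
begin

definition blk :: "real \<Rightarrow> real \<Rightarrow> real \<Rightarrow> real \<Rightarrow> real^'n^2" where
  "blk a b c d = (\<chi> i j. if j = j1 then (if i = 1 then a else c) else if j = j2 then (if i = 1 then b else d) else 0)"

definition row2 :: "real \<Rightarrow> real \<Rightarrow> real^'n" where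
  "row2 a b = (\<chi> j. if j = j1 then a else if j = j2 then b else 0)"

lemma sum_two_columns:
  fixes f g :: "'n \<Rightarrow> real"
  assumes "\<And>j. j \<noteq> j1 \<Longrightarrow> j \<noteq> j2 \<Longrightarrow> f j = 0"
  shows "(\<Sum>j\<in>UNIV. f j) = f j1 + f j2"
proof -
  have "(\<Sum>j\<in>UNIV. f j) = (\<Sum>j\<in>{j1, j2}. f j)"
    by (rule sum.mono_neutral_right) (use assms in auto)
  then show ?thesis using distinct_columns by simp
qed

lemma blk_nth [simp]:
  "blk a b c d $ 1 $ j1 = a" "blk a b c d $ 1 $ j2 = b" "blk a b c d $ 2 $ j1 = c" "blk a b c d $ 2 $ j2 = d"
  "j \<noteq> j1 \<Longrightarrow> j \<noteq> j2 \<Longrightarrow> blk a b c d $ i $ j = 0"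
  using distinct_columns distinct_columns[symmetric] by (auto simp: blk_def)

lemma row2_nth [simp]:
  "row2 a b $ j1 = a" "row2 a b $ j2 = b" "j \<noteq> j1 \<Longrightarrow> j \<noteq> j2 \<Longrightarrow> row2 a b $ j = 0"
  using distinct_columns distinct_columns[symmetric] by (auto simp: row2_def)

lemma matrix_eq_iff_columns:
  fixes A B :: "real^'n^2"
  shows "A = B \<longleftrightarrow> A $ 1 $ j1 = B $ 1 $ j1 \<and> A $ 1 $ j2 = B $ 1 $ j2 \<and> A $ 2 $ j1 = B $ 2 $ j1 \<and> A $ 2 $ j2 = B $ 2 $ j2
     \<and> (\<forall>j. j \<noteq> j1 \<longrightarrow> j \<noteq> j2 \<longrightarrow> A $ 1 $ j = B $ 1 $ j \<and> A $ 2 $ j = B $ 2 $ j)"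
  unfolding vec_eq_iff forall_2 by metis

lemma vector_eq_iff_columns:
  fixes a b :: "real^'n"
  shows "a = b \<longleftrightarrow> a $ j1 = b $ j1 \<and> a $ j2 = b $ j2 \<and> (\<forall>j. j \<noteq> j1 \<longrightarrow> j \<noteq> j2 \<longrightarrow> a $ j = b $ j)"
  unfolding vec_eq_iff by metis

lemma mult_row2: "(w *v row2 a b) $ i = w $ i $ j1 * a + w $ i $ j2 * b"
  unfolding matrix_vector_mult_def by (simp add: sum_two_columns)

lemma blk_mult:
  "(blk a b c d *v v) $ 1 = a * v $ j1 + b * v $ j2" "(blk a b c d *v v) $ 2 = c * v $ j1 + d * v $ j2"
  unfolding matrix_vector_mult_def by (simp_all add: sum_two_columns)

lemma row2_inner: "row2 a b \<bullet> v = a * v $ j1 + b * v $ j2" "v \<bullet> row2 a b = a * v $ j1 + b * v $ j2"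
  unfolding inner_vec_def by (simp_all add: sum_two_columns)

lemma blk_inner: "blk a b c d \<bullet> A = a * A $ 1 $ j1 + b * A $ 1 $ j2 + c * A $ 2 $ j1 + d * A $ 2 $ j2"
  unfolding inner_vec_def by (simp add: sum_2 sum_two_columns inner_vec_def)

lemma blk_arith:
  "blk a b c d + blk a' b' c' d' = blk (a + a') (b + b') (c + c') (d + d')"
  "blk a b c d - blk a' b' c' d' = blk (a - a') (b - b') (c - c') (d - d')"
  "r *\<^sub>R blk a b c d = blk (r * a) (r * b) (r * c) (r * d)"
  "blk 0 0 0 0 = 0"
  by (simp_all add: matrix_eq_iff_columns)

lemma cone_step_blk:
  fixes k1 k2 k3 k4 x1 x2 x3 x4 y1 y2 y3 y4 h l b1 b2 :: real
  defines "w1 \<equiv> k1 + h * x1 - y1" and "w2 \<equiv> k2 + h * x2 - y2" and "w3 \<equiv> k3 + h * x3 - y3" and "w4 \<equiv> k4 + h * x4 - y4"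
  defines "t1 \<equiv> w1 * b1 + w2 * b2" and "t2 \<equiv> w3 * b1 + w4 * b2" and "s \<equiv> b1 * b1 + b2 * b2"
  shows "cone_step l h (blk k1 k2 k3 k4) (blk x1 x2 x3 x4, blk y1 y2 y3 y4) (row2 b1 b2)
    = (blk (- (l / h * (t1 * b1))) (- (l / h * (t1 * b2))) (- (l / h * (t2 * b1))) (- (l / h * (t2 * b2))),
       blk (l * (s * w1 - t1 * b1)) (l * (s * w2 - t1 * b2)) (l * (s * w3 - t2 * b1)) (l * (s * w4 - t2 * b2)))"
  by (simp add: cone_step_def cone_residual_def Let_def blk_arith matrix_eq_iff_columns tensor_def blk_mult row2_inner
      w1_def w2_def w3_def w4_def t1_def t2_def s_def)

text \<open>
  The numerical data were found by a computer search: with \<open>\<kappa> = 2, 3/2, 3/2, 3/2, 3/2\<close> they form a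
  closed five-step configuration with vertices \<open>vertex k\<close> and endpoints \<open>(point k, grad k)\<close> for which
  the strict polyconvexity inequalities (\<open>polyconvexity_gap\<close>) hold. Indices are shifted by one with
  respect to the indices \<open>1..5\<close> of the statement.
\<close>

definition hess :: "nat \<Rightarrow> real" where "hess k = [3, 3, 2, 2, 2] ! k"
text \<open>Normalised so that \<open>rate k\<close> times |\<open>dir0 k\<close>|^2 is 1/kappa; the
  first and last directions have squared length 2, the others 1.\<close>

definition rate :: "nat \<Rightarrow> real" where "rate k = [1/4, 2/3, 2/3, 2/3, 1/3] ! k"
definition dir0 :: "nat \<Rightarrow> real^'n" where "dir0 k = [row2 (-1) 1, row2 1 0, row2 0 1, row2 1 0, row2 1 1] ! k"
definition point :: "nat \<Rightarrow> real^'n^2" where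
  "point k = [blk 0 0 4 (-4), blk (-3) 0 (-4) (-2), blk (-2) (-6) (-2) 1, blk (-5) (-4) 1 0, blk 2 2 0 0] ! k"
definition grad :: "nat \<Rightarrow> real^'n^2" where
  "grad k = [blk (-4) (-4) 0 0, blk (-2) (-2) 0 6, blk 4 (-2) 0 4, blk 2 (-2) 0 (-2), blk (-1) 1 0 0] ! k"
text \<open>The sixth entry repeats the first, which is the closing of the base loop at rho =
  0.\<close>

definition vertex :: "nat \<Rightarrow> (real^'n^2) \<times> (real^'n^2)" where
  "vertex k = [(blk 0 0 0 0, blk 0 0 0 0), (blk 0 0 2 (-2), blk (-2) (-2) 0 0), (blk (-2) 0 (-2) (-2), blk (-2) (-2) 0 4),
      (blk (-2) (-4) (-2) 0, blk 2 (-2) 0 4), (blk (-4) (-4) 0 0, blk 2 (-2) 0 0), (blk 0 0 0 0, blk 0 0 0 0)] ! k"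
definition offset :: "nat \<Rightarrow> real^'n^2" where "offset k = grad k - hess k *\<^sub>R point k"

text \<open>
  The unknown \<open>u\<close> collects the variations of the first four directions as the rows of two matrices, so
  that it ranges over the same space as \<open>\<rho>\<close>; the last direction stays fixed.
\<close>

definition dir_var :: "nat \<Rightarrow> (real^'n^2) \<times> (real^'n^2) \<Rightarrow> real^'n" where
  "dir_var k u = [fst u $ 1, fst u $ 2, snd u $ 1, snd u $ 2, 0] ! k"

definition dir :: "nat \<Rightarrow> (real^'n^2) \<times> (real^'n^2) \<Rightarrow> real^'n" where
  "dir k u = dir0 k + dir_var k u"

fun pos :: "nat \<Rightarrow> ((real^'n^2) \<times> (real^'n^2)) \<times> ((real^'n^2) \<times> (real^'n^2)) \<Rightarrow> (real^'n^2) \<times> (real^'n^2)" where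
  "pos 0 z = fst z"
| "pos (Suc k) z = pos k z + cone_step (rate k) (hess k) (offset k) (pos k z) (dir k (snd z))"

definition move where "move k z = cone_step (rate k) (hess k) (offset k) (pos k z) (dir k (snd z))"

definition residual0 :: "nat \<Rightarrow> real^'n^2" where
  "residual0 k = [blk (-4) (-4) (-12) 12, blk 9 0 18 6, blk 6 12 0 (-6), blk 6 0 (-6) (-6), blk (-15) (-9) 0 0] ! k"

fun pos_deriv :: "nat \<Rightarrow> ((real^'n^2) \<times> (real^'n^2)) \<times> ((real^'n^2) \<times> (real^'n^2)) \<Rightarrow> (real^'n^2) \<times> (real^'n^2)" where
  "pos_deriv 0 z = fst z"
| "pos_deriv (Suc k) z = pos_deriv k z
     + cone_step_deriv (rate k) (hess k) (residual0 k) (dir0 k) (pos_deriv k z) (dir_var k (snd z))"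

definition move_deriv where
  "move_deriv k z = cone_step_deriv (rate k) (hess k) (residual0 k) (dir0 k) (pos_deriv k z) (dir_var k (snd z))"

lemma less_5_cases: "k < (5::nat) \<Longrightarrow> k = 0 \<or> k = 1 \<or> k = 2 \<or> k = 3 \<or> k = 4" by auto

lemma dir_var_0 [simp]: "k < 5 \<Longrightarrow> dir_var k 0 = 0"
  by (drule less_5_cases) (elim disjE; simp add: dir_var_def)

lemma move_at_vertex:
  assumes "k < 5"
  shows "cone_step (rate k) (hess k) (offset k) (vertex k) (dir0 k) = vertex (Suc k) - vertex k"
  using less_5_cases[OF assms]
  by (elim disjE; simp add: rate_def hess_def offset_def vertex_def dir0_def grad_def point_def blk_arith(1-3) cone_step_blk)

lemma pos_at_0: "k \<le> 5 \<Longrightarrow> pos k 0 = vertex k"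
proof (induction k)
  case 0
  then show ?case by (simp add: vertex_def zero_prod_def blk_arith)
next
  case (Suc k)
  then show ?case using move_at_vertex[of k] by (simp add: dir_def)
qed

lemma residual_at_vertex: "k < 5 \<Longrightarrow> cone_residual (hess k) (offset k) (vertex k) = residual0 k"
  by (drule less_5_cases)
     (elim disjE; simp add: hess_def offset_def vertex_def grad_def point_def residual0_def cone_residual_def blk_arith)

lemma bounded_linear_dir_var: "k < 5 \<Longrightarrow> bounded_linear (dir_var k)"
  by (drule less_5_cases)
     (elim disjE; simp add: dir_var_def[abs_def] eval_nat_numeral bounded_linear_zero
        bounded_linear_compose[OF bounded_linear_vec_nth bounded_linear_fst] bounded_linear_compose[OF bounded_linear_vec_nth bounded_linear_snd])

lemma has_strict_derivative_dir:
  assumes "k < 5" shows "has_strict_derivative (\<lambda>z. dir k (snd z)) (\<lambda>z. dir_var k (snd z)) a"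
  using has_strict_derivative_add[OF has_strict_derivative_const[of "dir0 k"]
      has_strict_derivative_linear[OF bounded_linear_compose[OF bounded_linear_dir_var[OF assms] bounded_linear_snd]]]
  by (simp add: dir_def)

lemma has_strict_derivative_move:
  assumes "k < 5" "has_strict_derivative (pos k) (pos_deriv k) 0"
  shows "has_strict_derivative (move k) (move_deriv k) 0"
  using has_strict_derivative_cone_step[OF assms(2) has_strict_derivative_dir[OF assms(1)],
      of "rate k" "hess k" "offset k"] assms(1)
  by (simp add: move_def[abs_def] move_deriv_def[abs_def] pos_at_0 residual_at_vertex dir_def)

lemma has_strict_derivative_pos: "k \<le> 5 \<Longrightarrow> has_strict_derivative (pos k) (pos_deriv k) 0"
proof (induction k)
  case 0
  then show ?case by (simp add: has_strict_derivative_linear bounded_linear_fst)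
next
  case (Suc k)
  then show ?case
    using has_strict_derivative_add[of "pos k" "pos_deriv k" 0 "move k" "move_deriv k"] has_strict_derivative_move[of k]
    by (simp add: move_def[abs_def] move_deriv_def[abs_def])
qed

section \<open>The linearised loop in coordinates\<close>

lemma cone_step_deriv_block:
  fixes l h w1 w2 w3 w4 b1 b2 :: real and v :: "real^'n" and p :: "(real^'n^2) \<times> (real^'n^2)"
  defines "d1 \<equiv> h * fst p $ 1 $ j1 - snd p $ 1 $ j1" and "d2 \<equiv> h * fst p $ 1 $ j2 - snd p $ 1 $ j2"
    and "d3 \<equiv> h * fst p $ 2 $ j1 - snd p $ 2 $ j1" and "d4 \<equiv> h * fst p $ 2 $ j2 - snd p $ 2 $ j2"
  defines "t1 \<equiv> w1 * b1 + w2 * b2" and "t2 \<equiv> w3 * b1 + w4 * b2"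
    and "s1 \<equiv> w1 * v $ j1 + w2 * v $ j2 + (d1 * b1 + d2 * b2)" and "s2 \<equiv> w3 * v $ j1 + w4 * v $ j2 + (d3 * b1 + d4 * b2)"
    and "q \<equiv> 2 * (b1 * v $ j1 + b2 * v $ j2)" and "r \<equiv> b1 * b1 + b2 * b2"
  shows
    "fst (cone_step_deriv l h (blk w1 w2 w3 w4) (row2 b1 b2) p v) $ 1 $ j1 = - (l / h) * (t1 * v $ j1 + s1 * b1)"
    "fst (cone_step_deriv l h (blk w1 w2 w3 w4) (row2 b1 b2) p v) $ 1 $ j2 = - (l / h) * (t1 * v $ j2 + s1 * b2)"
    "fst (cone_step_deriv l h (blk w1 w2 w3 w4) (row2 b1 b2) p v) $ 2 $ j1 = - (l / h) * (t2 * v $ j1 + s2 * b1)"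
    "fst (cone_step_deriv l h (blk w1 w2 w3 w4) (row2 b1 b2) p v) $ 2 $ j2 = - (l / h) * (t2 * v $ j2 + s2 * b2)"
    "snd (cone_step_deriv l h (blk w1 w2 w3 w4) (row2 b1 b2) p v) $ 1 $ j1 = l * (r * d1 + q * w1 - (t1 * v $ j1 + s1 * b1))"
    "snd (cone_step_deriv l h (blk w1 w2 w3 w4) (row2 b1 b2) p v) $ 1 $ j2 = l * (r * d2 + q * w2 - (t1 * v $ j2 + s1 * b2))"
    "snd (cone_step_deriv l h (blk w1 w2 w3 w4) (row2 b1 b2) p v) $ 2 $ j1 = l * (r * d3 + q * w3 - (t2 * v $ j1 + s2 * b1))"
    "snd (cone_step_deriv l h (blk w1 w2 w3 w4) (row2 b1 b2) p v) $ 2 $ j2 = l * (r * d4 + q * w4 - (t2 * v $ j2 + s2 * b2))"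
  by (simp_all add: cone_step_deriv_def Let_def tensor_def blk_mult mult_row2 row2_inner matrix_vector_mult_diff_rdistrib assms)

text \<open>Base residual and base direction vanish in such a column, so neither the variation of w
  b nor that of |b|^2 reaches it. The column sees only its own entries, which reduces arbitrary n to
  copies of one small system.\<close>

lemma cone_step_deriv_column:
  fixes p :: "(real^'n^2) \<times> (real^'n^2)"
  assumes j: "j \<noteq> j1" "j \<noteq> j2"
  shows
    "fst (cone_step_deriv l h (blk w1 w2 w3 w4) (row2 b1 b2) p v) $ 1 $ j = - (l / h) * ((w1 * b1 + w2 * b2) * v $ j)"
    "fst (cone_step_deriv l h (blk w1 w2 w3 w4) (row2 b1 b2) p v) $ 2 $ j = - (l / h) * ((w3 * b1 + w4 * b2) * v $ j)"
    "snd (cone_step_deriv l h (blk w1 w2 w3 w4) (row2 b1 b2) p v) $ 1 $ j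
      = l * ((b1 * b1 + b2 * b2) * (h * fst p $ 1 $ j - snd p $ 1 $ j) - (w1 * b1 + w2 * b2) * v $ j)"
    "snd (cone_step_deriv l h (blk w1 w2 w3 w4) (row2 b1 b2) p v) $ 2 $ j
      = l * ((b1 * b1 + b2 * b2) * (h * fst p $ 2 $ j - snd p $ 2 $ j) - (w3 * b1 + w4 * b2) * v $ j)"
  using j by (simp_all add: cone_step_deriv_def Let_def tensor_def blk_mult mult_row2 row2_inner)

text \<open>The closing condition replaces the sixth vertex by the first, so the five steps become a
  cyclic system.\<close>

lemma pos_deriv_steps:
  assumes "pos_deriv 5 z = fst z"
  shows "pos_deriv 1 z = pos_deriv 0 z + move_deriv 0 z" "pos_deriv 2 z = pos_deriv 1 z + move_deriv 1 z"
    "pos_deriv 3 z = pos_deriv 2 z + move_deriv 2 z" "pos_deriv 4 z = pos_deriv 3 z + move_deriv 3 z"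
    "pos_deriv 0 z = pos_deriv 4 z + move_deriv 4 z"
proof -
  have *: "pos_deriv (Suc k) z = pos_deriv k z + move_deriv k z" for k
    by (simp add: move_deriv_def)
  show "pos_deriv 1 z = pos_deriv 0 z + move_deriv 0 z" "pos_deriv 2 z = pos_deriv 1 z + move_deriv 1 z"
    "pos_deriv 3 z = pos_deriv 2 z + move_deriv 2 z" "pos_deriv 4 z = pos_deriv 3 z + move_deriv 3 z"
    using *[of 0] *[of 1] *[of 2] *[of 3] by (simp_all add: eval_nat_numeral)
  have "pos_deriv 5 z = pos_deriv 4 z + move_deriv 4 z" using *[of 4] by (simp add: eval_nat_numeral)
  then show "pos_deriv 0 z = pos_deriv 4 z + move_deriv 4 z" using assms by simp
qed

lemma move_deriv_numeral:
  "move_deriv 0 z = cone_step_deriv (1/4) 3 (blk (-4) (-4) (-12) 12) (row2 (-1) 1) (pos_deriv 0 z) (dir_var 0 (snd z))"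
  "move_deriv 1 z = cone_step_deriv (2/3) 3 (blk 9 0 18 6) (row2 1 0) (pos_deriv 1 z) (dir_var 1 (snd z))"
  "move_deriv 2 z = cone_step_deriv (2/3) 2 (blk 6 12 0 (-6)) (row2 0 1) (pos_deriv 2 z) (dir_var 2 (snd z))"
  "move_deriv 3 z = cone_step_deriv (2/3) 2 (blk 6 0 (-6) (-6)) (row2 1 0) (pos_deriv 3 z) (dir_var 3 (snd z))"
  "move_deriv 4 z = cone_step_deriv (1/3) 2 (blk (-15) (-9) 0 0) (row2 1 1) (pos_deriv 4 z) (dir_var 4 (snd z))"
  by (simp_all add: move_deriv_def rate_def hess_def residual0_def dir0_def)

lemma closed_block:
  assumes "pos_deriv 5 z = fst z"
  shows "closed_block_variation (\<lambda>k. fst (pos_deriv k z) $ 1 $ j1) (\<lambda>k. fst (pos_deriv k z) $ 1 $ j2)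
    (\<lambda>k. fst (pos_deriv k z) $ 2 $ j1) (\<lambda>k. fst (pos_deriv k z) $ 2 $ j2)
    (\<lambda>k. snd (pos_deriv k z) $ 1 $ j1) (\<lambda>k. snd (pos_deriv k z) $ 1 $ j2)
    (\<lambda>k. snd (pos_deriv k z) $ 2 $ j1) (\<lambda>k. snd (pos_deriv k z) $ 2 $ j2)
    (\<lambda>k. dir_var k (snd z) $ j1) (\<lambda>k. dir_var k (snd z) $ j2)"
proof -
  have z4: "dir_var 4 (snd z) = 0" by (simp add: dir_var_def)
  note s = pos_deriv_steps[OF assms, unfolded move_deriv_numeral z4]
  have u: "fst q $ i $ j = fst p $ i $ j + fst d $ i $ j" "snd q $ i $ j = snd p $ i $ j + snd d $ i $ j"
    if "q = p + d" for p q d :: "(real^'n^2) \<times> (real^'n^2)" and i j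
    using that by auto
  note u0 = u[OF s(1), of 1 j1] u[OF s(1), of 1 j2] u[OF s(1), of 2 j1] u[OF s(1), of 2 j2]
  note u1 = u[OF s(2), of 1 j1] u[OF s(2), of 1 j2] u[OF s(2), of 2 j1] u[OF s(2), of 2 j2]
  note u2 = u[OF s(3), of 1 j1] u[OF s(3), of 1 j2] u[OF s(3), of 2 j1] u[OF s(3), of 2 j2]
  note u3 = u[OF s(4), of 1 j1] u[OF s(4), of 1 j2] u[OF s(4), of 2 j1] u[OF s(4), of 2 j2]
  note u4 = u[OF s(5), of 1 j1] u[OF s(5), of 1 j2] u[OF s(5), of 2 j1] u[OF s(5), of 2 j2]
  show ?thesis
    \<comment> \<open>Every goal is one scalar equation of one of the five steps; the alternatives
      try the steps in turn.\<close>
    by (rule closed_block_variation.intro; 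
      (use u0[unfolded cone_step_deriv_block] in \<open>simp add: field_simps del: pos_deriv.simps; fail\<close> |
       use u1[unfolded cone_step_deriv_block] in \<open>simp add: field_simps del: pos_deriv.simps; fail\<close> |
       use u2[unfolded cone_step_deriv_block] in \<open>simp add: field_simps del: pos_deriv.simps; fail\<close> |
       use u3[unfolded cone_step_deriv_block] in \<open>simp add: field_simps del: pos_deriv.simps; fail\<close> |
       use u4[unfolded cone_step_deriv_block] in \<open>simp add: field_simps del: pos_deriv.simps; fail\<close>))
qed

lemma closed_column:
  assumes "pos_deriv 5 z = fst z" and j: "j \<noteq> j1" "j \<noteq> j2"
  shows "closed_column_variation (\<lambda>k. fst (pos_deriv k z) $ 1 $ j) (\<lambda>k. fst (pos_deriv k z) $ 2 $ j)
    (\<lambda>k. snd (pos_deriv k z) $ 1 $ j) (\<lambda>k. snd (pos_deriv k z) $ 2 $ j) (\<lambda>k. dir_var k (snd z) $ j)"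
proof -
  have z4: "dir_var 4 (snd z) = 0" by (simp add: dir_var_def)
  note s = pos_deriv_steps[OF assms(1), unfolded move_deriv_numeral z4]
  have u: "fst q $ i $ j = fst p $ i $ j + fst d $ i $ j" "snd q $ i $ j = snd p $ i $ j + snd d $ i $ j"
    if "q = p + d" for p q d :: "(real^'n^2) \<times> (real^'n^2)" and i
    using that by auto
  note c = cone_step_deriv_column[OF j]
  show ?thesis
    by (rule closed_column_variation.intro;
      (use u[OF s(1), of 1, unfolded c] u[OF s(1), of 2, unfolded c] in \<open>simp add: field_simps del: pos_deriv.simps; fail\<close> |
       use u[OF s(2), of 1, unfolded c] u[OF s(2), of 2, unfolded c] in \<open>simp add: field_simps del: pos_deriv.simps; fail\<close> |
       use u[OF s(3), of 1, unfolded c] u[OF s(3), of 2, unfolded c] in \<open>simp add: field_simps del: pos_deriv.simps; fail\<close> |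
       use u[OF s(4), of 1, unfolded c] u[OF s(4), of 2, unfolded c] in \<open>simp add: field_simps del: pos_deriv.simps; fail\<close> |
       use u[OF s(5), of 1, unfolded c] u[OF s(5), of 2, unfolded c] in \<open>simp add: field_simps del: pos_deriv.simps; fail\<close>))
qed

lemma dir_var_eq_0:
  assumes "dir_var 0 u = 0" "dir_var 1 u = 0" "dir_var 2 u = 0" "dir_var 3 u = 0"
  shows "u = 0"
  using assms by (cases u) (simp add: dir_var_def zero_prod_def vec_eq_iff forall_2)

lemma pos_deriv_0_propagates:
  assumes "k \<le> m" "pos_deriv k z = 0" "snd z = 0" "m \<le> 5"
  shows "pos_deriv m z = 0"
  using assms(1,4)
proof (induction m rule: dec_induct)
  case (step m)
  then show ?case by (simp add: assms(3) cone_step_deriv_0)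
qed (use assms in simp)

text \<open>The two locales make all directions stationary. The zero variation at vertex
  \<open>k\<close> then propagates forward to the end of the loop, which closes up at rho, so rho is
  stationary as well.\<close>

lemma closed_variation_vertex:
  assumes z: "pos_deriv 5 z = fst z" and k: "k < 5" and 0: "pos_deriv k z = 0"
  shows "z = 0"
proof -
  note B = closed_block[OF z] and C = closed_column[OF z]
  have "dir_var 0 (snd z) = 0 \<and> dir_var 1 (snd z) = 0 \<and> dir_var 2 (snd z) = 0 \<and> dir_var 3 (snd z) = 0"
  proof -
    consider "k = 0" | "k = 1" | "k = 2" | "k = 3" | "k = 4" using less_5_cases[OF k] by blast
    then show ?thesis
      by cases (use 0 closed_block_variation.vanishing_at_0[OF B] closed_column_variation.vanishing_at_0[OF C]
          closed_block_variation.vanishing_at_1[OF B] closed_column_variation.vanishing_at_1[OF C]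
          closed_block_variation.vanishing_at_2[OF B] closed_column_variation.vanishing_at_2[OF C]
          closed_block_variation.vanishing_at_3[OF B] closed_column_variation.vanishing_at_3[OF C]
          closed_block_variation.vanishing_at_4[OF B] closed_column_variation.vanishing_at_4[OF C]
          in \<open>simp_all add: vector_eq_iff_columns del: pos_deriv.simps One_nat_def\<close>)
  qed
  then have u: "snd z = 0" using dir_var_eq_0 by blast
  have "fst z = 0" using pos_deriv_0_propagates[of k 5 z] k 0 u z by simp
  with u show ?thesis by (simp add: prod_eq_iff)
qed

section \<open>Variation of the endpoints\<close>

definition rate_time :: "nat \<Rightarrow> real" where "rate_time k = inverse (rate k * (dir0 k \<bullet> dir0 k))"

definition rate_time_deriv :: "nat \<Rightarrow> ((real^'n^2) \<times> (real^'n^2)) \<times> ((real^'n^2) \<times> (real^'n^2)) \<Rightarrow> real" where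
  "rate_time_deriv k z = - (rate_time k * (rate k * (2 * (dir0 k \<bullet> dir_var k (snd z)))) * rate_time k)"

text \<open>A stationary residual removes the variation of the vertex from that of the step. The
  endpoint equation then expresses the vertex explicitly through the variation \<open>v\<close> of
  the direction.\<close>

lemma endpoint_block:
  fixes p :: "(real^'n^2) \<times> (real^'n^2)"
  assumes w: "h *\<^sub>R fst p - snd p = 0"
    and e: "fst p + (t *\<^sub>R fst (cone_step_deriv l h (blk w1 w2 w3 w4) (row2 b1 b2) p v) + t' *\<^sub>R blk g1 g2 g3 g4) = 0"
  shows "fst p $ 1 $ j1 = t * (l / h) * ((w1 * b1 + w2 * b2) * v $ j1 + (w1 * v $ j1 + w2 * v $ j2) * b1) - t' * g1"
    "fst p $ 1 $ j2 = t * (l / h) * ((w1 * b1 + w2 * b2) * v $ j2 + (w1 * v $ j1 + w2 * v $ j2) * b2) - t' * g2"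
    "fst p $ 2 $ j1 = t * (l / h) * ((w3 * b1 + w4 * b2) * v $ j1 + (w3 * v $ j1 + w4 * v $ j2) * b1) - t' * g3"
    "fst p $ 2 $ j2 = t * (l / h) * ((w3 * b1 + w4 * b2) * v $ j2 + (w3 * v $ j1 + w4 * v $ j2) * b2) - t' * g4"
    "j \<noteq> j1 \<Longrightarrow> j \<noteq> j2 \<Longrightarrow> fst p $ 1 $ j = t * (l / h) * ((w1 * b1 + w2 * b2) * v $ j)"
    "j \<noteq> j1 \<Longrightarrow> j \<noteq> j2 \<Longrightarrow> fst p $ 2 $ j = t * (l / h) * ((w3 * b1 + w4 * b2) * v $ j)"
    "snd p $ i $ j = h * fst p $ i $ j"
proof -
  have w: "h * fst p $ i $ j - snd p $ i $ j = 0" for i j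
    using arg_cong[OF w, of "\<lambda>A. A $ i $ j"] by simp
  show "snd p $ i $ j = h * fst p $ i $ j" using w[of i j] by simp
  have e: "fst p $ i $ j + (t * fst (cone_step_deriv l h (blk w1 w2 w3 w4) (row2 b1 b2) p v) $ i $ j
      + t' * blk g1 g2 g3 g4 $ i $ j) = 0" for i j
    using arg_cong[OF e, of "\<lambda>A. A $ i $ j"] by simp
  show "fst p $ 1 $ j1 = t * (l / h) * ((w1 * b1 + w2 * b2) * v $ j1 + (w1 * v $ j1 + w2 * v $ j2) * b1) - t' * g1"
    "fst p $ 1 $ j2 = t * (l / h) * ((w1 * b1 + w2 * b2) * v $ j2 + (w1 * v $ j1 + w2 * v $ j2) * b2) - t' * g2"
    "fst p $ 2 $ j1 = t * (l / h) * ((w3 * b1 + w4 * b2) * v $ j1 + (w3 * v $ j1 + w4 * v $ j2) * b1) - t' * g3"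
    "fst p $ 2 $ j2 = t * (l / h) * ((w3 * b1 + w4 * b2) * v $ j2 + (w3 * v $ j1 + w4 * v $ j2) * b2) - t' * g4"
    using e[of 1 j1] e[of 1 j2] e[of 2 j1] e[of 2 j2] unfolding cone_step_deriv_block w
    by (simp_all add: eq_neg_iff_add_eq_0[symmetric] algebra_simps)
  show "fst p $ 1 $ j = t * (l / h) * ((w1 * b1 + w2 * b2) * v $ j)" "fst p $ 2 $ j = t * (l / h) * ((w3 * b1 + w4 * b2) * v $ j)"
    if "j \<noteq> j1" "j \<noteq> j2"
    using e[of 1 j] e[of 2 j] that unfolding cone_step_deriv_column[OF that] by simp_all
qed

lemma vertex_diff:
  "fst (vertex (Suc 0) - vertex 0) = blk 0 0 2 (-2)"
  "fst (vertex (Suc 1) - vertex 1) = blk (-2) 0 (-4) 0"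
  "fst (vertex (Suc 2) - vertex 2) = blk 0 (-4) 0 2"
  "fst (vertex (Suc 3) - vertex 3) = blk (-2) 0 2 0"
  "fst (vertex (Suc 4) - vertex 4) = blk 4 4 0 0"
  by (simp_all add: vertex_def blk_arith(1-3))

lemma rate_time_numeral: "k < 5 \<Longrightarrow> rate_time k = [2, 3/2, 3/2, 3/2, 3/2] ! k"
  by (drule less_5_cases) (elim disjE; simp add: rate_time_def rate_def dir0_def row2_inner)

lemma closed_variation_endpoint:
  assumes z: "pos_deriv 5 z = fst z" and k: "k < 5"
    and e: "fst (pos_deriv k z) + (rate_time k *\<^sub>R fst (move_deriv k z) + rate_time_deriv k z *\<^sub>R fst (vertex (Suc k) - vertex k)) = 0"
    and w: "hess k *\<^sub>R fst (pos_deriv k z) - snd (pos_deriv k z) = 0"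
  shows "z = 0"
proof -
  note B = closed_block[OF z] and C = closed_column[OF z]
  have u: "dir_var 0 (snd z) = 0 \<and> dir_var 1 (snd z) = 0 \<and> dir_var 2 (snd z) = 0 \<and> dir_var 3 (snd z) = 0"
  proof -
    consider "k = 0" | "k = 1" | "k = 2" | "k = 3" | "k = 4" using less_5_cases[OF k] by blast
    then show ?thesis
    proof cases
      case 1
      have "3 *\<^sub>R fst (pos_deriv 0 z) - snd (pos_deriv 0 z) = 0" using w unfolding 1 by (simp add: hess_def)
      note x = endpoint_block[OF this e[unfolded 1 move_deriv_numeral vertex_diff(1)]]
      have x0: "dir_var 4 (snd z) = 0" by (simp add: dir_var_def)
      show ?thesis unfolding vector_eq_iff_columns
        using closed_block_variation.vanishing_endpoint_at_0[OF B] closed_column_variation.vanishing_endpoint_at_0[OF C]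
        by (simp add: x x0 rate_time_deriv_def rate_time_numeral rate_def dir0_def row2_inner field_simps del: pos_deriv.simps One_nat_def)
    next
      case 2
      have "3 *\<^sub>R fst (pos_deriv 1 z) - snd (pos_deriv 1 z) = 0" using w unfolding 2 by (simp add: hess_def)
      note x = endpoint_block[OF this e[unfolded 2 move_deriv_numeral vertex_diff(2)]]
      have x0: "dir_var 4 (snd z) = 0" by (simp add: dir_var_def)
      show ?thesis unfolding vector_eq_iff_columns
        using closed_block_variation.vanishing_endpoint_at_1[OF B] closed_column_variation.vanishing_endpoint_at_1[OF C]
        by (simp add: x x0 rate_time_deriv_def rate_time_numeral rate_def dir0_def row2_inner field_simps del: pos_deriv.simps One_nat_def)
    next
      case 3
      have "2 *\<^sub>R fst (pos_deriv 2 z) - snd (pos_deriv 2 z) = 0" using w unfolding 3 by (simp add: hess_def)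
      note x = endpoint_block[OF this e[unfolded 3 move_deriv_numeral vertex_diff(3)]]
      have x0: "dir_var 4 (snd z) = 0" by (simp add: dir_var_def)
      show ?thesis unfolding vector_eq_iff_columns
        using closed_block_variation.vanishing_endpoint_at_2[OF B] closed_column_variation.vanishing_endpoint_at_2[OF C]
        by (simp add: x x0 rate_time_deriv_def rate_time_numeral rate_def dir0_def row2_inner field_simps del: pos_deriv.simps One_nat_def)
    next
      case 4
      have "2 *\<^sub>R fst (pos_deriv 3 z) - snd (pos_deriv 3 z) = 0" using w unfolding 4 by (simp add: hess_def)
      note x = endpoint_block[OF this e[unfolded 4 move_deriv_numeral vertex_diff(4)]]
      have x0: "dir_var 4 (snd z) = 0" by (simp add: dir_var_def)
      show ?thesis unfolding vector_eq_iff_columns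
        using closed_block_variation.vanishing_endpoint_at_3[OF B] closed_column_variation.vanishing_endpoint_at_3[OF C]
        by (simp add: x x0 rate_time_deriv_def rate_time_numeral rate_def dir0_def row2_inner field_simps del: pos_deriv.simps One_nat_def)
    next
      case 5
      have "2 *\<^sub>R fst (pos_deriv 4 z) - snd (pos_deriv 4 z) = 0" using w unfolding 5 by (simp add: hess_def)
      note x = endpoint_block[OF this e[unfolded 5 move_deriv_numeral vertex_diff(5)]]
      have x0: "dir_var 4 (snd z) = 0" by (simp add: dir_var_def)
      show ?thesis unfolding vector_eq_iff_columns
        using closed_block_variation.vanishing_at_4[OF B] closed_column_variation.vanishing_at_4[OF C]
        by (simp add: x x0 rate_time_deriv_def rate_time_numeral rate_def dir0_def row2_inner field_simps del: pos_deriv.simps One_nat_def)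
    qed
  qed
  then have u: "snd z = 0" using dir_var_eq_0 by blast
  have "tensor (0::real^2) b = 0" "tensor p (0::real^'n) = 0" for p :: "real^2" and b :: "real^'n"
    by (simp_all add: tensor_def vec_eq_iff)
  \<comment> \<open>With direction and residual stationary the displacement does not vary, and the
    endpoint hypothesis becomes the one for the vertex.\<close>
  then have "fst (move_deriv k z) = 0"
    using u k unfolding move_deriv_def cone_step_deriv_def Let_def w by simp
  moreover have "rate_time_deriv k z = 0"
    using u k by (simp add: rate_time_deriv_def)
  ultimately have "pos_deriv k z = 0" using e w by (simp add: prod_eq_iff)
  then show ?thesis using closed_variation_vertex[OF z k] by blast
qed

end

section \<open>Deformations of the base configuration\<close>

lemma uniform_radius:
  assumes "\<And>k. k < (n::nat) \<Longrightarrow> \<exists>r>0. Q k (r::real)"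
    and "\<And>k r r'. 0 < r' \<Longrightarrow> r' \<le> r \<Longrightarrow> Q k r \<Longrightarrow> Q k r'"
  shows "\<exists>r>0. \<forall>k<n. Q k r"
  using assms(1)
proof (induction n)
  case (Suc n)
  obtain r where r: "r > 0" "\<forall>k<n. Q k r" using Suc by auto
  obtain s where s: "s > 0" "Q n s" using Suc.prems by auto
  have "Q k (min r s)" if "k < Suc n" for k
  proof (cases "k = n")
    case True
    then show ?thesis using assms(2)[of "min r s" s n] r s by auto
  next
    case False
    then show ?thesis using assms(2)[of "min r s" r k] r s that by auto
  qed
  then show ?case using r s by (intro exI[of _ "min r s"]) auto
qed (auto intro: exI[of _ 1])

context two_columns
begin

definition time :: "nat \<Rightarrow> ((real^'n^2) \<times> (real^'n^2)) \<times> ((real^'n^2) \<times> (real^'n^2)) \<Rightarrow> real" where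
   "time k z = inverse (rate k * (dir k (snd z) \<bullet> dir k (snd z)))"

definition tip where "tip k z = fst (pos k z) + time k z *\<^sub>R fst (move k z)"

definition residual where "residual k z = cone_residual (hess k) (offset k) (pos k z)"

lemma hess_pos: "k < 5 \<Longrightarrow> hess k > 0"
  by (drule less_5_cases) (elim disjE; simp add: hess_def)

lemma at_0:
  assumes "k < 5"
  shows "time k 0 = rate_time k" "move k 0 = vertex (Suc k) - vertex k" "tip k 0 = point k" "pos k 0 = vertex k"
proof -
  show t: "time k 0 = rate_time k" using assms by (simp add: time_def rate_time_def dir_def)
  show p: "pos k 0 = vertex k" using assms by (simp add: pos_at_0)
  show m: "move k 0 = vertex (Suc k) - vertex k" using assms by (simp add: move_def p dir_def move_at_vertex)
  show "tip k 0 = point k" unfolding tip_def t m p using less_5_cases[OF assms]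
    by (elim disjE; simp add: rate_time_numeral point_def vertex_def blk_arith(1-3))
qed

lemma has_strict_derivative_time:
  assumes "k < 5" shows "has_strict_derivative (time k) (rate_time_deriv k) 0"
proof -
  have "rate k * (dir0 k \<bullet> dir0 k) \<noteq> 0"
    using less_5_cases[OF assms] by (elim disjE; simp add: rate_def dir0_def row2_inner)
  moreover note d = has_strict_derivative_dir[OF assms, of "0 :: ((real^'n^2) \<times> (real^'n^2)) \<times> ((real^'n^2) \<times> (real^'n^2))"]
  ultimately show ?thesis
    using has_strict_derivative_inverse[OF has_strict_derivative_bounded_linear_compose[OF bounded_linear_mult_right[of "rate k"]
        has_strict_derivative_bilinear[OF bounded_bilinear_inner d d]]] assms
    by (simp add: time_def[abs_def] rate_time_deriv_def[abs_def] rate_time_def dir_def inner_commute)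
qed

lemma has_strict_derivative_push:
  assumes "k < 5"
  shows "has_strict_derivative (\<lambda>z. time k z *\<^sub>R fst (move k z))
    (\<lambda>z. rate_time k *\<^sub>R fst (move_deriv k z) + rate_time_deriv k z *\<^sub>R fst (vertex (Suc k) - vertex k)) 0"
  using has_strict_derivative_bilinear[OF bounded_bilinear_scaleR has_strict_derivative_time[OF assms]
      has_strict_derivative_bounded_linear_compose[OF bounded_linear_fst has_strict_derivative_move[OF assms has_strict_derivative_pos]]] assms
  by (simp add: at_0)

lemma has_strict_derivative_tip:
  assumes "k < 5"
  shows "has_strict_derivative (tip k) (\<lambda>z. fst (pos_deriv k z) + 
    (rate_time k *\<^sub>R fst (move_deriv k z) + rate_time_deriv k z *\<^sub>R fst (vertex (Suc k) - vertex k))) 0"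
  unfolding tip_def[abs_def] using assms
  by (intro has_strict_derivative_add has_strict_derivative_push
      has_strict_derivative_bounded_linear_compose[OF bounded_linear_fst] has_strict_derivative_pos) auto

lemma has_strict_derivative_residual:
  assumes "k < 5"
  shows "has_strict_derivative (residual k) (\<lambda>z. hess k *\<^sub>R fst (pos_deriv k z) - snd (pos_deriv k z)) 0"
proof -
  have "bounded_linear (\<lambda>q. hess k *\<^sub>R fst q - snd q :: real^'n^2)"
    by (intro bounded_linear_sub bounded_linear_scaleR_right[THEN bounded_linear_compose] bounded_linear_fst bounded_linear_snd)
  from has_strict_derivative_add[OF has_strict_derivative_const[of "offset k"]
      has_strict_derivative_bounded_linear_compose[OF this has_strict_derivative_pos]]
  show ?thesis using assms by (simp add: residual_def[abs_def] cone_residual_def add_diff_eq)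
qed

lemma has_strict_derivative_closing:
  "has_strict_derivative (\<lambda>z. pos 5 z - fst z) (\<lambda>z. pos_deriv 5 z - fst z) 0"
  using has_strict_derivative_add[OF has_strict_derivative_pos[of 5]
      has_strict_derivative_linear[OF bounded_linear_minus[OF bounded_linear_fst]]] by simp

text \<open>A vertex alone cannot determine (rho, u), which has twice as many coordinates. Pairing
  it with the closing map gives equal dimensions, and on closed loops the added component is
  0.\<close>

lemma vertex_injective_near_0:
  assumes k: "k < 5"
  shows "\<exists>r>0. \<forall>x\<in>ball 0 r. \<forall>y\<in>ball 0 r. pos k x = pos k y \<longrightarrow> pos 5 x = fst x \<longrightarrow> pos 5 y = fst y \<longrightarrow> x = y"
proof -
  note f = has_strict_derivative_Pair[OF has_strict_derivative_pos[of k] has_strict_derivative_closing]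
  have inj: "x = 0" if "(pos_deriv k x, pos_deriv 5 x - fst x) = 0" for x
    using that closed_variation_vertex[OF _ k, of x] by (simp add: prod_eq_iff)
  obtain r m where r: "r > 0" "m > 0"
    "\<And>x y. x \<in> ball 0 r \<Longrightarrow> y \<in> ball 0 r \<Longrightarrow>
      m * norm (x - y) \<le> norm ((pos k x, pos 5 x - fst x) - (pos k y, pos 5 y - fst y))"
    by (rule strict_derivative_bounded_below[OF f inj]) (use k in auto)
  show ?thesis
  proof (intro exI[of _ r] conjI ballI impI r(1))
    fix x y assume "x \<in> ball 0 r" "y \<in> ball 0 r" "pos k x = pos k y" "pos 5 x = fst x" "pos 5 y = fst y"
    with r(3)[of x y] have "m * norm (x - y) \<le> 0" by simp
    then show "x = y" using r(2) by (simp add: mult_le_0_iff)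
  qed
qed

text \<open>
  At \<open>\<lambda> = 1\<close> the points \<open>\<lambda> \<xi> + (1 - \<lambda>) \<pi>\<close> fall into the graph of \<open>\<sigma>\<close>, so their dependence on \<open>\<rho>\<close>
  degenerates as \<open>\<lambda>\<close> tends to 1. Their residual is exactly \<open>1 - \<lambda>\<close> times that of \<open>\<pi>\<close>, hence the pair of
  first component and rescaled residual is a perturbation of a nondegenerate map, uniformly in
  \<open>s = \<lambda> - 1\<close>.
\<close>

lemma endpoint_injective_near_0:
  assumes k: "k < 5"
  shows "\<exists>r>0. \<forall>s x y. \<bar>s\<bar> \<le> r \<longrightarrow> x \<in> ball 0 r \<longrightarrow> y \<in> ball 0 r \<longrightarrow>
    tip k x + s *\<^sub>R (time k x *\<^sub>R fst (move k x)) = tip k y + s *\<^sub>R (time k y *\<^sub>R fst (move k y)) \<longrightarrow>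
    residual k x = residual k y \<longrightarrow> pos 5 x = fst x \<longrightarrow> pos 5 y = fst y \<longrightarrow> x = y"
proof -
  let ?f = "\<lambda>z. ((tip k z, residual k z), pos 5 z - fst z)"
  let ?g = "\<lambda>z. ((time k z *\<^sub>R fst (move k z), 0 :: real^'n^2), 0 :: (real^'n^2) \<times> (real^'n^2))"
  note f = has_strict_derivative_Pair[OF has_strict_derivative_Pair[OF has_strict_derivative_tip[OF k] has_strict_derivative_residual[OF k]] has_strict_derivative_closing]
  note g = has_strict_derivative_Pair[OF has_strict_derivative_Pair[OF has_strict_derivative_push[OF k] has_strict_derivative_const[of "0 :: real^'n^2"]]
    has_strict_derivative_const[of "0 :: (real^'n^2) \<times> (real^'n^2)"]]
  obtain r \<eta> m where r: "r > 0" "\<eta> > 0" "m > 0"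
    "\<And>s x y. \<bar>s\<bar> \<le> \<eta> \<Longrightarrow> x \<in> ball 0 r \<Longrightarrow> y \<in> ball 0 r \<Longrightarrow>
       m * norm (x - y) \<le> norm ((?f x + s *\<^sub>R ?g x) - (?f y + s *\<^sub>R ?g y))"
  proof (rule strict_derivative_bounded_below_perturbed[OF f g])
    fix x assume "((fst (pos_deriv k x) + (rate_time k *\<^sub>R fst (move_deriv k x) + rate_time_deriv k x *\<^sub>R fst (vertex (Suc k) - vertex k)),
        hess k *\<^sub>R fst (pos_deriv k x) - snd (pos_deriv k x)), pos_deriv 5 x - fst x) = 0"
    then show "x = 0" using closed_variation_endpoint[OF _ k, of x] by (simp add: prod_eq_iff)
  qed blast
  show ?thesis
  proof (intro exI[of _ "min r \<eta>"] conjI allI impI)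
    fix s x y assume "\<bar>s\<bar> \<le> min r \<eta>" "x \<in> ball 0 (min r \<eta>)" "y \<in> ball 0 (min r \<eta>)"
      "tip k x + s *\<^sub>R (time k x *\<^sub>R fst (move k x)) = tip k y + s *\<^sub>R (time k y *\<^sub>R fst (move k y))"
      "residual k x = residual k y" "pos 5 x = fst x" "pos 5 y = fst y"
    with r(4)[of s x y] have "m * norm (x - y) \<le> 0" by simp
    then show "x = y" using r(3) by (simp add: mult_le_0_iff)
  qed (use r in auto)
qed

lemma near_0:
  assumes e: "e > 0" and k: "k < 5"
  shows "\<exists>r>0. continuous_on (ball 0 r) (move k) \<and> continuous_on (ball 0 r) (time k) \<and> continuous_on (ball 0 r) (pos k) \<and>
    (\<forall>z\<in>ball 0 r. norm (fst (pos k z) - fst (vertex k)) \<le> e \<and> norm (tip k z - point k) \<le> e \<and> \<bar>time k z - rate_time k\<bar> \<le> 1/10)"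
proof -
  have pos: "has_strict_derivative (pos k) (pos_deriv k) 0" using k by (simp add: has_strict_derivative_pos)
  obtain r1 where r1: "r1 > 0" "continuous_on (ball 0 r1) (move k)"
    by (rule has_strict_derivative_continuous_on[OF has_strict_derivative_move[OF k pos]])
  obtain r2 where r2: "r2 > 0" "continuous_on (ball 0 r2) (time k)"
    by (rule has_strict_derivative_continuous_on[OF has_strict_derivative_time[OF k]])
  obtain r3 where r3: "r3 > 0" "continuous_on (ball 0 r3) (pos k)"
    by (rule has_strict_derivative_continuous_on[OF pos])
  obtain r4 where r4: "r4 > 0" "\<And>z. z \<in> ball 0 r4 \<Longrightarrow> norm (pos k z - pos k 0) \<le> e"
    by (rule has_strict_derivative_near[OF pos e]) blast
  obtain r5 where r5: "r5 > 0" "\<And>z. z \<in> ball 0 r5 \<Longrightarrow> norm (tip k z - tip k 0) \<le> e"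
    by (rule has_strict_derivative_near[OF has_strict_derivative_tip[OF k] e]) blast
  obtain r6 where r6: "r6 > 0" "\<And>z. z \<in> ball 0 r6 \<Longrightarrow> norm (time k z - time k 0) \<le> 1/10"
    by (rule has_strict_derivative_near[OF has_strict_derivative_time[OF k], of "1/10"]) auto
  define r where "r = min r1 (min r2 (min r3 (min r4 (min r5 r6))))"
  have r: "r > 0" "r \<le> r1" "r \<le> r2" "r \<le> r3" "r \<le> r4" "r \<le> r5" "r \<le> r6"
    using r1 r2 r3 r4 r5 r6 by (auto simp: r_def)
  have "norm (fst (pos k z) - fst (vertex k)) \<le> e" if "z \<in> ball 0 r" for z
    using r4(2)[of z] that r norm_fst_le[of "fst (pos k z - vertex k)" "snd (pos k z - vertex k)"] at_0[OF k]
    unfolding prod.collapse by simp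
  then show ?thesis
    using r1 r2 r3 r5 r6 r at_0[OF k]
    by (intro exI[of _ r]) (auto intro: continuous_on_subset)
qed

text \<open>All entries are integers, so distinct matrices differ by at least 1 in some
  entry.\<close>

lemma points_apart:
  assumes "i < 5" "j < 5" "i \<noteq> j"
  shows "norm (point i - point j) \<ge> 1" "norm (fst (vertex i) - fst (vertex j)) \<ge> 1"
proof -
  have blk: "1 \<le> norm (blk a b c d)" if "1 \<le> \<bar>a\<bar> \<or> 1 \<le> \<bar>b\<bar> \<or> 1 \<le> \<bar>c\<bar> \<or> 1 \<le> \<bar>d\<bar>" for a b c d
  proof -
    have "\<bar>blk a b c d $ i $ j\<bar> \<le> norm (blk a b c d)" for i j
      using component_le_norm_cart Finite_Cartesian_Product.norm_nth_le by (rule order_trans)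
    from this[of 1 j1] this[of 1 j2] this[of 2 j1] this[of 2 j2] that show ?thesis by auto
  qed
  show "norm (point i - point j) \<ge> 1"
    using less_5_cases[OF assms(1)] less_5_cases[OF assms(2)] assms(3)
    by (elim disjE; simp add: point_def blk_arith(1-3) blk)
  show "norm (fst (vertex i) - fst (vertex j)) \<ge> 1"
    using less_5_cases[OF assms(1)] less_5_cases[OF assms(2)] assms(3)
    by (elim disjE; simp add: vertex_def blk_arith(1-3) blk)
qed

theorem condition_O_if_affine_near_points:
  fixes \<sigma> :: "real^'n^2 \<Rightarrow> real^'n^2"
  assumes cont: "continuous_on UNIV \<sigma>" and \<epsilon>: "\<epsilon> > 0"
    and \<sigma>: "\<And>k A. k < 5 \<Longrightarrow> norm (A - point k) \<le> \<epsilon> \<Longrightarrow> \<sigma> A = hess k *\<^sub>R A + offset k"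
  shows "condition_O 5 \<sigma>"
proof -
  \<comment> \<open>Radius 1/4 keeps neighbourhoods of points at distance at least 1 disjoint and
    leaves room for a further displacement of 1/8.\<close>
  define e where "e = min (1/4) \<epsilon>"
  have e: "e > 0" "e \<le> 1/4" "e \<le> \<epsilon>" using \<epsilon> by (auto simp: e_def)
  obtain U r1 where U: "r1 > 0" "continuous_on (ball 0 r1) U" "U 0 = 0"
    "\<And>\<rho>. \<rho> \<in> ball 0 r1 \<Longrightarrow> pos 5 (\<rho>, U \<rho>) - fst (\<rho>, U \<rho>) = 0"
  proof (rule strict_implicit_function[OF has_strict_derivative_closing])
    show "pos 5 0 - fst 0 = 0" by (simp add: pos_at_0 vertex_def blk_arith prod_eq_iff)
    fix v assume "pos_deriv 5 (0, v) - fst (0 :: (real^'n^2) \<times> (real^'n^2), v) = 0"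
    \<comment> \<open>A variation of the directions alone has stationary first vertex, so
      nondegeneracy in \<open>u\<close> is the vertex lemma at k = 0.\<close>
    then have "(0 :: (real^'n^2) \<times> (real^'n^2), v) = 0"
      by (intro closed_variation_vertex[of _ 0]) auto
    then show "v = 0" by (simp add: zero_prod_def)
  qed blast
  define Q1 where "Q1 k r \<longleftrightarrow>
      continuous_on (ball 0 r) (move k) \<and> continuous_on (ball 0 r) (time k) \<and> continuous_on (ball 0 r) (pos k) \<and>
        (\<forall>z\<in>ball 0 r. norm (fst (pos k z) - fst (vertex k)) \<le> e \<and> norm (tip k z - point k) \<le> e \<and> \<bar>time k z - rate_time k\<bar> \<le> 1/10)" for k r
  define Q2 where "Q2 k r \<longleftrightarrow>
      (\<forall>x\<in>ball 0 r. \<forall>y\<in>ball 0 r. pos k x = pos k y \<longrightarrow> pos 5 x = fst x \<longrightarrow> pos 5 y = fst y \<longrightarrow> x = y)" for k r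
  define Q3 where "Q3 k r \<longleftrightarrow>
      (\<forall>s x y. \<bar>s\<bar> \<le> r \<longrightarrow> x \<in> ball 0 r \<longrightarrow> y \<in> ball 0 r \<longrightarrow>
        tip k x + s *\<^sub>R (time k x *\<^sub>R fst (move k x)) = tip k y + s *\<^sub>R (time k y *\<^sub>R fst (move k y)) \<longrightarrow>
        residual k x = residual k y \<longrightarrow> pos 5 x = fst x \<longrightarrow> pos 5 y = fst y \<longrightarrow> x = y)" for k r
  have mono: "Q1 k r \<Longrightarrow> Q1 k r'" "Q2 k r \<Longrightarrow> Q2 k r'" "Q3 k r \<Longrightarrow> Q3 k r'" if "r' \<le> r" for k r r'
  proof -
    have sub: "ball 0 r' \<subseteq> ball (0 :: ((real^'n^2) \<times> (real^'n^2)) \<times> ((real^'n^2) \<times> (real^'n^2))) r"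
      using that by (rule subset_ball)
    show "Q1 k r \<Longrightarrow> Q1 k r'" unfolding Q1_def using that by (auto intro: continuous_on_subset[OF _ sub])
    show "Q2 k r \<Longrightarrow> Q2 k r'" unfolding Q2_def using sub by blast
    show "Q3 k r \<Longrightarrow> Q3 k r'" unfolding Q3_def
      apply (intro allI impI)
      subgoal premises p for s x y
        by (rule p(1)[rule_format, of s x y]) (use p(2-) that in auto)
      done
  qed
  have "\<exists>r>0. \<forall>k<5. Q1 k r \<and> Q2 k r \<and> Q3 k r"
  proof (rule uniform_radius)
    fix k :: nat assume k: "k < 5"
    obtain a where a: "a > 0" "Q1 k a" using near_0[OF e(1) k] unfolding Q1_def[symmetric] by blast
    obtain b where b: "b > 0" "Q2 k b" using vertex_injective_near_0[OF k] unfolding Q2_def[symmetric] by blast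
    obtain c where c: "c > 0" "Q3 k c" using endpoint_injective_near_0[OF k] unfolding Q3_def[symmetric] by blast
    have "Q1 k (min a (min b c)) \<and> Q2 k (min a (min b c)) \<and> Q3 k (min a (min b c))"
      by (intro conjI mono(1)[OF _ a(2)] mono(2)[OF _ b(2)] mono(3)[OF _ c(2)]) auto
    then show "\<exists>r>0. Q1 k r \<and> Q2 k r \<and> Q3 k r" using a b c by (intro exI[of _ "min a (min b c)"]) auto
  qed (use mono in blast)
  then obtain r where r: "r > 0" and Q: "\<And>k. k < 5 \<Longrightarrow> Q1 k r" "\<And>k. k < 5 \<Longrightarrow> Q2 k r" "\<And>k. k < 5 \<Longrightarrow> Q3 k r"
    by blast
  obtain r2 where r2: "r2 > 0" "\<And>\<rho>. norm \<rho> < r2 \<Longrightarrow> norm (U \<rho>) < r / 2"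
  proof -
    have "isCont U 0" using U(1,2) by (simp add: continuous_on_eq_continuous_at)
    then obtain d where "d > 0" "\<And>\<rho>. dist \<rho> 0 < d \<Longrightarrow> dist (U \<rho>) (U 0) < r / 2"
      using r unfolding continuous_at_eps_delta by (metis half_gt_zero)
    then show ?thesis using that[of d] U(3) by simp
  qed
  define r0 where "r0 = min r1 (min r2 (r / 2)) / 2"
  have r0: "r0 > 0" "r0 < r1" "r0 < r2" "r0 < r / 2" using U(1) r r2(1) by (auto simp: r0_def)
  define z where "z \<rho> = (\<rho>, U \<rho>)" for \<rho>
  have z: "z \<rho> \<in> ball 0 r" "pos 5 (z \<rho>) = fst (z \<rho>)" if "\<rho> \<in> cball 0 r0" for \<rho>
  proof -
    have "norm (z \<rho>) \<le> norm \<rho> + norm (U \<rho>)" unfolding z_def by (rule norm_Pair_le)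
    also have "\<dots> < r / 2 + r / 2" using that r0 r2(2)[of \<rho>] by (intro add_strict_mono) auto
    finally show "z \<rho> \<in> ball 0 r" by simp
    show "pos 5 (z \<rho>) = fst (z \<rho>)" using U(4)[of \<rho>] that r0 by (simp add: z_def)
  qed
  have cont_z: "continuous_on (cball 0 r0) z" unfolding z_def[abs_def]
    by (intro continuous_on_Pair continuous_on_id continuous_on_subset[OF U(2)]) (use r0 in auto)
  have cont_at_z: "continuous_on (cball 0 r0) (\<lambda>\<rho>. f (z \<rho>))" if "continuous_on (ball 0 r) f"
    for f :: "((real^'n^2) \<times> (real^'n^2)) \<times> ((real^'n^2) \<times> (real^'n^2)) \<Rightarrow> 'b::topological_space"
    by (rule continuous_on_compose2[OF that cont_z]) (use z in auto)
  define \<kappa> where "\<kappa> i \<rho> = time (i - 1) (z \<rho>)" for i \<rho>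
  define \<gamma> where "\<gamma> i \<rho> = move (i - 1) (z \<rho>)" for i \<rho>
  have pi: "pi_map \<gamma> (Suc k) \<rho> = pos k (z \<rho>)" for k \<rho>
  proof (induction k)
    case 0
    then show ?case by (simp add: pi_map_def z_def)
  next
    case (Suc k)
    have "{1..<Suc (Suc k)} = insert (Suc k) {1..<Suc k}" by auto
    then have "pi_map \<gamma> (Suc (Suc k)) \<rho> = pi_map \<gamma> (Suc k) \<rho> + \<gamma> (Suc k) \<rho>"
      by (simp add: pi_map_def)
    moreover have "\<gamma> (Suc k) \<rho> = move k (z \<rho>)" by (simp add: \<gamma>_def)
    ultimately show ?case using Suc by (simp add: move_def)
  qed
  have xi: "xi_map \<kappa> \<gamma> (Suc k) \<rho> = pos k (z \<rho>) + time k (z \<rho>) *\<^sub>R move k (z \<rho>)" for k \<rho>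
    by (simp add: xi_map_def pi \<kappa>_def \<gamma>_def)
  have fst_xi: "fst (xi_map \<kappa> \<gamma> (Suc k) \<rho>) = tip k (z \<rho>)" for k \<rho>
    by (simp add: xi tip_def)
  define seg where "seg k t \<rho> = t *\<^sub>R xi_map \<kappa> \<gamma> (Suc k) \<rho> + (1 - t) *\<^sub>R pi_map \<gamma> (Suc k) \<rho>" for k t \<rho>
  have seg: "seg k t \<rho> = pos k (z \<rho>) + (t * time k (z \<rho>)) *\<^sub>R move k (z \<rho>)" for k t \<rho>
    by (simp add: seg_def xi pi algebra_simps)
  \<comment> \<open>Written backwards from the endpoint, with s = t - 1 as the small parameter of
    \<open>Q3\<close>.\<close>
  have fst_seg: "fst (seg k t \<rho>) = tip k (z \<rho>) + (t - 1) *\<^sub>R (time k (z \<rho>) *\<^sub>R fst (move k (z \<rho>)))" for k t \<rho>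
    by (simp add: seg tip_def algebra_simps)
  have index: "\<exists>k. i = Suc k \<and> k < 5" if "i \<in> {1..5}" for i :: nat
    using that by (intro exI[of _ "i - 1"]) auto
  have rate: "rate_time k \<in> {3/2, 2}" if "k < 5" for k
    using less_5_cases[OF that] by (elim disjE; simp add: rate_time_numeral)
  \<comment> \<open>The base times 3/2 and 2, moved by at most 1/10, stay in [4/3, 3]; this is the
    origin of 3/4 and 1/3 as the values of \<open>\<delta>2\<close> and
    \<open>\<delta>1\<close>.\<close>
  have time_bounds: "time k (z \<rho>) \<in> {1/(3/4)..1/(1/3)}" if "k < 5" "\<rho> \<in> cball 0 r0" for k \<rho>
  proof -
    have "\<bar>time k (z \<rho>) - rate_time k\<bar> \<le> 1/10" using Q(1)[OF that(1)] z(1)[OF that(2)] by (auto simp: Q1_def)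
    then show ?thesis using rate[OF that(1)] unfolding atLeastAtMost_iff abs_le_iff by auto
  qed
  have residual_seg: "cone_residual (hess k) (offset k) (seg k t \<rho>) = (1 - t) *\<^sub>R residual k (z \<rho>)"
    if "k < 5" "\<rho> \<in> cball 0 r0" for k t \<rho>
  proof -
    \<comment> \<open>Since \<open>inverse 0 = 0\<close>, a nonzero time certifies a nonzero
      direction, so the factors cancel.\<close>
    have "time k (z \<rho>) \<noteq> 0" using time_bounds[OF that] by auto
    then have "t * time k (z \<rho>) * rate k * (dir k (snd (z \<rho>)) \<bullet> dir k (snd (z \<rho>))) = t"
      by (simp add: time_def field_simps)
    then show ?thesis
      using cone_residual_along_step[of "hess k" "offset k" "pos k (z \<rho>)" "t * time k (z \<rho>)" "rate k" "dir k (snd (z \<rho>))"]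
        hess_pos[OF that(1)]
      by (simp add: seg move_def residual_def)
  qed
  have wave: "move k (z \<rho>) \<in> wave_cone" if "k < 5" "\<rho> \<in> cball 0 r0" for k \<rho>
  proof -
    have "dir k (snd (z \<rho>)) \<noteq> 0" using time_bounds[OF that] by (auto simp: time_def)
    then show ?thesis unfolding move_def by (rule cone_step_in_wave_cone)
  qed
  have near: "norm (fst (pos k (z \<rho>)) - fst (vertex k)) \<le> e" "norm (tip k (z \<rho>) - point k) \<le> e"
    if "k < 5" "\<rho> \<in> cball 0 r0" for k \<rho>
    using Q(1)[OF that(1)] z(1)[OF that(2)] by (auto simp: Q1_def)
  have in_graph: "snd (xi_map \<kappa> \<gamma> (Suc k) \<rho>) = \<sigma> (fst (xi_map \<kappa> \<gamma> (Suc k) \<rho>))"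
    if "k < 5" "\<rho> \<in> cball 0 r0" for k \<rho>
  proof -
    have "cone_residual (hess k) (offset k) (xi_map \<kappa> \<gamma> (Suc k) \<rho>) = 0"
      using residual_seg[OF that, of 1] by (simp add: seg_def)
    then have "snd (xi_map \<kappa> \<gamma> (Suc k) \<rho>) = hess k *\<^sub>R tip k (z \<rho>) + offset k"
      by (simp add: cone_residual_def fst_xi algebra_simps)
    then show ?thesis using \<sigma>[OF that(1), of "tip k (z \<rho>)"] near(2)[OF that] e(3) by (simp add: fst_xi)
  qed
  define M where "M = 1 + (\<Sum>k<5. norm (point k - fst (vertex k)))"
  have M: "M \<ge> 1" by (simp add: M_def sum_nonneg)
  have push_le: "norm (time k (z \<rho>) *\<^sub>R fst (move k (z \<rho>))) \<le> M" if "k < 5" "\<rho> \<in> cball 0 r0" for k \<rho>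
  proof -
    have "time k (z \<rho>) *\<^sub>R fst (move k (z \<rho>)) = (tip k (z \<rho>) - point k) + ((point k - fst (vertex k)) - (fst (pos k (z \<rho>)) - fst (vertex k)))"
      by (simp add: tip_def)
    then have "norm (time k (z \<rho>) *\<^sub>R fst (move k (z \<rho>))) \<le> e + (norm (point k - fst (vertex k)) + e)"
      using near[OF that] norm_triangle_ineq norm_triangle_ineq4 by (smt (verit))
    moreover have "norm (point k - fst (vertex k)) \<le> (\<Sum>k<5. norm (point k - fst (vertex k)))"
      using that(1) by (intro member_le_sum) auto
    ultimately show ?thesis using e by (simp add: M_def)
  qed
  \<comment> \<open>The bound 7/8 exceeds 3/4; the second term makes |t - 1| at most r, for
    injectivity, and at most 1 / (8 M), so that the segment point stays within 1/8 of the
    endpoint.\<close>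
  define \<delta>0 where "\<delta>0 = max (7/8) (1 - min r (1 / (8 * M)))"
  have "7/8 \<le> \<delta>0" by (simp add: \<delta>0_def)
  then have \<delta>0: "3/4 < \<delta>0" "\<delta>0 < 1" using r M by (simp, simp add: \<delta>0_def)
  have admissible: "t = 0 \<or> \<bar>t - 1\<bar> \<le> r \<and> \<bar>t - 1\<bar> * M \<le> 1/8 \<and> t \<noteq> 1" if "t = 0 \<or> \<delta>0 \<le> t \<and> t < 1" for t
  proof (cases "t = 0")
    case False
    then have "\<bar>t - 1\<bar> \<le> r" "\<bar>t - 1\<bar> \<le> 1 / (8 * M)" "t \<noteq> 1" using that by (auto simp: \<delta>0_def)
    moreover have "\<bar>t - 1\<bar> * M \<le> 1 / (8 * M) * M" using calculation M by (intro mult_right_mono) auto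
    ultimately show ?thesis using M by simp
  qed simp
  have seg_inj: "inj_on (seg k t) (cball 0 r0)" if k: "k < 5" and t: "t = 0 \<or> \<delta>0 \<le> t \<and> t < 1" for k t
  proof (rule inj_onI)
    fix \<rho> \<rho>' assume \<rho>: "\<rho> \<in> cball 0 r0" "\<rho>' \<in> cball 0 r0" and eq: "seg k t \<rho> = seg k t \<rho>'"
    have "z \<rho> = z \<rho>'"
      using admissible[OF t]
    proof (elim disjE conjE)
      assume "t = 0"
      then have "pos k (z \<rho>) = pos k (z \<rho>')" using eq by (simp add: seg)
      then show ?thesis using Q(2)[OF k] z[OF \<rho>(1)] z[OF \<rho>(2)] unfolding Q2_def by blast
    next
      assume t: "\<bar>t - 1\<bar> \<le> r" "t \<noteq> 1"
      have "(1 - t) *\<^sub>R residual k (z \<rho>) = (1 - t) *\<^sub>R residual k (z \<rho>')"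
        unfolding residual_seg[OF k \<rho>(1), symmetric] residual_seg[OF k \<rho>(2), symmetric] eq ..
      then have "residual k (z \<rho>) = residual k (z \<rho>')" using t by simp
      moreover have "tip k (z \<rho>) + (t - 1) *\<^sub>R (time k (z \<rho>) *\<^sub>R fst (move k (z \<rho>)))
         = tip k (z \<rho>') + (t - 1) *\<^sub>R (time k (z \<rho>') *\<^sub>R fst (move k (z \<rho>')))"
        using arg_cong[OF eq, of fst] by (simp only: fst_seg)
      ultimately show ?thesis using Q(3)[OF k] z[OF \<rho>(1)] z[OF \<rho>(2)] t(1) unfolding Q3_def by blast
    qed
    then show "\<rho> = \<rho>'" by (simp add: z_def)
  qed
  have cont_seg: "continuous_on (cball 0 r0) (seg k t)" if "k < 5" for k t
    using Q(1)[OF that] unfolding seg[abs_def] Q1_def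
    by (intro continuous_intros cont_at_z) auto
  have S_eq: "S_set \<kappa> \<gamma> (Suc k) q t = seg k t ` ball 0 q" for k q t
    by (simp add: S_set_def seg_def)
  have S_open: "open (S_set \<kappa> \<gamma> (Suc k) q t)"
    if "k < 5" "t = 0 \<or> \<delta>0 \<le> t \<and> t < 1" "0 < q" "q \<le> r0" for k q t
    unfolding S_eq
    by (rule invariance_of_domain_ball) 
       (use that in \<open>auto intro: continuous_on_subset[OF cont_seg] inj_on_subset[OF seg_inj]\<close>)
  have pos_apart: "fst (pos k (z \<rho>)) \<noteq> fst (pos l (z \<rho>'))" if "k < 5" "l < 5" "k \<noteq> l" "\<rho> \<in> cball 0 r0" "\<rho>' \<in> cball 0 r0" for k l \<rho> \<rho>'
    using near[OF that(1,4)] near[OF that(2,5)] points_apart(2)[OF that(1-3)] e(2)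
      norm_triangle_ineq4[of "fst (pos l (z \<rho>')) - fst (vertex l)" "fst (pos k (z \<rho>)) - fst (vertex k)"] by auto
  have tip_apart: "tip k (z \<rho>) \<noteq> tip l (z \<rho>')" if "k < 5" "l < 5" "k \<noteq> l" "\<rho> \<in> cball 0 r0" "\<rho>' \<in> cball 0 r0" for k l \<rho> \<rho>'
    using near(2)[OF that(1,4)] near(2)[OF that(2,5)] points_apart(1)[OF that(1-3)] e(2)
      norm_triangle_ineq4[of "tip l (z \<rho>') - point l" "tip k (z \<rho>) - point k"] by auto
  have seg_apart: "seg k t \<rho> \<noteq> seg l t \<rho>'" if kl: "k < 5" "l < 5" "k \<noteq> l" and \<rho>: "\<rho> \<in> cball 0 r0" "\<rho>' \<in> cball 0 r0"
    and t: "t = 0 \<or> \<delta>0 \<le> t \<and> t < 1" for k l t \<rho> \<rho>'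
    using admissible[OF t]
  proof (elim disjE conjE)
    assume "t = 0"
    then show ?thesis using pos_apart[OF kl \<rho>] by (auto simp: seg)
  next
    assume t: "\<bar>t - 1\<bar> * M \<le> 1/8"
    \<comment> \<open>3/8 = 1/4 + 1/8, and two such deviations add up to less than the distance 1 of
      the points.\<close>
    have close: "norm (fst (seg k t \<rho>) - point k) \<le> 3/8" if "k < 5" "\<rho> \<in> cball 0 r0" for k \<rho>
    proof -
      have n: "norm ((t - 1) *\<^sub>R (time k (z \<rho>) *\<^sub>R fst (move k (z \<rho>)))) \<le> \<bar>t - 1\<bar> * M"
        unfolding norm_scaleR[of "t - 1"] using push_le[OF that] by (intro mult_left_mono) auto
      have "fst (seg k t \<rho>) - point k = (tip k (z \<rho>) - point k) + (t - 1) *\<^sub>R (time k (z \<rho>) *\<^sub>R fst (move k (z \<rho>)))"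
        by (simp add: fst_seg)
      then show ?thesis
        using n near(2)[OF that] e(2) t by (simp only:, intro norm_triangle_le, linarith)
    qed
    show ?thesis
      using close[OF kl(1) \<rho>(1)] close[OF kl(2) \<rho>(2)] points_apart(1)[OF kl]
        norm_triangle_ineq4[of "fst (seg l t \<rho>') - point l" "fst (seg k t \<rho>) - point k"] by auto
  qed
  have F1: "(\<Sum>i\<in>{1..5}. \<gamma> i \<rho>) = 0" if "\<rho> \<in> cball 0 r0" for \<rho>
  proof -
    \<comment> \<open>The left side is \<open>pi_map\<close> at the index 6, that is, the position
      after five steps.\<close>
    have "\<rho> + (\<Sum>i\<in>{1..<6}. \<gamma> i \<rho>) = \<rho>"
      using pi[of 5 \<rho>] z(2)[OF that] by (simp add: pi_map_def z_def)
    moreover have "{1..<6} = {1..5::nat}" by auto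
    ultimately show ?thesis by simp
  qed
  have F2: "continuous_on (cball 0 r0) (\<kappa> i) \<and> continuous_on (cball 0 r0) (\<gamma> i) \<and>
         (\<forall>\<rho>\<in>cball 0 r0. \<kappa> i \<rho> \<in> {1/(3/4)..1/(1/3)} \<and> \<gamma> i \<rho> \<in> wave_cone)" if "i \<in> {1..5}" for i
  proof -
    obtain k where k: "i = Suc k" "k < 5" using index[OF \<open>i \<in> {1..5}\<close>] by blast
    have "continuous_on (cball 0 r0) (\<lambda>\<rho>. time k (z \<rho>))" "continuous_on (cball 0 r0) (\<lambda>\<rho>. move k (z \<rho>))"
      using Q(1)[OF k(2)] by (auto simp: Q1_def intro: cont_at_z)
    then show ?thesis using time_bounds[OF k(2)] wave[OF k(2)] k(1) by (simp add: \<kappa>_def[abs_def] \<gamma>_def[abs_def])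
  qed
  have F3: "snd (xi_map \<kappa> \<gamma> i \<rho>) = \<sigma> (fst (xi_map \<kappa> \<gamma> i \<rho>))" if "i \<in> {1..5}" "\<rho> \<in> cball 0 r0" for i \<rho>
    using index[OF that(1)] in_graph that(2) by blast
  have F4: "(fst \<circ> xi_map \<kappa> \<gamma> i) ` cball 0 r0 \<inter> (fst \<circ> xi_map \<kappa> \<gamma> j) ` cball 0 r0 = {} \<and>
          (fst \<circ> pi_map \<gamma> i) ` cball 0 r0 \<inter> (fst \<circ> pi_map \<gamma> j) ` cball 0 r0 = {}"
    if ij: "i \<in> {1..5}" "j \<in> {1..5}" "i \<noteq> j" for i j
  proof -
    obtain k where k: "i = Suc k" "k < 5" using index[OF ij(1)] by blast
    obtain l where l: "j = Suc l" "l < 5" using index[OF ij(2)] by blast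
    have "k \<noteq> l" using ij(3) k l by simp
    then show ?thesis using tip_apart[OF k(2) l(2)] pos_apart[OF k(2) l(2)]
      by (force simp: k(1) l(1) fst_xi pi)
  qed
  have F5: "open (S_set \<kappa> \<gamma> i q t)" if "0 < q \<and> q \<le> r0 \<and> (t = 0 \<or> \<delta>0 \<le> t \<and> t < 1)" "i \<in> {1..5}" for i q t
    using index[OF that(2)] S_open that(1) by blast
  have F6: "S_set \<kappa> \<gamma> i q t \<inter> S_set \<kappa> \<gamma> j q t = {}"
    if ij: "0 < q \<and> q \<le> r0 \<and> (t = 0 \<or> \<delta>0 \<le> t \<and> t < 1)" "i \<in> {1..5}" "j \<in> {1..5}" "i \<noteq> j" for i j q t
  proof -
    obtain k where k: "i = Suc k" "k < 5" using index[OF ij(2)] by blast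
    obtain l where l: "j = Suc l" "l < 5" using index[OF ij(3)] by blast
    have "k \<noteq> l" using ij(4) k l by simp
    moreover have "ball 0 q \<subseteq> cball (0 :: (real^'n^2) \<times> (real^'n^2)) r0" using ij(1) by auto
    ultimately show ?thesis using seg_apart[OF k(2) l(2)] ij(1) unfolding k(1) l(1) S_eq by blast
  qed
  show ?thesis
    unfolding condition_O_def
  proof (rule conjI[OF cont], rule exI[of _ r0], rule exI[of _ "1/3"], rule exI[of _ "3/4"],
      rule exI[of _ \<kappa>], rule exI[of _ \<gamma>], intro conjI ballI impI F1 F3)
    show "\<exists>\<delta>0. 3/4 < \<delta>0 \<and> \<delta>0 < 1 \<and>
         (\<forall>r t. 0 < r \<and> r \<le> r0 \<and> (t = 0 \<or> (\<delta>0 \<le> t \<and> t < 1)) \<longrightarrow>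
            (\<forall>i\<in>{1..5}. open (S_set \<kappa> \<gamma> i r t)) \<and>
            (\<forall>i\<in>{1..5}. \<forall>j\<in>{1..5}. i \<noteq> j \<longrightarrow> S_set \<kappa> \<gamma> i r t \<inter> S_set \<kappa> \<gamma> j r t = {}))"
      by (rule exI[of _ \<delta>0], intro conjI allI impI ballI) (fact \<delta>0 | erule (1) F5 | erule (3) F6)+
  qed (use r0(1) F2 F4 in auto)
qed

end

section \<open>Smooth maxima and derivative bounds\<close>

text \<open>With \<open>\<psi>\<close> a smooth positive part, b + psi (a - b) is the larger of a
  and b as soon as they differ by at least the tolerance; this is iterated over the pieces, starting
  from \<open>g\<close>.\<close>

fun glue :: "(real \<Rightarrow> real) \<Rightarrow> (nat \<Rightarrow> 'a \<Rightarrow> real) \<Rightarrow> ('a \<Rightarrow> real) \<Rightarrow> nat \<Rightarrow> 'a \<Rightarrow> real" where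
  "glue \<psi> f g 0 x = g x"
| "glue \<psi> f g (Suc k) x = glue \<psi> f g k x + \<psi> (f k x - glue \<psi> f g k x)"

lemma glue_compose: "glue \<psi> f g n (p x) = glue \<psi> (\<lambda>k x. f k (p x)) (\<lambda>x. g (p x)) n x"
  by (induction n) auto

lemma smooth_glue:
  fixes f :: "nat \<Rightarrow> 'a::real_normed_vector \<Rightarrow> real"
  assumes "smooth \<psi>" "\<And>k. k < n \<Longrightarrow> smooth (f k)" "smooth g"
  shows "smooth (glue \<psi> f g n)"
  using assms(2)
proof (induction n)
  case 0
  then show ?case using assms(3) by (simp add: glue.simps(1)[abs_def])
next
  case (Suc n)
  then have "smooth (\<lambda>x. glue \<psi> f g n x + \<psi> (f n x - glue \<psi> f g n x))"
    by (intro smooth_add smooth_compose[OF assms(1)] smooth_diff) auto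
  then show ?case by (simp add: glue.simps(2)[abs_def])
qed

text \<open>Since \<open>\<psi>\<close> and \<open>t - \<psi> t\<close> are monotone, \<open>b + \<psi> (a - b)\<close> is monotone in both \<open>a\<close> and \<open>b\<close>.\<close>

lemma convex_on_smooth_max:
  fixes f g :: "'a::real_vector \<Rightarrow> real"
  assumes \<psi>: "convex_on UNIV \<psi>" "mono \<psi>" "mono (\<lambda>t. t - \<psi> t)"
    and fg: "convex_on UNIV f" "convex_on UNIV g"
  shows "convex_on UNIV (\<lambda>x. g x + \<psi> (f x - g x))"
proof (rule convex_onI)
  fix t :: real and x y :: 'a assume t: "0 < t" "t < 1"
  let ?z = "(1 - t) *\<^sub>R x + t *\<^sub>R y"
  let ?F = "(1 - t) * f x + t * f y" and ?G = "(1 - t) * g x + t * g y"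
  have f: "f ?z \<le> ?F" and g: "g ?z \<le> ?G"
    using convex_onD[OF fg(1), of t x y] convex_onD[OF fg(2), of t x y] t by auto
  have "g ?z + \<psi> (f ?z - g ?z) \<le> g ?z + \<psi> (?F - g ?z)"
    using monoD[OF \<psi>(2), of "f ?z - g ?z" "?F - g ?z"] f by simp
  also have "\<dots> \<le> ?G + \<psi> (?F - ?G)"
    using monoD[OF \<psi>(3), of "?F - ?G" "?F - g ?z"] g by simp
  also have "?F - ?G = (1 - t) *\<^sub>R (f x - g x) + t *\<^sub>R (f y - g y)" by (simp add: algebra_simps)
  also have "\<psi> \<dots> \<le> (1 - t) * \<psi> (f x - g x) + t * \<psi> (f y - g y)"
    using t by (intro convex_onD[OF \<psi>(1)]) auto
  finally show "g ?z + \<psi> (f ?z - g ?z) \<le> (1 - t) * (g x + \<psi> (f x - g x)) + t * (g y + \<psi> (f y - g y))"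
    by (simp add: algebra_simps)
qed simp

lemma convex_on_glue:
  fixes f :: "nat \<Rightarrow> 'a::real_vector \<Rightarrow> real"
  assumes "convex_on UNIV \<psi>" "mono \<psi>" "mono (\<lambda>t. t - \<psi> t)"
    and "\<And>k. k < n \<Longrightarrow> convex_on UNIV (f k)" "convex_on UNIV g"
  shows "convex_on UNIV (glue \<psi> f g n)"
  using assms(4)
proof (induction n)
  case 0
  then show ?case using assms(5) by (simp add: glue.simps(1)[abs_def])
next
  case (Suc n)
  then have "convex_on UNIV (glue \<psi> f g n)" "convex_on UNIV (f n)" by auto
  then have "convex_on UNIV (\<lambda>x. glue \<psi> f g n x + \<psi> (f n x - glue \<psi> f g n x))"
    by (intro convex_on_smooth_max[OF assms(1-3)])
  then show ?case by (simp add: glue.simps(2)[abs_def])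
qed

lemma glue_eq_base:
  assumes "\<And>t. t \<le> - e \<Longrightarrow> \<psi> t = 0" "\<And>k. k < n \<Longrightarrow> f k x + e \<le> g x"
  shows "glue \<psi> f g n x = g x"
  using assms(2)
proof (induction n)
  case (Suc n)
  have "f n x - g x \<le> - e" using Suc.prems[of n] by simp
  moreover have "glue \<psi> f g n x = g x" using Suc by simp
  ultimately show ?case using assms(1) by simp
qed simp

lemma glue_le:
  assumes \<psi>: "mono \<psi>" "\<And>t. t \<le> - e \<Longrightarrow> \<psi> t = 0" "\<And>t. e \<le> t \<Longrightarrow> \<psi> t = t" and e: "0 < e"
    and m: "\<And>k. k < n \<Longrightarrow> f k x \<le> m" "g x \<le> m"
  shows "glue \<psi> f g n x \<le> m + real n * e"
  using m(1)
proof (induction n)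
  case (Suc n)
  let ?G = "glue \<psi> f g n x"
  have G: "?G \<le> m + real n * e" using Suc by auto
  have "?G + \<psi> (f n x - ?G) \<le> m + real n * e + e"
  proof (cases "f n x - ?G \<le> e")
    case True
    then have "\<psi> (f n x - ?G) \<le> e" using monoD[OF \<psi>(1) True] \<psi>(3)[of e] by simp
    then show ?thesis using G by simp
  next
    case False
    moreover have "0 \<le> real n * e" using e by simp
    moreover have "f n x \<le> m" using Suc.prems by simp
    ultimately show ?thesis using \<psi>(3)[of "f n x - ?G"] e by linarith
  qed
  then show ?case by (simp add: algebra_simps)
qed (use m(2) in simp)

text \<open>Each earlier smoothing can raise the running maximum by at most \<open>e\<close>, so a
  lead of n e still leaves \<open>e\<close> when piece \<open>j\<close> is reached. From then on the
  other pieces lie below the tolerance and change nothing.\<close>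

lemma glue_eq_dominant:
  assumes \<psi>: "mono \<psi>" "\<And>t. t \<le> - e \<Longrightarrow> \<psi> t = 0" "\<And>t. e \<le> t \<Longrightarrow> \<psi> t = t" and e: "0 < e"
    and j: "j < n" and f: "\<And>k. k < n \<Longrightarrow> k \<noteq> j \<Longrightarrow> f k x + real n * e \<le> f j x" and g: "g x + real n * e \<le> f j x"
  shows "glue \<psi> f g n x = f j x"
proof -
  have "glue \<psi> f g m x = f j x" if "Suc j \<le> m" "m \<le> n" for m
    using that
  proof (induction m rule: dec_induct)
    case base
    have "glue \<psi> f g j x \<le> (f j x - real n * e) + real j * e"
    proof (rule glue_le[OF \<psi> e])
      show "f k x \<le> f j x - real n * e" if "k < j" for k using f[of k] that j by simp
      show "g x \<le> f j x - real n * e" using g by simp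
    qed
    moreover have "real (Suc j) * e \<le> real n * e" using j e by (intro mult_right_mono) auto
    ultimately show ?case using \<psi>(3)[of "f j x - glue \<psi> f g j x"] by (simp add: algebra_simps)
  next
    case (step m)
    have "1 * e \<le> real n * e" using j e by (intro mult_right_mono) auto
    then show ?case using step f[of m] \<psi>(2)[of "f m x - f j x"] by simp
  qed
  then show ?thesis using j by simp
qed

lemma smooth_compact_support_bound:
  fixes g :: "'a::euclidean_space \<Rightarrow> real"
  assumes g: "smooth g" and 0: "\<And>x. R < norm x \<Longrightarrow> g x = 0"
  shows "\<exists>C. \<forall>x. \<bar>iter_dderiv g hs x\<bar> \<le> C"
proof -
  have out: "iter_dderiv g hs x = 0" if "R < norm x" for x
    using that
  proof (induction hs arbitrary: x)
    case (Cons h hs)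
    have "open {x::'a. R < norm x}" by (intro open_Collect_less continuous_intros)
    then have "(iter_dderiv g hs has_derivative (\<lambda>h. 0)) (at x)"
      by (rule has_derivative_transform_within_open[OF has_derivative_const]) (use Cons in auto)
    then show ?case by (simp add: frechet_derivative_eqI)
  qed (use 0 in simp)
  have "continuous_on (cball 0 R) (iter_dderiv g hs)"
    using g unfolding smooth_def by (meson continuous_at_imp_continuous_on differentiable_imp_continuous_within)
  then have "bounded (iter_dderiv g hs ` cball 0 R)"
    by (intro compact_imp_bounded compact_continuous_image) auto
  then obtain C where "\<forall>y\<in>iter_dderiv g hs ` cball 0 R. norm y \<le> C"
    unfolding bounded_iff by blast
  then have C: "\<bar>iter_dderiv g hs x\<bar> \<le> C" if "x \<in> cball 0 R" for x using that by auto
  show ?thesis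
  proof (intro exI allI)
    fix x show "\<bar>iter_dderiv g hs x\<bar> \<le> max C 0"
      using C[of x] out[of x] by (cases "R < norm x") (auto simp: le_max_iff_disj)
  qed
qed

section \<open>Cofactors and the growth of derivatives of \<open>hnorm\<close>\<close>

context two_columns
begin

text \<open>The cofactor matrix of the distinguished block, extended by 0. It is self-adjoint and is
  the gradient of \<open>det12\<close>; applied twice it is the orthogonal projection onto the two
  columns.\<close>

definition cof :: "real^'n^2 \<Rightarrow> real^'n^2" where
  "cof A = blk (A $ 2 $ j2) (- A $ 2 $ j1) (- A $ 1 $ j2) (A $ 1 $ j1)"

lemma linear_cof: "linear cof"
  by (rule linearI) (simp_all add: cof_def matrix_eq_iff_columns algebra_simps)

lemma bounded_linear_cof: "bounded_linear cof"
  using linear_cof linear_conv_bounded_linear by blast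

lemma cof_inner: "cof A \<bullet> B = A \<bullet> cof B"
  unfolding inner_commute[of A] by (simp add: cof_def blk_inner)

lemma det12_eq_cof: "det12 j1 j2 A = (A \<bullet> cof A) / 2"
  unfolding inner_commute[of A] by (simp add: cof_def blk_inner det12_def)

lemma norm_cof_cof: "cof (cof A) \<bullet> cof (cof A) = cof A \<bullet> cof A"
  by (simp add: cof_def blk_inner)

lemma det12_expand: "det12 j1 j2 A = det12 j1 j2 B + cof B \<bullet> (A - B) + det12 j1 j2 (A - B)"
  by (simp add: det12_def cof_def blk_inner algebra_simps)

definition hnorm :: "real^'n^2 \<Rightarrow> real" where
  "hnorm A = sqrt (1 + (norm A)\<^sup>2 + (det12 j1 j2 A)\<^sup>2)"

lemma hnorm_ge: "hnorm A \<ge> (1 + norm A) / 2" "hnorm A > 0" "hnorm A \<ge> \<bar>det12 j1 j2 A\<bar>"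
proof -
  have "((1 + norm A) / 2)\<^sup>2 \<le> 1 + (norm A)\<^sup>2 + (det12 j1 j2 A)\<^sup>2"
  proof -
    \<comment> \<open>With x = |A|, 4 (1 + x^2) - (1 + x)^2 = 3 (x - 1/3)^2 + 8/3.\<close>
    have "0 \<le> 3 * (norm A - 1/3)\<^sup>2 + 8/3 + 4 * (det12 j1 j2 A)\<^sup>2" by simp
    then show ?thesis by (simp add: power2_eq_square field_simps)
  qed
  then show "hnorm A \<ge> (1 + norm A) / 2" unfolding hnorm_def by (rule real_le_rsqrt)
  moreover have "(1 + norm A) / 2 > 0" by (simp add: add_pos_nonneg)
  ultimately show "hnorm A > 0" by linarith
  show "hnorm A \<ge> \<bar>det12 j1 j2 A\<bar>" unfolding hnorm_def by (rule real_le_rsqrt) (simp add: power2_abs)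
qed

lemma has_derivative_det12: "(det12 j1 j2 has_derivative (\<lambda>h. A \<bullet> cof h)) (at A)"
proof -
  have "((\<lambda>A. A \<bullet> cof A / 2) has_derivative (\<lambda>h. (A \<bullet> cof h + h \<bullet> cof A) / 2)) (at A)"
    by (auto intro!: derivative_eq_intros bounded_linear.has_derivative[OF bounded_linear_cof])
  moreover have "(A \<bullet> cof h + h \<bullet> cof A) / 2 = A \<bullet> cof h" for h
    using cof_inner[of h A] by (simp add: inner_commute)
  ultimately show ?thesis by (simp add: det12_eq_cof[abs_def])
qed

lemma has_derivative_hnorm:
  "(hnorm has_derivative (\<lambda>h. (A \<bullet> h) * (1 / hnorm A) + (det12 j1 j2 A / hnorm A) * (A \<bullet> cof h))) (at A)"
proof -
  let ?q = "\<lambda>A. 1 + A \<bullet> A + det12 j1 j2 A * det12 j1 j2 A"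
  have q: "(?q has_derivative (\<lambda>h. 2 * ((A \<bullet> h) + det12 j1 j2 A * (A \<bullet> cof h)))) (at A)"
    by (rule has_derivative_eq_rhs[OF has_derivative_add[OF has_derivative_add[OF has_derivative_const
          has_derivative_inner[OF has_derivative_ident has_derivative_ident]] has_derivative_mult[OF has_derivative_det12 has_derivative_det12]]])
       (simp add: inner_commute algebra_simps)
  have pos: "0 < ?q A" by (simp add: add_pos_nonneg)
  have h: "hnorm A = sqrt (?q A)" for A
    unfolding hnorm_def power2_norm_eq_inner by (simp add: power2_eq_square)
  have e: "2 * (x + d * y) * (inverse s / 2) = x * (1 / s) + d / s * y" for x y d s :: real
    by (cases "s = 0") (simp_all add: field_simps)
  show ?thesis
    using has_derivative_real_sqrt[OF pos q] unfolding h[symmetric] e .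
qed

text \<open>
  \<open>symb m\<close> contains functions of growth order \<open>m\<close>. Differentiation does not raise the order, because
  \<open>det / hnorm\<close> is bounded: a derivative falling on \<open>det\<close> costs a factor linear in \<open>A\<close>, which is
  compensated by \<open>1 / hnorm\<close>.
\<close>

inductive symb :: "int \<Rightarrow> (real^'n^2 \<Rightarrow> real) \<Rightarrow> bool" where
  const: "symb 0 (\<lambda>A. c)"
| coord: "symb 1 (\<lambda>A. A \<bullet> B)"
| ratio: "symb 0 (\<lambda>A. det12 j1 j2 A / hnorm A)"
| inv: "symb (-1) (\<lambda>A. 1 / hnorm A)"
| add: "symb m f \<Longrightarrow> symb m g \<Longrightarrow> symb m (\<lambda>A. f A + g A)"
| mult: "symb m f \<Longrightarrow> symb m' g \<Longrightarrow> symb (m + m') (\<lambda>A. f A * g A)"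
| weaken: "symb m f \<Longrightarrow> m \<le> m' \<Longrightarrow> symb m' f"

lemma symb_has_derivative:
  "symb m f \<Longrightarrow> \<exists>f'. (\<forall>A. (f has_derivative f' A) (at A)) \<and> (\<forall>h. symb m (\<lambda>A. f' A h))"
proof (induction rule: symb.induct)
  case (const c)
  have "((\<lambda>A. c) has_derivative (\<lambda>h. 0)) (at A)" for A :: "real^'n^2" by simp
  then show ?case using symb.const[of 0] by (intro exI[of _ "\<lambda>A h. 0"]) auto
next
  case (coord B)
  have "((\<lambda>A. A \<bullet> B) has_derivative (\<lambda>h. h \<bullet> B)) (at A)" for A :: "real^'n^2"
    by (auto intro!: derivative_eq_intros)
  then show ?case using symb.weaken[OF symb.const] by (intro exI[of _ "\<lambda>A h. h \<bullet> B"]) auto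
next
  case ratio
  \<comment> \<open>The quotient rule, arranged as sums of products of the generators of
    \<open>symb\<close>.\<close>
  let ?D = "\<lambda>A h. (A \<bullet> cof h) * (1 / hnorm A) + (- 1) * ((det12 j1 j2 A / hnorm A) * ((1 / hnorm A) * 
     ((A \<bullet> h) * (1 / hnorm A) + (det12 j1 j2 A / hnorm A) * (A \<bullet> cof h))))"
  have "((\<lambda>A. det12 j1 j2 A / hnorm A) has_derivative ?D A) (at A)" for A
    using hnorm_ge(2)[of A]
    by (intro has_derivative_eq_rhs[OF has_derivative_divide'[OF has_derivative_det12 has_derivative_hnorm]])
       (auto simp: field_simps)
  moreover have "symb 0 (\<lambda>A. ?D A h)" for h
  proof -
    have 1: "symb 0 (\<lambda>A. (A \<bullet> h) * (1 / hnorm A))" for h using symb.mult[OF symb.coord symb.inv] by simp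
    have 2: "symb 1 (\<lambda>A. (A \<bullet> h) * (1 / hnorm A) + (det12 j1 j2 A / hnorm A) * (A \<bullet> cof h))"
      using symb.mult[OF symb.ratio symb.coord[of "cof h"]] by (intro symb.add symb.weaken[OF 1]) auto
    have 3: "symb 0 (\<lambda>A. (det12 j1 j2 A / hnorm A) * ((1 / hnorm A) * ((A \<bullet> h) * (1 / hnorm A) + (det12 j1 j2 A / hnorm A) * (A \<bullet> cof h))))"
      using symb.mult[OF symb.ratio symb.mult[OF symb.inv 2]] by simp
    show ?thesis
      by (rule symb.add[OF 1[of "cof h"] symb.weaken[OF symb.mult[OF symb.const 3]]]) simp
  qed
  ultimately show ?case by (intro exI[of _ ?D]) auto
next
  case inv
  let ?D = "\<lambda>A h. (- 1) * ((1 / hnorm A) * ((1 / hnorm A) * 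
     ((A \<bullet> h) * (1 / hnorm A) + (det12 j1 j2 A / hnorm A) * (A \<bullet> cof h))))"
  have "((\<lambda>A. 1 / hnorm A) has_derivative ?D A) (at A)" for A
    using hnorm_ge(2)[of A]
    by (intro has_derivative_eq_rhs[OF has_derivative_divide'[OF has_derivative_const has_derivative_hnorm]])
       (auto simp: field_simps)
  moreover have "symb (-1) (\<lambda>A. ?D A h)" for h
  proof -
    have 1: "symb 0 (\<lambda>A. (A \<bullet> h) * (1 / hnorm A))" using symb.mult[OF symb.coord symb.inv] by simp
    have 2: "symb 1 (\<lambda>A. (A \<bullet> h) * (1 / hnorm A) + (det12 j1 j2 A / hnorm A) * (A \<bullet> cof h))"
      using symb.mult[OF symb.ratio symb.coord[of "cof h"]] by (intro symb.add symb.weaken[OF 1]) auto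
    show ?thesis
      by (rule symb.weaken[OF symb.mult[OF symb.const symb.mult[OF symb.inv symb.mult[OF symb.inv 2]]]]) simp
  qed
  ultimately show ?case by (intro exI[of _ ?D]) auto
next
  case (add m f g)
  then obtain f' g' where *: "\<forall>A. (f has_derivative f' A) (at A)" "\<forall>h. symb m (\<lambda>A. f' A h)"
    "\<forall>A. (g has_derivative g' A) (at A)" "\<forall>h. symb m (\<lambda>A. g' A h)" by blast
  then show ?case
    by (intro exI[of _ "\<lambda>A h. f' A h + g' A h"]) (auto intro: has_derivative_add symb.add)
next
  case (mult m f m' g)
  then obtain f' g' where *: "\<forall>A. (f has_derivative f' A) (at A)" "\<forall>h. symb m (\<lambda>A. f' A h)"
    "\<forall>A. (g has_derivative g' A) (at A)" "\<forall>h. symb m' (\<lambda>A. g' A h)" by blast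
  then show ?case
    using mult.hyps by (intro exI[of _ "\<lambda>A h. f A * g' A h + f' A h * g A"]) (auto intro!: has_derivative_mult symb.add symb.mult)
next
  case (weaken m f m')
  then show ?case using symb.weaken by blast
qed

lemma symb_frechet_derivative:
  assumes "symb m f" shows "f differentiable (at A)" "symb m (\<lambda>A. frechet_derivative f (at A) h)"
proof -
  obtain f' where f': "\<And>A. (f has_derivative f' A) (at A)" "\<And>h. symb m (\<lambda>A. f' A h)"
    using symb_has_derivative[OF assms] by blast
  show "f differentiable (at A)" using f'(1) differentiable_def by blast
  show "symb m (\<lambda>A. frechet_derivative f (at A) h)" using f'(2)[of h] by (simp add: frechet_derivative_eqI[OF f'(1)])
qed

lemma symb_smooth: "symb m f \<Longrightarrow> smooth f"
  by (rule smooth_coinduct[of f "Collect (symb m)"]) (auto intro: symb_frechet_derivative)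

lemma symb_iter_dderiv: "symb m f \<Longrightarrow> symb m (iter_dderiv f hs)"
  by (induction hs) (auto intro: symb_frechet_derivative)

text \<open>The weight 1 + |A| is at least 1, so its integer powers are monotone in the exponent and
  \<open>weaken\<close> is sound for negative orders too.\<close>

lemma symb_bound: "symb m f \<Longrightarrow> \<exists>C\<ge>0. \<forall>A. \<bar>f A\<bar> \<le> C * (1 + norm A) powi m"
proof (induction rule: symb.induct)
  case (const c)
  then show ?case by (intro exI[of _ "\<bar>c\<bar>"]) auto
next
  case (coord B)
  have "\<bar>A \<bullet> B\<bar> \<le> norm B * (1 + norm A)" for A
    using Cauchy_Schwarz_ineq2[of A B] by (simp add: algebra_simps add_increasing)
  then show ?case by (intro exI[of _ "norm B"]) auto
next
  case ratio
  have "\<bar>det12 j1 j2 A / hnorm A\<bar> \<le> 1" for A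
    using hnorm_ge(2,3)[of A] by (simp add: field_simps)
  then show ?case by (intro exI[of _ 1]) auto
next
  case inv
  have "\<bar>1 / hnorm A\<bar> \<le> 2 * (1 + norm A) powi (-1)" for A
    using hnorm_ge(1,2)[of A] by (simp add: power_int_minus field_simps add_pos_nonneg)
  then show ?case by (intro exI[of _ 2]) auto
next
  case (add m f g)
  then obtain C D where C: "C \<ge> 0" "\<And>A. \<bar>f A\<bar> \<le> C * (1 + norm A) powi m" and D: "D \<ge> 0" "\<And>A. \<bar>g A\<bar> \<le> D * (1 + norm A) powi m" by blast
  have "\<bar>f A + g A\<bar> \<le> (C + D) * (1 + norm A) powi m" for A
    using C(2)[of A] D(2)[of A] by (simp add: distrib_right)
  then show ?case using C(1) D(1) by (intro exI[of _ "C + D"]) auto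
next
  case (mult m f m' g)
  then obtain C D where C: "C \<ge> 0" "\<And>A. \<bar>f A\<bar> \<le> C * (1 + norm A) powi m" and D: "D \<ge> 0" "\<And>A. \<bar>g A\<bar> \<le> D * (1 + norm A) powi m'" by blast
  have "\<bar>f A * g A\<bar> \<le> (C * D) * (1 + norm A) powi (m + m')" for A
  proof -
    have "1 + norm A \<noteq> 0" using norm_ge_zero[of A] by linarith
    then have "(C * D) * (1 + norm A) powi (m + m') = (C * (1 + norm A) powi m) * (D * (1 + norm A) powi m')"
      by (simp add: power_int_add)
    moreover have "\<bar>f A\<bar> * \<bar>g A\<bar> \<le> (C * (1 + norm A) powi m) * (D * (1 + norm A) powi m')"
      using C D by (intro mult_mono) auto
    ultimately show ?thesis by (simp only: abs_mult)
  qed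
  then show ?case using C(1) D(1) by (intro exI[of _ "C * D"]) auto
next
  case (weaken m f m')
  then obtain C where C: "C \<ge> 0" "\<And>A. \<bar>f A\<bar> \<le> C * (1 + norm A) powi m" by blast
  have "\<bar>f A\<bar> \<le> C * (1 + norm A) powi m'" for A
    using C(2)[of A] mult_left_mono[OF power_int_increasing[OF weaken(2), of "1 + norm A"] C(1)] by simp
  then show ?case using C(1) by blast
qed

end

section \<open>The polyconvex function\<close>

text \<open>Convexity, linear growth and smoothness of the pieces are all inherited from
  \<open>q\<close> along sums of this form, so each needs only one induction.\<close>

inductive ridge :: "(real \<Rightarrow> real) \<Rightarrow> ('a::real_normed_vector \<Rightarrow> real) \<Rightarrow> bool" for q where
  affine: "bounded_linear l \<Longrightarrow> ridge q (\<lambda>x. l x + c)"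
| add_ridge: "ridge q f \<Longrightarrow> 0 \<le> s \<Longrightarrow> bounded_linear l \<Longrightarrow> ridge q (\<lambda>x. f x + s * q (l x + c))"

lemma ridge_add_sum:
  assumes "ridge q f" "0 \<le> s" "finite B" "\<And>b. b \<in> B \<Longrightarrow> bounded_linear (l b)"
  shows "ridge q (\<lambda>x. f x + s * (\<Sum>b\<in>B. q (l b x + c b)))"
  using assms(3,4)
proof (induction B rule: finite_induct)
  case empty
  then show ?case using assms(1) by simp
next
  case (insert b B)
  then have "ridge q (\<lambda>x. (f x + s * (\<Sum>b\<in>B. q (l b x + c b))) + s * q (l b x + c b))"
    by (intro add_ridge assms(2)) auto
  then show ?case using insert by (simp add: algebra_simps)
qed

text \<open>The substitution \<open>p\<close> is tested only on linear functionals, which covers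
  both the identity and the graph map \<open>lift\<close>.\<close>

lemma ridge_smooth_compose:
  assumes "ridge q f" "smooth q" "\<And>l :: 'a \<Rightarrow> real. bounded_linear l \<Longrightarrow> smooth (\<lambda>x. l (p x))"
  shows "smooth (\<lambda>x. f (p x :: 'a::real_normed_vector))"
  using assms(1)
proof (induction rule: ridge.induct)
  case (affine l c)
  then show ?case by (intro smooth_add smooth_const assms(3))
next
  case (add_ridge f s l c)
  show ?case
    by (rule smooth_add[OF add_ridge.IH smooth_mult[OF smooth_const
          smooth_compose[OF assms(2) smooth_add[OF assms(3)[OF add_ridge.hyps(3)] smooth_const]]]])
qed

lemma linear_convex_combination:
  fixes l :: "'a::real_vector \<Rightarrow> real"
  assumes "linear l"
  shows "l ((1 - t) *\<^sub>R x + t *\<^sub>R y) + c = (1 - t) * (l x + c) + t * (l y + c)"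
proof -
  have "l ((1 - t) *\<^sub>R x + t *\<^sub>R y) = (1 - t) * l x + t * l y"
    by (simp only: linear_add[OF assms] linear_cmul[OF assms] real_scaleR_def)
  then show ?thesis by (simp add: algebra_simps)
qed

lemma convex_on_affine: "linear l \<Longrightarrow> convex_on UNIV (\<lambda>x. l x + c :: real)"
  by (rule convex_onI) (simp_all only: linear_convex_combination order_refl convex_UNIV)

lemma convex_on_compose_affine:
  assumes "convex_on UNIV q" "linear l" shows "convex_on UNIV (\<lambda>x. q (l x + c :: real))"
proof (rule convex_onI)
  fix t :: real and x y assume t: "0 < t" "t < 1"
  then show "q (l ((1 - t) *\<^sub>R x + t *\<^sub>R y) + c) \<le> (1 - t) * q (l x + c) + t * q (l y + c)"
    using convex_onD[OF assms(1), of t "l x + c" "l y + c"] unfolding linear_convex_combination[OF assms(2)] by simp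
qed simp

lemma ridge_convex:
  assumes "ridge q f" "convex_on UNIV q"
  shows "convex_on UNIV f"
  using assms(1)
  by (induction rule: ridge.induct)
     (auto intro!: convex_on_add convex_on_cmul convex_on_affine convex_on_compose_affine[OF assms(2)] bounded_linear.linear)

lemma ridge_linear_growth:
  assumes "ridge q f" and q: "\<And>s. q s \<le> m * \<bar>s\<bar>" "0 \<le> m"
  shows "\<exists>a b. 0 \<le> b \<and> (\<forall>x. f x \<le> a + b * norm x)"
  using assms(1)
proof (induction rule: ridge.induct)
  case (affine l c)
  obtain B where B: "0 \<le> B" "\<And>x. norm (l x) \<le> norm x * B"
    using bounded_linear.nonneg_bounded[OF affine] by blast
  have "l x + c \<le> c + B * norm x" for x using B(2)[of x] by (simp add: mult.commute abs_le_iff)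
  then show ?case using B(1) by blast
next
  case (add_ridge f s l c)
  obtain a b where ab: "0 \<le> b" "\<And>x. f x \<le> a + b * norm x" using add_ridge.IH by blast
  obtain B where B: "0 \<le> B" "\<And>x. norm (l x) \<le> norm x * B"
    using bounded_linear.nonneg_bounded[OF add_ridge.hyps(3)] by blast
  have "f x + s * q (l x + c) \<le> (a + s * (m * \<bar>c\<bar>)) + (b + s * (m * B)) * norm x" for x
  proof -
    have "m * \<bar>l x + c\<bar> \<le> m * (norm x * B + \<bar>c\<bar>)"
      using B(2)[of x] q(2) by (intro mult_left_mono) auto
    then have "s * q (l x + c) \<le> s * (m * (norm x * B + \<bar>c\<bar>))"
      using q(1)[of "l x + c"] add_ridge.hyps(2) by (intro mult_left_mono) auto
    then show ?thesis using ab(2)[of x] by (simp add: algebra_simps)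
  qed
  moreover have "0 \<le> b + s * (m * B)" using ab(1) B(1) q(2) add_ridge.hyps(2) by simp
  ultimately show ?case by blast
qed

context two_columns
begin

text \<open>The value of F at \<open>point k\<close>.\<close>

definition level :: "nat \<Rightarrow> real" where "level k = [0, 11/2, 20, -1, 7/2] ! k"
text \<open>The slope in delta of the supporting affine function at \<open>point k\<close>.\<close>

definition weight :: "nat \<Rightarrow> real" where "weight k = [6/5, -2, 7/10, 3/10, -1] ! k"
definition nu :: real where "nu = 1/1000"

definition spread :: "(real \<Rightarrow> real) \<Rightarrow> real^'n^2 \<Rightarrow> real" where
  "spread q v = (\<Sum>b\<in>Basis. q (v \<bullet> b))"

text \<open>
  Near 0, \<open>trunc q k H\<close> is half of the quadratic form \<open>(hess k - nu) |H|\<^sup>2 - 2 (weight k) det H\<close>,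
  written as a sum of squares and then flattened to linear growth. Adding it corrects the Hessian of
  the piece at \<open>point k\<close> to \<open>hess k\<close> times the identity.
\<close>

definition trunc :: "(real \<Rightarrow> real) \<Rightarrow> nat \<Rightarrow> real^'n^2 \<Rightarrow> real" where
  "trunc q k H = spread q (H - (weight k / 2) *\<^sub>R cof H) + (hess k - nu - 1 - (weight k)\<^sup>2 / 4) * spread q (cof H)
     + (hess k - nu - 1) * spread q (H - cof (cof H))"

text \<open>Affine in (A, delta) up to \<open>trunc\<close>: the bracket is delta minus the tangent
  of the determinant at \<open>point k\<close>, and the terms with \<open>nu\<close> cancel the
  affine part of nu/2 |A|^2 expanded about \<open>point k\<close>.\<close>

definition piece :: "(real \<Rightarrow> real) \<Rightarrow> nat \<Rightarrow> (real^'n^2) \<times> real \<Rightarrow> real" where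
  "piece q k x = level k + grad k \<bullet> (fst x - point k)
     + weight k * (snd x - det12 j1 j2 (point k) - cof (point k) \<bullet> (fst x - point k))
     - nu / 2 * (norm (point k))\<^sup>2 - nu * (point k \<bullet> (fst x - point k)) + trunc q k (fst x - point k)"

lemma coefficients_nonneg:
  "k < 5 \<Longrightarrow> 0 \<le> hess k - nu - 1 - (weight k)\<^sup>2 / 4" "k < 5 \<Longrightarrow> 0 \<le> hess k - nu - 1" "k < 5 \<Longrightarrow> \<bar>weight k\<bar> \<le> 2"
  by (drule less_5_cases; elim disjE; simp add: hess_def nu_def weight_def power2_eq_square)+

lemma ridge_piece:
  assumes "k < 5" shows "ridge q (piece q k)"
proof -
  define a where "a x = grad k \<bullet> fst x + weight k * (snd x - cof (point k) \<bullet> fst x) - nu * (point k \<bullet> fst x)" for x :: "(real^'n^2) \<times> real"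
  define c where "c = level k - grad k \<bullet> point k + weight k * (- det12 j1 j2 (point k) + cof (point k) \<bullet> point k)
    - nu / 2 * (norm (point k))\<^sup>2 + nu * (point k \<bullet> point k)"
  have "bounded_linear a" unfolding a_def
    by (intro bounded_linear_sub bounded_linear_add bounded_linear_const_mult bounded_linear_fst bounded_linear_snd
        bounded_linear_compose[OF bounded_linear_inner_right bounded_linear_fst])
  then have r: "ridge q (\<lambda>x. a x + c)" by (rule ridge.affine)
  have lin: "bounded_linear (\<lambda>x. l (fst x) \<bullet> b)" if "bounded_linear l" for l :: "real^'n^2 \<Rightarrow> real^'n^2" and b and x :: "(real^'n^2) \<times> real"
    by (intro bounded_linear_compose[OF bounded_linear_inner_left] bounded_linear_compose[OF that bounded_linear_fst])
  have l: "bounded_linear (\<lambda>H. H - (weight k / 2) *\<^sub>R cof H)" "bounded_linear (\<lambda>H. cof H)" "bounded_linear (\<lambda>H. H - cof (cof H))"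
    by (intro bounded_linear_sub bounded_linear_ident bounded_linear_const_scaleR bounded_linear_cof bounded_linear_compose[OF bounded_linear_cof])+
  have shift: "spread q (l (y - p)) = (\<Sum>b\<in>Basis. q (l y \<bullet> b + (- (l p \<bullet> b))))" if "bounded_linear l" for l y p
    by (simp add: spread_def linear_diff[OF bounded_linear.linear[OF that]] inner_diff_left)
  have "ridge q (\<lambda>x. ((a x + c + 1 * (\<Sum>b\<in>Basis. q ((fst x - (weight k / 2) *\<^sub>R cof (fst x)) \<bullet> b + (- ((point k - (weight k / 2) *\<^sub>R cof (point k)) \<bullet> b)))))
     + (hess k - nu - 1 - (weight k)\<^sup>2 / 4) * (\<Sum>b\<in>Basis. q (cof (fst x) \<bullet> b + (- (cof (point k) \<bullet> b)))))
     + (hess k - nu - 1) * (\<Sum>b\<in>Basis. q ((fst x - cof (cof (fst x))) \<bullet> b + (- ((point k - cof (cof (point k))) \<bullet> b)))))"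
    by (intro ridge_add_sum r coefficients_nonneg assms finite_Basis lin[OF l(1)] lin[OF l(2)] lin[OF l(3)] zero_le_one)
  then show ?thesis
    unfolding shift[OF l(1), symmetric] shift[OF l(2), symmetric] shift[OF l(3), symmetric]
    by (rule back_subst[of "ridge q"]) (auto simp: piece_def trunc_def a_def c_def algebra_simps)
qed

text \<open>The determinant is quadratic, so its deviation from the tangent is exactly the
  determinant of the increment.\<close>

lemma piece_on_graph:
  "nu / 2 * (norm A)\<^sup>2 + piece q k (A, det12 j1 j2 A)
    = level k + grad k \<bullet> (A - point k) + weight k * det12 j1 j2 (A - point k) + nu / 2 * (norm (A - point k))\<^sup>2
      + trunc q k (A - point k)"
proof -
  have "(norm A)\<^sup>2 = (norm (point k))\<^sup>2 + 2 * (point k \<bullet> (A - point k)) + (norm (A - point k))\<^sup>2"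
    by (simp add: power2_norm_eq_inner inner_diff_left inner_diff_right inner_commute)
  then have "nu / 2 * (norm A)\<^sup>2 = nu / 2 * (norm (point k))\<^sup>2 + nu * (point k \<bullet> (A - point k)) + nu / 2 * (norm (A - point k))\<^sup>2"
    by (simp only: distrib_left)
  moreover have d: "det12 j1 j2 A - det12 j1 j2 (point k) - cof (point k) \<bullet> (A - point k) = det12 j1 j2 (A - point k)"
    using det12_expand[of A "point k"] by simp
  ultimately show ?thesis unfolding piece_def fst_conv snd_conv d by linarith
qed

lemma spread_quadratic:
  assumes "\<And>s. \<bar>s\<bar> \<le> \<tau> \<Longrightarrow> q s = s\<^sup>2 / 2" "norm v \<le> \<tau>"
  shows "spread q v = (v \<bullet> v) / 2"
proof -
  have "q (v \<bullet> b) = (v \<bullet> b)\<^sup>2 / 2" if "b \<in> Basis" for b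
    using Basis_le_norm[OF that, of v] assms by simp
  then have "spread q v = (\<Sum>b\<in>Basis. (v \<bullet> b)\<^sup>2) / 2"
    unfolding spread_def sum_divide_distrib by (intro sum.cong) auto
  then show ?thesis unfolding euclidean_inner[of v v] by (simp add: power2_eq_square)
qed

lemma norm_cof_le: "norm (cof A) \<le> norm A"
proof -
  have "(A - cof (cof A)) \<bullet> (A - cof (cof A)) = A \<bullet> A - cof A \<bullet> cof A"
    using norm_cof_cof[of A] cof_inner[of "cof A" A] cof_inner[of A "cof A"]
    by (simp add: inner_diff_left inner_diff_right inner_commute)
  then have "cof A \<bullet> cof A \<le> A \<bullet> A" using inner_ge_zero[of "A - cof (cof A)"] by linarith
  then show ?thesis by (simp add: norm_le)
qed

text \<open>H . cof H = 2 det H makes the first square produce the determinant, and |H - cof (cof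
  H)|^2 = |H|^2 - |cof H|^2 restores the missing columns. Since |\<open>weight k\<close>| is at most
  2, every argument has norm at most 2 |H|, hence the radius tau/2.\<close>

lemma trunc_quadratic:
  assumes k: "k < 5" and q: "\<And>s. \<bar>s\<bar> \<le> \<tau> \<Longrightarrow> q s = s\<^sup>2 / 2" and H: "norm H \<le> \<tau> / 2"
  shows "trunc q k H = (hess k - nu) / 2 * (norm H)\<^sup>2 - weight k * det12 j1 j2 H"
proof -
  have sq: "spread q v = (v \<bullet> v) / 2" if "norm v \<le> \<tau>" for v
    using spread_quadratic[of \<tau> q v] q that by blast
  have c: "norm (cof H) \<le> norm H" "norm (cof (cof H)) \<le> norm H"
    using norm_cof_le[of H] norm_cof_le[of "cof H"] by auto
  have "norm ((weight k / 2) *\<^sub>R cof H) \<le> 1 * norm H"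
    unfolding norm_scaleR using coefficients_nonneg(3)[OF k] c by (intro mult_mono) auto
  then have n: "norm (H - (weight k / 2) *\<^sub>R cof H) \<le> \<tau>" "norm (H - cof (cof H)) \<le> \<tau>"
    using norm_triangle_ineq4[of H "(weight k / 2) *\<^sub>R cof H"] norm_triangle_ineq4[of H "cof (cof H)"] c H by auto
  have n2: "norm (cof H) \<le> \<tau>" using c H norm_ge_zero[of H] by linarith
  have "(H - cof (cof H)) \<bullet> (H - cof (cof H)) = H \<bullet> H - cof H \<bullet> cof H"
    using norm_cof_cof[of H] cof_inner[of "cof H" H] by (simp add: inner_diff_left inner_diff_right inner_commute)
  moreover have "(H - (weight k / 2) *\<^sub>R cof H) \<bullet> (H - (weight k / 2) *\<^sub>R cof H)
      = H \<bullet> H - 2 * weight k * det12 j1 j2 H + (weight k)\<^sup>2 / 4 * (cof H \<bullet> cof H)"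
    by (simp add: inner_diff_left inner_diff_right inner_commute det12_eq_cof power2_eq_square algebra_simps)
  ultimately show ?thesis
    unfolding trunc_def sq[OF n(1)] sq[OF n(2)] sq[OF n2]
    by (simp add: power2_norm_eq_inner) (simp add: field_simps)
qed

lemma spread_le: "(\<And>s. q s \<le> m * \<bar>s\<bar>) \<Longrightarrow> spread q v \<le> m * spread abs v"
  unfolding spread_def sum_distrib_left by (intro sum_mono) auto

text \<open>Separates the slope from the geometry: \<open>trunc abs\<close> does not depend on tau,
  so the correction at the other points becomes as small as desired.\<close>

lemma trunc_le:
  assumes "k < 5" "\<And>s. q s \<le> m * \<bar>s\<bar>"
  shows "trunc q k H \<le> m * trunc abs k H"
proof -
  have "m * (a + c1 * b + c2 * d) = m * a + c1 * (m * b) + c2 * (m * d)" for a b c1 c2 d :: real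
    by (simp add: algebra_simps)
  then show ?thesis unfolding trunc_def
    by (simp only:) (intro add_mono mult_left_mono spread_le assms coefficients_nonneg)
qed

lemma trunc_abs_nonneg: "k < 5 \<Longrightarrow> 0 \<le> trunc abs k H"
  using coefficients_nonneg[of k] by (simp add: trunc_def spread_def sum_nonneg)

lemma trunc_at_0: "q 0 = 0 \<Longrightarrow> trunc q k 0 = 0"
  by (simp add: trunc_def spread_def linear_0[OF linear_cof])

text \<open>Twenty numerical inequalities. The margin 1/5 pays for the flattened corrections, the
  smoothing tolerances and the passage to neighbourhoods.\<close>

lemma polyconvexity_gap:
  assumes "i < 5" "j < 5" "i \<noteq> j"
  shows "level i + grad i \<bullet> (point j - point i) + weight i * det12 j1 j2 (point j - point i)
     + nu / 2 * (norm (point j - point i))\<^sup>2 + 1/5 \<le> level j"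
  using less_5_cases[OF assms(1)] less_5_cases[OF assms(2)] assms(3) unfolding power2_norm_eq_inner
  by (elim disjE; simp add: level_def grad_def point_def weight_def nu_def det12_def blk_arith(1-3) blk_inner)

end

lemma smooth_inner_self: "smooth (\<lambda>x::'a::euclidean_space. x \<bullet> x)"
  unfolding euclidean_inner[of x x for x]
  by (intro smooth_sum smooth_mult smooth_bounded_linear bounded_linear_inner_left)

text \<open>The dominating function at infinity. Evaluated at (A, delta(A)) it is an affine function
  of \<open>hnorm\<close>.\<close>

definition cap :: "real \<Rightarrow> real \<Rightarrow> 'a::real_inner \<Rightarrow> real" where
  "cap l c x = l * sqrt (1 + (norm x)\<^sup>2) - c"

lemma smooth_cap: "smooth (cap l c :: 'a::euclidean_space \<Rightarrow> real)"
proof -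
  have pos: "1 + x \<bullet> x > 0" for x :: 'a by (simp add: add_pos_nonneg)
  have "smooth (\<lambda>x::'a. l * (1 + x \<bullet> x) powr (1/2) - c)"
    by (intro smooth_diff smooth_mult smooth_const smooth_powr smooth_add smooth_inner_self pos)
  then show ?thesis using pos by (simp add: cap_def[abs_def] power2_norm_eq_inner powr_half_sqrt less_imp_le)
qed

lemma convex_on_cap:
  assumes "0 \<le> l" shows "convex_on UNIV (cap l c :: 'a::real_inner \<Rightarrow> real)"
proof (rule convex_onI)
  \<comment> \<open>A norm composed with an affine map, hence convex.\<close>
  have eq: "sqrt (1 + (norm x)\<^sup>2) = norm (1::real, x)" for x :: 'a by (simp add: norm_Pair)
  fix t :: real and x y :: 'a assume t: "0 < t" "t < 1"
  have "norm (1::real, (1 - t) *\<^sub>R x + t *\<^sub>R y) = norm ((1 - t) *\<^sub>R (1::real, x) + t *\<^sub>R (1::real, y))"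
    by simp
  also have "\<dots> \<le> (1 - t) * norm (1::real, x) + t * norm (1::real, y)"
    using norm_triangle_ineq[of "(1 - t) *\<^sub>R (1::real, x)" "t *\<^sub>R (1::real, y)"] t by (simp only: norm_scaleR)
  finally have "l * norm (1::real, (1 - t) *\<^sub>R x + t *\<^sub>R y) \<le> l * ((1 - t) * norm (1::real, x) + t * norm (1::real, y))"
    using assms by (rule mult_left_mono)
  then show "cap l c ((1 - t) *\<^sub>R x + t *\<^sub>R y) \<le> (1 - t) * cap l c x + t * cap l c y"
    unfolding cap_def eq by (simp add: algebra_simps)
qed simp

lemma norm_le_sqrt_cap: "norm x \<le> sqrt (1 + (norm x)\<^sup>2)"
  by (rule real_le_rsqrt) simp

section \<open>Assembling F and its derivative bounds\<close>

context two_columns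
begin

definition lift :: "real^'n^2 \<Rightarrow> (real^'n^2) \<times> real" where "lift A = (A, det12 j1 j2 A)"

lemma smooth_det12: "smooth (det12 j1 j2)"
proof -
  have "smooth (\<lambda>A::real^'n^2. A $ i $ j)" for i j
    by (intro smooth_bounded_linear bounded_linear_compose[OF bounded_linear_vec_nth bounded_linear_vec_nth])
  then show ?thesis unfolding det12_def[abs_def] by (intro smooth_diff smooth_mult)
qed

lemma smooth_lift:
  assumes "bounded_linear l" shows "smooth (\<lambda>A. l (lift A) :: real)"
proof -
  have l: "l (A, d) = l (A, 0) + l (0, 1) * d" for A d
  proof -
    have "(A, d) = (A, 0) + d *\<^sub>R (0, 1)" by simp
    then show ?thesis
      using linear_add[OF bounded_linear.linear[OF assms]] linear_cmul[OF bounded_linear.linear[OF assms]]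
      by (metis mult.commute real_scaleR_def)
  qed
  have "bounded_linear (\<lambda>A. l (A, 0))"
    by (intro bounded_linear_compose[OF assms] bounded_linear_Pair bounded_linear_ident bounded_linear_zero)
  then show ?thesis unfolding lift_def l[of _ "det12 j1 j2 _"]
    by (intro smooth_add smooth_mult smooth_const smooth_det12 smooth_bounded_linear)
qed

lemma cap_lift: "cap l c (lift A) = l * hnorm A - c"
  by (simp add: cap_def lift_def hnorm_def norm_Pair power2_eq_square algebra_simps)

lemma smooth_hnorm: "smooth hnorm"
  and symb_hnorm_deriv: "symb 1 (\<lambda>A. frechet_derivative hnorm (at A) h)"
proof -
  have s: "symb 1 (\<lambda>A. frechet_derivative hnorm (at A) h)" for h
  proof -
    have 1: "symb 0 (\<lambda>A. (A \<bullet> h) * (1 / hnorm A))" using symb.mult[OF symb.coord symb.inv] by simp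
    have "symb 1 (\<lambda>A. (A \<bullet> h) * (1 / hnorm A) + (det12 j1 j2 A / hnorm A) * (A \<bullet> cof h))"
      using symb.mult[OF symb.ratio symb.coord[of "cof h"]] by (intro symb.add symb.weaken[OF 1]) auto
    then show ?thesis by (simp add: frechet_derivative_eqI[OF has_derivative_hnorm])
  qed
  show "symb 1 (\<lambda>A. frechet_derivative hnorm (at A) h)" by (rule s)
  show "smooth hnorm" unfolding smooth_iff_deriv[of hnorm]
    using s symb_smooth has_derivative_hnorm differentiableI by blast
qed

text \<open>The function itself grows quadratically. After one derivative it lies in
  \<open>symb 1\<close>, and further derivatives do not raise the order.\<close>

lemma graded_part_bound:
  assumes "hs \<noteq> []"
  shows "\<exists>C. \<forall>A. \<bar>iter_dderiv (\<lambda>A. a * (A \<bullet> A) + (l * hnorm A - c)) hs A\<bar> \<le> C * (norm A + 1)"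
proof -
  let ?f = "\<lambda>A. a * (A \<bullet> A) + (l * hnorm A - c)"
  obtain h hs' where hs: "hs = hs' @ [h]" using assms by (cases hs rule: rev_cases) auto
  have "(?f has_derivative (\<lambda>h. (2 * a) * (A \<bullet> h) + l * frechet_derivative hnorm (at A) h)) (at A)" for A
  proof -
    have "((\<lambda>A. a * (A \<bullet> A) + (l * hnorm A - c)) has_derivative
        (\<lambda>h. a * (A \<bullet> h + h \<bullet> A) + (l * frechet_derivative hnorm (at A) h - 0))) (at A)"
      by (intro has_derivative_add has_derivative_diff has_derivative_mult_right has_derivative_inner has_derivative_ident
          has_derivative_const smooth_imp_has_derivative smooth_hnorm)
    then show ?thesis by (rule has_derivative_eq_rhs) (auto simp: inner_commute algebra_simps)
  qed
  then have "(\<lambda>A. frechet_derivative ?f (at A) h) = (\<lambda>A. (2 * a) * (A \<bullet> h) + l * frechet_derivative hnorm (at A) h)"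
    by (intro ext frechet_derivative_eqI)
  moreover have "symb 1 (\<lambda>A. (2 * a) * (A \<bullet> h) + l * frechet_derivative hnorm (at A) h)"
    using symb.mult[OF symb.const symb.coord] symb.mult[OF symb.const symb_hnorm_deriv] by (intro symb.add) simp_all
  ultimately have "symb 1 (iter_dderiv ?f hs)"
    unfolding hs iter_dderiv_snoc by (simp only: symb_iter_dderiv)
  from symb_bound[OF this] show ?thesis by (auto simp: add.commute)
qed

text \<open>For basis directions the bound splits into the explicit part and the compactly supported
  \<open>g\<close>; finitely many basis lists then give one constant for all directions.\<close>

lemma derivative_bounds:
  fixes F :: "real^'n^2 \<Rightarrow> real"
  assumes F: "\<And>A. F A = (a * (A \<bullet> A) + (l * hnorm A - c)) + g A" and g: "smooth g" "\<And>A. R < norm A \<Longrightarrow> g A = 0"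
    and k: "k \<ge> 1"
  shows "\<exists>C>0. \<forall>A hs. length hs = k \<and> (\<forall>h\<in>set hs. norm h \<le> 1) \<longrightarrow> \<bar>iter_dderiv F hs A\<bar> \<le> C * (norm A + 1)"
proof -
  let ?f = "\<lambda>A. a * (A \<bullet> A) + (l * hnorm A - c)"
  have f: "smooth ?f"
    by (intro smooth_add smooth_diff smooth_mult smooth_const smooth_inner_self smooth_hnorm)
  have F': "F = (\<lambda>A. ?f A + g A)" using F by auto
  have sF: "smooth F" unfolding F' using f g(1) by (rule smooth_add)
  let ?B = "{bs. set bs \<subseteq> (Basis :: (real^'n^2) set) \<and> length bs = k}"
  have fin: "finite ?B" by (rule finite_lists_length_eq) simp
  have "\<exists>C. \<forall>A. \<bar>iter_dderiv F bs A\<bar> \<le> C * (norm A + 1)" if bs: "bs \<in> ?B" for bs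
  proof -
    have ne: "bs \<noteq> []" using bs k by auto
    obtain C where C: "\<And>A. \<bar>iter_dderiv ?f bs A\<bar> \<le> C * (norm A + 1)"
      using graded_part_bound[OF ne, of a l c] by blast
    obtain D where D: "\<And>A. \<bar>iter_dderiv g bs A\<bar> \<le> D"
      using smooth_compact_support_bound[OF g] by blast
    have "\<bar>iter_dderiv F bs A\<bar> \<le> (C + \<bar>D\<bar>) * (norm A + 1)" for A
    proof -
      have "\<bar>D\<bar> * 1 \<le> \<bar>D\<bar> * (norm A + 1)" by (intro mult_left_mono) auto
      then show ?thesis
        using C[of A] D[of A] unfolding F' iter_dderiv_add[OF f g(1)] by (simp add: distrib_right)
    qed
    then show ?thesis by blast
  qed
  then have "\<forall>bs\<in>?B. \<exists>C. \<forall>A. \<bar>iter_dderiv F bs A\<bar> \<le> C * (norm A + 1)" by blast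
  from bchoice[OF this] obtain C where C: "\<And>bs A. bs \<in> ?B \<Longrightarrow> \<bar>iter_dderiv F bs A\<bar> \<le> C bs * (norm A + 1)" by blast
  define M where "M = (\<Sum>bs\<in>?B. \<bar>C bs\<bar>)"
  have M: "\<bar>iter_dderiv F bs A\<bar> \<le> M * (norm A + 1)" if "bs \<in> ?B" for bs A
  proof -
    have "C bs \<le> M" unfolding M_def using member_le_sum[of bs ?B "\<lambda>bs. \<bar>C bs\<bar>"] fin that by auto
    then have "C bs * (norm A + 1) \<le> M * (norm A + 1)" by (intro mult_right_mono) auto
    then show ?thesis using C[OF that, of A] by linarith
  qed
  have M0: "M \<ge> 0" by (simp add: M_def sum_nonneg)
  let ?K = "real DIM(real^'n^2) ^ k * M + 1"
  show ?thesis
  proof (intro exI[of _ ?K] conjI allI impI)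
    show "?K > 0" using M0 by (simp add: add_nonneg_pos)
    fix A :: "real^'n^2" and hs :: "(real^'n^2) list" assume hs: "length hs = k \<and> (\<forall>h\<in>set hs. norm h \<le> 1)"
    have "\<bar>iter_dderiv F hs A\<bar> \<le> real DIM(real^'n^2) ^ length hs * (M * (norm A + 1))"
      by (rule iter_dderiv_bound_Basis[OF sF]) (use M hs in auto)
    also have "\<dots> \<le> ?K * (norm A + 1)" using hs by (simp add: algebra_simps)
    finally show "\<bar>iter_dderiv F hs A\<bar> \<le> ?K * (norm A + 1)" .
  qed
qed

lemma polyconvex_function_exists:
  obtains F :: "real^'n^2 \<Rightarrow> real" and G where
    "smooth G" "convex_on UNIV G" "\<And>A. F A = nu / 2 * (norm A)\<^sup>2 + G (A, det12 j1 j2 A)" "smooth F"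
    "\<And>k. k < 5 \<Longrightarrow> \<exists>r>0. \<forall>A\<in>ball (point k) r. F A = level k + grad k \<bullet> (A - point k) + hess k / 2 * (norm (A - point k))\<^sup>2"
    "\<And>k. k \<ge> 1 \<Longrightarrow> \<exists>C>0. \<forall>A hs. length hs = k \<and> (\<forall>h\<in>set hs. norm h \<le> 1) \<longrightarrow> \<bar>iter_dderiv F hs A\<bar> \<le> C * (norm A + 1)"
proof -
  define S where "S = (\<Sum>i<5. \<Sum>j<5. trunc abs i (point j - point i))"
  have S: "trunc abs i (point j - point i) \<le> S" "0 \<le> S" if "i < 5" "j < 5" for i j
  proof -
    have "trunc abs i (point j - point i) \<le> (\<Sum>j<5. trunc abs i (point j - point i))"
      using that by (intro member_le_sum[of j]) (auto intro: trunc_abs_nonneg)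
    also have "\<dots> \<le> S" unfolding S_def
      using that by (intro member_le_sum[of i "{..<5}" "\<lambda>i. \<Sum>j<5. trunc abs i (point j - point i)"]) (auto intro!: sum_nonneg trunc_abs_nonneg)
    finally show "trunc abs i (point j - point i) \<le> S" .
    then show "0 \<le> S" using trunc_abs_nonneg[OF that(1)] order_trans by blast
  qed
  \<comment> \<open>Then 2 tau S = S / (100 (1 + S)), at most 1/100, which bounds every correction
    at every other point.\<close>
  define \<tau> where "\<tau> = 1 / (200 * (1 + S))"
  have \<tau>: "\<tau> > 0" "2 * \<tau> * S \<le> 1/100" using S(2)[of 0 0] by (auto simp: \<tau>_def field_simps)
  obtain q :: "real \<Rightarrow> real" where q: "smooth q" "convex_on UNIV q"
    "\<And>s. \<bar>s\<bar> \<le> \<tau> \<Longrightarrow> q s = s\<^sup>2 / 2" "\<And>s. q s \<le> 2 * \<tau> * \<bar>s\<bar>"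
    using smooth_truncated_square_exists[OF \<tau>(1)] by blast
  have q0: "q 0 = 0" using q(3)[of 0] \<tau>(1) by simp
  obtain \<psi> :: "real \<Rightarrow> real" where \<psi>: "smooth \<psi>" "convex_on UNIV \<psi>" "mono \<psi>" "mono (\<lambda>t. t - \<psi> t)"
    "\<And>t. t \<le> - (1/100) \<Longrightarrow> \<psi> t = 0" "\<And>t. 1/100 \<le> t \<Longrightarrow> \<psi> t = t"
    by (rule smooth_positive_part_exists[of "1/100"]) auto
  have "\<exists>a b. 0 \<le> b \<and> (\<forall>x. piece q k x \<le> a + b * norm x)" if "k < 5" for k
    using ridge_linear_growth[OF ridge_piece[OF that] q(4)] \<tau>(1) by simp
  then obtain a b where ab: "\<And>k. k < 5 \<Longrightarrow> 0 \<le> b k" "\<And>k x. k < 5 \<Longrightarrow> piece q k x \<le> a k + b k * norm x" by metis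
  define l where "l = 1 + (\<Sum>k<5. b k)"
  have l: "b k + 1 \<le> l" "0 \<le> l" if "k < 5" for k
  proof -
    show "b k + 1 \<le> l" unfolding l_def using that ab(1) member_le_sum[of k "{..<5}" b] by simp
    then show "0 \<le> l" using ab(1)[OF that] by linarith
  qed
  \<comment> \<open>Lowers the cap by at least 1 below each piece at its own point, while the choice
    of \<open>l\<close> keeps it steeper than all pieces at infinity.\<close>
  define c where "c = 1 + (\<Sum>k<5. \<bar>cap l 0 (lift (point k)) - piece q k (lift (point k))\<bar>)"
  have base_below: "cap l c (lift (point k)) + 1 \<le> piece q k (lift (point k))" if "k < 5" for k
  proof -
    have "cap l 0 (lift (point k)) - piece q k (lift (point k)) \<le> c - 1"
      using that member_le_sum[of k "{..<5}" "\<lambda>k. \<bar>cap l 0 (lift (point k)) - piece q k (lift (point k))\<bar>"] by (simp add: c_def)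
    then show ?thesis by (simp add: cap_def)
  qed
  define G where "G = glue \<psi> (piece q) (cap l c) 5"
  define F where "F A = nu / 2 * (norm A)\<^sup>2 + G (lift A)" for A
  define g where "g A = G (lift A) - cap l c (lift A)" for A
  have sG: "smooth G" unfolding G_def
    by (intro smooth_glue \<psi>(1) smooth_cap) 
       (use ridge_smooth_compose[OF ridge_piece q(1), of _ "\<lambda>x. x"] smooth_bounded_linear in auto)
  have cG: "convex_on UNIV G" unfolding G_def
    by (intro convex_on_glue \<psi> convex_on_cap l(2)[of 0] ridge_convex[OF ridge_piece q(2)]) auto
  have s_cap: "smooth (\<lambda>A. cap l c (lift A))"
    unfolding cap_lift by (intro smooth_diff smooth_mult smooth_const smooth_hnorm)
  have sGl: "smooth (\<lambda>A. G (lift A))" unfolding G_def glue_compose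
    by (rule smooth_glue[unfolded eta_contract_eq]) (use \<psi>(1) s_cap ridge_smooth_compose[where p = lift, OF ridge_piece q(1) smooth_lift] in auto)
  have sF: "smooth F" unfolding F_def[abs_def] power2_norm_eq_inner
    by (intro smooth_add smooth_mult smooth_const smooth_inner_self sGl)
  have sg: "smooth g" unfolding g_def[abs_def] by (intro smooth_diff sGl s_cap)
  \<comment> \<open>Beyond \<open>R\<close> the surplus slope 1 of the cap outweighs
    \<open>a k\<close>, \<open>c\<close> and the tolerance 1/100.\<close>
  define R where "R = (\<Sum>k<5. \<bar>a k\<bar>) + \<bar>c\<bar> + 1"
  have g0: "g A = 0" if "R < norm A" for A
  proof -
    have "piece q k (lift A) + 1/100 \<le> cap l c (lift A)" if k: "k < 5" for k
    proof -
      have "norm A \<le> norm (lift A)" unfolding lift_def by (rule norm_fst_le)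
      then have "R < norm (lift A)" using \<open>R < norm A\<close> by simp
      moreover have "a k \<le> (\<Sum>k<5. \<bar>a k\<bar>)" using k member_le_sum[of k "{..<5}" "\<lambda>k. \<bar>a k\<bar>"] by simp
      ultimately have "a k + b k * norm (lift A) + 1/100 \<le> (b k + 1) * norm (lift A) - c"
        by (simp add: R_def algebra_simps)
      also have "\<dots> \<le> l * norm (lift A) - c" using l(1)[OF k] by (simp add: mult_right_mono)
      also have "\<dots> \<le> cap l c (lift A)" unfolding cap_def
        using mult_left_mono[OF norm_le_sqrt_cap l(2)[OF k]] by simp
      finally show ?thesis using ab(2)[OF k, of "lift A"] by linarith
    qed
    then have "G (lift A) = cap l c (lift A)" unfolding G_def by (intro glue_eq_base \<psi>) auto
    then show ?thesis by (simp add: g_def)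
  qed
  have quad: "\<exists>r>0. \<forall>A\<in>ball (point k) r. F A = level k + grad k \<bullet> (A - point k) + hess k / 2 * (norm (A - point k))\<^sup>2"
    if k: "k < 5" for k
  proof -
    have nhds: "(f \<longlongrightarrow> f A) (nhds A)" if "smooth f" for f :: "real^'n^2 \<Rightarrow> real" and A
      using smooth_imp_continuous_on[OF that, of UNIV]
      by (simp add: continuous_on_eq_continuous_at isCont_def tendsto_at_iff_tendsto_nhds)
    have cont: "((\<lambda>A. piece q i (lift A)) \<longlongrightarrow> piece q i (lift A)) (nhds A)" if "i < 5" for A i
      by (rule nhds[OF ridge_smooth_compose[where p = lift, OF ridge_piece[OF that] q(1) smooth_lift]])
    have cont_cap: "((\<lambda>A. cap l c (lift A)) \<longlongrightarrow> cap l c (lift A)) (nhds A)" for A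
      by (rule nhds[OF s_cap])
    \<comment> \<open>1/5 minus the correction 1/100 still exceeds 1/10.\<close>
    have gap: "piece q i (lift (point k)) + 1/10 \<le> piece q k (lift (point k))" if i: "i < 5" "i \<noteq> k" for i
    proof -
      have "trunc q i (point k - point i) \<le> 2 * \<tau> * S"
        using trunc_le[OF i(1) q(4), of "point k - point i"] S(1)[OF i(1) k] \<tau>(1)
        by (meson mult_left_mono order_trans less_imp_le mult_nonneg_nonneg zero_le_numeral)
      then show ?thesis
        using polyconvexity_gap[OF i(1) k i(2)] piece_on_graph[of "point k" q i] piece_on_graph[of "point k" q k] \<tau>(2)
        by (simp add: lift_def trunc_at_0[where q = q, OF q0] det12_def)
    qed
    \<comment> \<open>The lead 5/100 is five pieces times the tolerance 1/100, as
      \<open>glue_eq_dominant\<close> requires.\<close>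
    have "\<forall>\<^sub>F A in nhds (point k). \<forall>i\<in>{..<5} - {k}. piece q k (lift A) - piece q i (lift A) > 5/100"
    proof (intro eventually_ball_finite ballI)
      fix i assume "i \<in> {..<5} - {k}"
      then show "\<forall>\<^sub>F A in nhds (point k). piece q k (lift A) - piece q i (lift A) > 5/100"
        using cont[OF k] cont[of i] gap[of i]
        by (intro order_tendstoD(1)[where y = "piece q k (lift (point k)) - piece q i (lift (point k))"] tendsto_diff)
           auto
    qed simp
    moreover have "\<forall>\<^sub>F A in nhds (point k). piece q k (lift A) - cap l c (lift A) > 5/100"
      using cont[OF k] cont_cap base_below[OF k]
      by (intro order_tendstoD(1)[where y = "piece q k (lift (point k)) - cap l c (lift (point k))"] tendsto_diff)
         auto
    moreover have "\<forall>\<^sub>F A in nhds (point k). dist A (point k) < \<tau> / 2"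
      unfolding eventually_nhds_metric using \<tau>(1) by (intro exI[of _ "\<tau> / 2"]) simp
    ultimately have "\<forall>\<^sub>F A in nhds (point k). F A = level k + grad k \<bullet> (A - point k) + hess k / 2 * (norm (A - point k))\<^sup>2"
    proof eventually_elim
      case (elim A)
      have "G (lift A) = piece q k (lift A)" unfolding G_def
      proof (rule glue_eq_dominant[where e = "1/100", OF \<psi>(3,5,6)])
        show "piece q i (lift A) + real 5 * (1/100) \<le> piece q k (lift A)" if "i < 5" "i \<noteq> k" for i
          using bspec[OF elim(1), of i] that by auto
      qed (use elim(2) k in auto)
      moreover have "trunc q k (A - point k) = (hess k - nu) / 2 * (norm (A - point k))\<^sup>2 - weight k * det12 j1 j2 (A - point k)"
        using elim(3) q(3) by (intro trunc_quadratic[OF k, of \<tau>]) (auto simp: dist_norm)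
      ultimately show ?case
        using piece_on_graph[of A q k] by (simp add: F_def lift_def algebra_simps diff_divide_distrib)
    qed
    then show ?thesis by (auto simp: eventually_nhds_metric dist_commute)
  qed
  have F_split: "F A = (nu / 2 * (A \<bullet> A) + (l * hnorm A - c)) + g A" for A
    by (simp add: F_def g_def cap_lift power2_norm_eq_inner)
  show ?thesis
  proof (rule that[OF sG cG _ sF quad])
    show "F A = nu / 2 * (norm A)\<^sup>2 + G (A, det12 j1 j2 A)" for A by (simp add: F_def lift_def)
    show "\<exists>C>0. \<forall>A hs. length hs = k \<and> (\<forall>h\<in>set hs. norm h \<le> 1) \<longrightarrow> \<bar>iter_dderiv F hs A\<bar> \<le> C * (norm A + 1)"
      if "k \<ge> 1" for k
      by (rule derivative_bounds[OF F_split sg g0 that])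
  qed
qed

end

theorem theorem2p2:
  fixes j1 j2 :: "'n::finite"
  assumes "j1 \<noteq> j2"
  shows "\<exists>(F :: real^'n^2 \<Rightarrow> real) (\<nu>::real) (G :: (real^'n^2) \<times> real \<Rightarrow> real)
            (\<sigma> :: real^'n^2 \<Rightarrow> real^'n^2).
     \<nu> > 0 \<and> smooth G \<and> convex_on UNIV G \<and>
     (\<forall>A. F A = \<nu> / 2 * (norm A)\<^sup>2 + G (A, det12 j1 j2 A)) \<and>
     (\<forall>A. (F has_derivative (\<lambda>H. \<sigma> A \<bullet> H)) (at A)) \<and>
     condition_O 5 \<sigma> \<and>
     (\<forall>k::nat. k \<ge> 1 \<longrightarrow> (\<exists>C>0. \<forall>A hs. length hs = k \<and> (\<forall>h\<in>set hs. norm h \<le> 1) \<longrightarrow>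
          \<bar>iter_dderiv F hs A\<bar> \<le> C * (norm A + 1)))"
proof -
  interpret two_columns j1 j2 by unfold_locales (rule assms)
  obtain F :: "real^'n^2 \<Rightarrow> real" and G where F:
    "smooth G" "convex_on UNIV G" "\<And>A. F A = nu / 2 * (norm A)\<^sup>2 + G (A, det12 j1 j2 A)" "smooth F"
    "\<And>k. k < 5 \<Longrightarrow> \<exists>r>0. \<forall>A\<in>ball (point k) r. F A = level k + grad k \<bullet> (A - point k) + hess k / 2 * (norm (A - point k))\<^sup>2"
    "\<And>k. k \<ge> 1 \<Longrightarrow> \<exists>C>0. \<forall>A hs. length hs = k \<and> (\<forall>h\<in>set hs. norm h \<le> 1) \<longrightarrow> \<bar>iter_dderiv F hs A\<bar> \<le> C * (norm A + 1)"
    by (rule polyconvex_function_exists) blast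
  \<comment> \<open>The Riesz representative of the derivative in the Frobenius inner product; its
    continuity is that of finitely many directional derivatives.\<close>
  define \<sigma> where "\<sigma> A = (\<Sum>b\<in>Basis. frechet_derivative F (at A) b *\<^sub>R b)" for A
  have inner: "\<sigma> A \<bullet> H = frechet_derivative F (at A) H" for A H
  proof -
    have lin: "linear (frechet_derivative F (at A))"
      using smooth_imp_has_derivative[OF F(4)] has_derivative_linear by blast
    have "frechet_derivative F (at A) H = frechet_derivative F (at A) (\<Sum>b\<in>Basis. (H \<bullet> b) *\<^sub>R b)"
      by (simp add: euclidean_representation)
    also have "\<dots> = (\<Sum>b\<in>Basis. (H \<bullet> b) * frechet_derivative F (at A) b)"
      by (simp add: linear_sum[OF lin] linear_cmul[OF lin])
    finally show ?thesis unfolding \<sigma>_def inner_sum_left inner_scaleR_left by (simp add: inner_commute mult.commute)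
  qed
  have der: "(F has_derivative (\<lambda>H. \<sigma> A \<bullet> H)) (at A)" for A
    unfolding inner using smooth_imp_has_derivative[OF F(4)] by simp
  have cont: "continuous_on UNIV \<sigma>" unfolding \<sigma>_def[abs_def]
    by (intro continuous_on_sum continuous_on_scaleR continuous_on_const smooth_imp_continuous_on smooth_imp_deriv F(4))
  have "\<exists>r>0. \<forall>k<5. \<forall>A\<in>ball (point k) r. F A = level k + grad k \<bullet> (A - point k) + hess k / 2 * (norm (A - point k))\<^sup>2"
    by (rule uniform_radius) (use F(5) in auto)
  then obtain r where r: "r > 0" "\<And>k A. k < 5 \<Longrightarrow> A \<in> ball (point k) r \<Longrightarrow>
      F A = level k + grad k \<bullet> (A - point k) + hess k / 2 * (norm (A - point k))\<^sup>2" by blast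
  \<comment> \<open>Half the radius keeps the closed ball inside the open one where F is quadratic,
    so the derivatives agree.\<close>
  have aff: "\<sigma> A = hess k *\<^sub>R A + offset k" if k: "k < 5" and A: "norm (A - point k) \<le> r / 2" for k A
  proof -
    let ?Q = "\<lambda>A. level k + grad k \<bullet> (A - point k) + hess k / 2 * ((A - point k) \<bullet> (A - point k))"
    have "(?Q has_derivative (\<lambda>H. 0 + grad k \<bullet> (H - 0) + hess k / 2 * ((A - point k) \<bullet> (H - 0) + (H - 0) \<bullet> (A - point k)))) (at A)"
      by (intro has_derivative_add has_derivative_const has_derivative_mult_right has_derivative_inner has_derivative_diff
          has_derivative_ident bounded_linear.has_derivative[OF bounded_linear_inner_right])
    then have "(F has_derivative (\<lambda>H. 0 + grad k \<bullet> (H - 0) + hess k / 2 * ((A - point k) \<bullet> (H - 0) + (H - 0) \<bullet> (A - point k)))) (at A)"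
      by (rule has_derivative_transform_within_open[OF _ open_ball[of "point k" r]])
         (use r(1) A in \<open>auto simp: dist_norm norm_minus_commute r(2)[OF k] power2_norm_eq_inner\<close>)
    from has_derivative_unique[OF der this]
    have "\<sigma> A \<bullet> H = (grad k + hess k *\<^sub>R (A - point k)) \<bullet> H" for H
      by (drule_tac fun_cong[of _ _ H]) (simp add: inner_add_left inner_add_right inner_commute)
    then have "\<sigma> A = grad k + hess k *\<^sub>R (A - point k)" by (metis vector_eq_rdot)
    then show ?thesis by (simp add: offset_def algebra_simps)
  qed
  have "condition_O 5 \<sigma>"
    using condition_O_if_affine_near_points[OF cont, of "r / 2"] r(1) aff by auto
  then show ?thesis
    using F der by (intro exI[of _ F] exI[of _ nu] exI[of _ G] exI[of _ \<sigma>]) (auto simp: nu_def)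
qed

end
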